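(* Let $\mathcal{T}$ be a rooted binary tree with $h\ge2$ leaves. 1. The set $\{Q_{\mathrm{c}}(\,\cdot\,;\alpha_1,\dots,\alpha_h,N|q):0\le n\le N,\ \mathrm{c}\in \mathrm{CL}(\mathcal{T},n)\}$ is an orthogonal basis for $V_{h,N}$. 2. For $0\le n\le N$, the set $\{Q_{\mathrm{c}}(\,\cdot\,;\alpha_1,\dots,\alpha_h,N|q):\mathrm{c}\in \mathrm{CL}(\mathcal{T},n)\}$ is an orthogonal basis for $\mathcal{R}_{N-1}\mathcal{R}_{N-2}\cdots\mathcal{R}_n[\mathrm{Ker}\,\mathcal{L}_n]$, that is, for the eigenspace of $\mathcal{D}_N$ corresponding to the eigenvalue $q^{-n}(1-q^n)(1-A_hq^{h+n-1})$. 3. For $\mathrm{c}\in\mathrm{CL}(\mathcal{T},n)$, $0\le n\le N$, $$\| Q_{\mathrm{c}}(\,\cdot\,;\alpha_1,\dots,\alpha_h,N|q)\|_{V_{h,N}}^2=\frac{(A_h q^{h+2n};q)_{N-n}}{(q;q)_{N-n}}\,q^{[(N-2n)^2+N+2n-2n^2]/2}\prod_{U\in\mathcal{T}}\Gamma(U).$$ 4. The polynomials $Q_{\mathrm{c}}(\,\cdot\,;\alpha_1,\dots,\alpha_h,N|q)$, $\mathrm{c}\in \mathrm{CL}(\mathcal{T},n)$, satisfy $$Q_{\mathrm{c}}(\mathbf{x};\alpha_1,\dots,\alpha_h,N|q)=\frac{q^{(N-n)(N-n+1)/2}}{(q;q)_{N-n}}\,\mathcal{R}_{N-1}\mathcal{R}_{N-2}\cdots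 \mathcal{R}_n\,Q_{\mathrm{c}}(\mathbf{x};\alpha_1,\dots,\alpha_h,n|q).$$
   Context: Let $0<q<1$, let $h\ge2$ and $N\ge1$ be integers, and let $\alpha_1,\dots,\alpha_h$ be real numbers such that either $0<\alpha_i<q^{-1}$ for all $i$, or $\alpha_i>q^{-N}$ for all $i$. Write $(a;q)_k=\prod_{j=0}^{k-1}(1-aq^j)$ and $(a,b,c;q)_k=(a;q)_k(b;q)_k(c;q)_k$. Spaces and operators. For $M\ge 0$, $[h;M]$ is the set of $\mathbf{x}=(x_1,\dots,x_h)$ with $x_i$ nonnegative integers and $x_1+\cdots+x_h=M$; $V_{h,M}$ is the space of complex functions on $[h;M]$. Put $X_k=x_1+\cdots+x_k$, $A_k=\alpha_1\cdots\alpha_k$, $X_0=0$, $A_0=1$. $\epsilon_j^{\pm}$ replaces $x_j$ by $x_j\pm1$; $[i<j]=1$ if $i<j$, else $0$; values of functions outside their domain are $0$. For $M\le N$, $$\langle f_1,f_2 \rangle_{V_{h,M}}=q^{M(M+1)/2}\sum_{\mathbf{x}\in [h;M]}\prod_{i=1}^h\left[\frac{(q\alpha_i;q)_{x_i}}{(q;q)_{x_i}}(\alpha_i q)^{M-X_i}\right]f_1(\mathbf{x})\overline{f_2(\mathbf{x})},$$ and $\|f\|^2=\langle f,f\rangle$ (in the case $\alpha_i>q^{-N}$ the form is definite with sign $(-1)^M$). The operators $\mathcal{R}_M:V_{h,M}\to V_{h,M+1}$, $\mathcal{L}_M:V_{h,M}\to V_{h,M-1}$, $\mathcal{D}_M:V_{h,M}\to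 V_{h,M}$ are $$\mathcal{R}_Mf(\mathbf{x})=\sum_{i=1}^hq^{X_{i-1}-M-1}(1-q^{x_i})f(\epsilon_i^-(\mathbf{x})),\qquad \mathcal{L}_Mf(\mathbf{x})=\sum_{j=1}^hA_{j-1}q^{j-1+X_{j-1}}(\alpha_jq^{x_j+1}-1)f(\epsilon_j^+(\mathbf{x})),$$ $$\mathcal{D}_Mf(\mathbf{x})=\sum_{\substack{i,j=1\\ i\ne j}}^hA_{j-1}q^{j-1+X_{j-1}+X_{i-1}-M-[i<j]}(\alpha_jq^{x_j+1}-1)(1-q^{x_i})f(\epsilon_i^-\epsilon_j^+(\mathbf{x}))$$ $$\qquad+\Bigl\{\sum_{j=1}^hA_{j-1}q^{j-1+2X_{j-1}-M}(\alpha_jq^{x_j}-1)(1-q^{x_j})+(A_hq^{h+M-1}-1)(1-q^{-M})\Bigr\}f(\mathbf{x}),$$ with $V_{h,-1}=\{0\}$, $\mathcal{L}_0=0$; for $n=N$ the product $\mathcal{R}_{N-1}\cdots\mathcal{R}_n$ is the identity. One-variable $q$-Hahn polynomials. For $0\le n\le N'$, $0\le x\le N'$, $$Q_n(x;\alpha,\beta,N'|q)=q^{-nN'+n^2/2}\frac{(q;q)_{N'}}{(q;q)_{N'-n}}\sum_{k=0}^{n}\frac{(q^{-n};q)_k(\alpha\beta q^{n+1};q)_k(q^{-x};q)_k}{(\alpha q;q)_k(q^{-N'};q)_k(q;q)_k}\,q^k.$$ Trees. A rooted binary tree is a planar rooted tree in which every vertex is either a leaf or has exactly two sons (a left one and a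 right one); a single vertex is allowed as a subtree. Non-leaf vertices are called internal. Let $\mathcal{T}$ have $h$ leaves, numbered $1,\dots,h$ from left to right; leaf $k$ carries the parameter $\alpha_k$ and the variable $x_k$. If the leaves descending from a vertex $U$ (or $U$ itself, if it is a leaf) are $l+1,\dots,m$, set $\mathrm{p}(U)=\alpha_{l+1}\cdots\alpha_m q^{m-l}$. If $U$ is internal with left son $X$ and right son $Y$, set $\mathrm{lp}(U)=\mathrm{p}(X)$, $\mathrm{rp}(U)=\mathrm{p}(Y)$. A coefficients labeling $\mathrm{c}$ of $\mathcal{T}$ assigns a nonnegative integer $\mathrm{c}(U)$ to each internal vertex $U$ and $0$ to each leaf; $\mathrm{CL}(\mathcal{T},n)$ is the set of those with $\sum_{U\in\mathcal{T}}\mathrm{c}(U)=n$. $\mathrm{lcs}(U)$ (resp. $\mathrm{rcs}(U)$) is the sum of the labels of all vertices of the subtree rooted at the left (resp. right) son of $U$, and $\mathrm{cs}(U)=\mathrm{c}(U)+\mathrm{lcs}(U)+\mathrm{rcs}(U)$. Multidimensional $q$-Hahn polynomials. Let $\mathcal{T}',\mathcal{T}''$ be the subtrees rooted at the left and right son of the root, $t$ the number of leaves of $\mathcal{T}'$, $\mathrm{c}\in\mathrm{CL}(\mathcal{T},n)$, $\mathrm{c}',\mathrm{c}''$ its restrictions to $\mathcal{T}',\mathcal{T}''$, and $i,j$ the sums of the labels in $\mathcal{T}'$, $\mathcal{T}''$ (so the root has label $n-i-j$). With $\mathbf{x}'=(x_1,\dots,x_t)$, $\mathbf{x}''=(x_{t+1},\dots,x_h)$,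 define recursively, for $\mathbf{x}\in[h;X_h]$, $$Q_{\mathrm{c}}(\mathbf{x};\alpha_1,\dots,\alpha_h,X_h|q)=q^{-jX_t}Q_{n-i-j}(X_t-i;A_tq^{t+2i-1},A_hA_t^{-1}q^{h-t+2j-1},X_h-i-j|q)$$ $$\qquad\times Q_{\mathrm{c}'}(\mathbf{x}';\alpha_1,\dots,\alpha_t,X_t|q)\,Q_{\mathrm{c}''}(\mathbf{x}'';\alpha_{t+1},\dots,\alpha_h,X_h-X_t|q)$$ if $X_h\ge n$, $X_t\ge i$, $X_h-X_t\ge j$, and $Q_{\mathrm{c}}=0$ otherwise; for a single-vertex tree the polynomial is the constant $1$. The function $\Gamma$ (depending on $\mathrm{c}$): $\Gamma(U)=1$ if $U$ is a leaf and, for $U$ internal, $$\Gamma(U)=\frac{\bigl(q,\ \mathrm{p}(U)q^{\mathrm{cs}(U)+\mathrm{lcs}(U)+\mathrm{rcs}(U)-1},\ \mathrm{rp}(U)q^{2\mathrm{rcs}(U)};q\bigr)_{\mathrm{c}(U)}}{(\mathrm{lp}(U)q^{2\mathrm{lcs}(U)};q)_{\mathrm{c}(U)}}\bigl[\mathrm{lp}(U)q^{2\mathrm{lcs}(U)}\bigr]^{\mathrm{c}(U)+\mathrm{rcs}(U)}q^{-2\mathrm{lcs}(U)\mathrm{rcs}(U)-\mathrm{c}(U)}.$$ *)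

theory Defs
  imports Complex_Main "HOL-Library.Function_Algebras" "HOL-Library.Tree"
begin

global_interpretation cfun: vector_space "\<lambda>(c::complex) (f::'a \<Rightarrow> complex) x. c * f x"
  by unfold_locales (simp_all add: fun_eq_iff algebra_simps)

text \<open>
  An orthogonal basis of a space \<open>W\<close> of complex functions, given as a family \<open>b\<close> indexed by \<open>I\<close>,
  with respect to a form. The form is arbitrary here (those used below may be negative definite), so
  independence does not follow from orthogonality and is required separately.
\<close>
definition orthogonal_basis ::
  "(('a \<Rightarrow> complex) \<Rightarrow> ('a \<Rightarrow> complex) \<Rightarrow> complex) \<Rightarrow> ('a \<Rightarrow> complex) set \<Rightarrow>
    ('i \<Rightarrow> 'a \<Rightarrow> complex) \<Rightarrow> 'i set \<Rightarrow> bool" where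
  "orthogonal_basis form W b I \<longleftrightarrow>
    inj_on b I \<and> cfun.independent (b ` I) \<and> cfun.span (b ` I) = W \<and>
    (\<forall>c\<in>I. \<forall>d\<in>I. c \<noteq> d \<longrightarrow> form (b c) (b d) = 0)"

definition qpoch :: "real \<Rightarrow> real \<Rightarrow> nat \<Rightarrow> real" where
  "qpoch q a k = (\<Prod>j<k. 1 - a * q ^ j)"


subsection \<open>Spaces and operators\<close>

text \<open>
  A point \<open>(x\<^sub>1, \<dots>, x\<^sub>h)\<close> is a function \<open>nat \<Rightarrow> nat\<close> that vanishes outside \<open>{1..h}\<close>; a function on
  \<open>[h;M]\<close> is extended by 0 to all of \<open>nat \<Rightarrow> nat\<close>. The parameters are indexed by \<open>{1..h}\<close> too.
\<close>
definition grid :: "nat \<Rightarrow> nat \<Rightarrow> (nat \<Rightarrow> nat) set" where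
  "grid h M = {x. (\<forall>i. i \<notin> {1..h} \<longrightarrow> x i = 0) \<and> (\<Sum>i=1..h. x i) = M}"

type_synonym gfun = "(nat \<Rightarrow> nat) \<Rightarrow> complex"

definition V :: "nat \<Rightarrow> nat \<Rightarrow> gfun set" where
  "V h M = {f. \<forall>x. x \<notin> grid h M \<longrightarrow> f x = 0}"

definition psum :: "(nat \<Rightarrow> nat) \<Rightarrow> nat \<Rightarrow> nat" where
  "psum x k = (\<Sum>i=1..k. x i)"

definition pprod :: "(nat \<Rightarrow> real) \<Rightarrow> nat \<Rightarrow> real" where
  "pprod \<alpha> k = (\<Prod>i=1..k. \<alpha> i)"

text \<open>
  When \<open>x i = 0\<close> the truncated subtraction gives \<open>eps_minus i x = x\<close>, but every occurrence in the
  operators below carries the factor \<open>1 - q ^ x i = 0\<close>.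
\<close>
definition eps_minus :: "nat \<Rightarrow> (nat \<Rightarrow> nat) \<Rightarrow> nat \<Rightarrow> nat" where
  "eps_minus i x = x(i := x i - 1)"

definition eps_plus :: "nat \<Rightarrow> (nat \<Rightarrow> nat) \<Rightarrow> nat \<Rightarrow> nat" where
  "eps_plus j x = x(j := x j + 1)"

definition V_form :: "real \<Rightarrow> nat \<Rightarrow> (nat \<Rightarrow> real) \<Rightarrow> nat \<Rightarrow> gfun \<Rightarrow> gfun \<Rightarrow> complex" where
  "V_form q h \<alpha> M f1 f2 =
    of_real (q ^ (M * (M + 1) div 2)) *
    (\<Sum>x\<in>grid h M.
      of_real (\<Prod>i=1..h. qpoch q (q * \<alpha> i) (x i) / qpoch q q (x i) * (\<alpha> i * q) ^ (M - psum x i))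
      * f1 x * cnj (f2 x))"

definition R_op :: "real \<Rightarrow> nat \<Rightarrow> nat \<Rightarrow> gfun \<Rightarrow> gfun" where
  "R_op q h M f = (\<lambda>x. if x \<in> grid h (M + 1) then
    (\<Sum>i=1..h. of_real (q powi (int (psum x (i - 1)) - int M - 1) * (1 - q ^ x i)) * f (eps_minus i x))
    else 0)"

definition L_op :: "real \<Rightarrow> nat \<Rightarrow> (nat \<Rightarrow> real) \<Rightarrow> nat \<Rightarrow> gfun \<Rightarrow> gfun" where
  "L_op q h \<alpha> M f = (\<lambda>x. if M > 0 \<and> x \<in> grid h (M - 1) then
    (\<Sum>j=1..h. of_real (pprod \<alpha> (j - 1) * q ^ (j - 1 + psum x (j - 1)) * (\<alpha> j * q ^ (x j + 1) - 1))
      * f (eps_plus j x))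
    else 0)"

definition D_op :: "real \<Rightarrow> nat \<Rightarrow> (nat \<Rightarrow> real) \<Rightarrow> nat \<Rightarrow> gfun \<Rightarrow> gfun" where
  "D_op q h \<alpha> M f = (\<lambda>x. if x \<in> grid h M then
    (\<Sum>i=1..h. \<Sum>j\<in>{1..h} - {i}.
      of_real (pprod \<alpha> (j - 1)
        * q powi (int (j - 1) + int (psum x (j - 1)) + int (psum x (i - 1)) - int M
                  - (if i < j then 1 else 0))
        * (\<alpha> j * q ^ (x j + 1) - 1) * (1 - q ^ x i))
      * f (eps_minus i (eps_plus j x)))
    + of_real ((\<Sum>j=1..h. pprod \<alpha> (j - 1) * q powi (int (j - 1) + 2 * int (psum x (j - 1)) - int M)
                  * (\<alpha> j * q ^ x j - 1) * (1 - q ^ x j))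
               + (pprod \<alpha> h * q powi (int h + int M - 1) - 1) * (1 - q powi (- int M)))
      * f x
    else 0)"

text \<open>The composition \<open>R\<^bsub>N-1\<^esub> \<circ> \<dots> \<circ> R\<^bsub>n\<^esub>\<close>; \<open>fold\<close> applies \<open>R\<^bsub>n\<^esub>\<close> first.\<close>
definition R_chain :: "real \<Rightarrow> nat \<Rightarrow> nat \<Rightarrow> nat \<Rightarrow> gfun \<Rightarrow> gfun" where
  "R_chain q h n N f = fold (R_op q h) [n..<N] f"

definition Ker_L :: "real \<Rightarrow> nat \<Rightarrow> (nat \<Rightarrow> real) \<Rightarrow> nat \<Rightarrow> gfun set" where
  "Ker_L q h \<alpha> n = {f \<in> V h n. L_op q h \<alpha> n f = 0}"

definition eigenspace_D :: "real \<Rightarrow> nat \<Rightarrow> (nat \<Rightarrow> real) \<Rightarrow> nat \<Rightarrow> real \<Rightarrow> gfun set" where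
  "eigenspace_D q h \<alpha> N ev = {f \<in> V h N. D_op q h \<alpha> N f = (\<lambda>x. of_real ev * f x)}"


subsection \<open>One-variable $q$-Hahn polynomials\<close>

definition qhahn :: "real \<Rightarrow> nat \<Rightarrow> nat \<Rightarrow> real \<Rightarrow> real \<Rightarrow> nat \<Rightarrow> real" where
  "qhahn q n x \<alpha> \<beta> N =
    q powr (real n ^ 2 / 2 - real n * real N) * (qpoch q q N / qpoch q q (N - n)) *
    (\<Sum>k=0..n. qpoch q (q powi (- int n)) k * qpoch q (\<alpha> * \<beta> * q ^ (n + 1)) k
                * qpoch q (q powi (- int x)) k
              / (qpoch q (\<alpha> * q) k * qpoch q (q powi (- int N)) k * qpoch q q k) * q ^ k)"


subsection \<open>Trees and labelings\<close>

text \<open>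
  A rooted binary tree is a \<open>unit tree\<close>; \<open>Leaf\<close> is a leaf, \<open>Node\<close> an internal vertex with its left and
  right son, and \<open>size1\<close> counts the leaves. A coefficients labeling of \<open>T\<close> is a \<open>nat tree\<close> of the
  same shape, carrying at each node the label of that vertex; leaves implicitly have label 0.
\<close>
fun cs :: "nat tree \<Rightarrow> nat" where
  "cs Leaf = 0"
| "cs (Node l k r) = k + cs l + cs r"

definition CL :: "unit tree \<Rightarrow> nat \<Rightarrow> nat tree set" where
  "CL T n = {c. map_tree (\<lambda>_. ()) c = T \<and> cs c = n}"

text \<open>
  All vertices of a labelled tree whose leaves are numbered \<open>l+1, l+2, \<dots>\<close>: a vertex \<open>U\<close> is given by
  the subtree rooted at it and the number of leaves to the left of that subtree.
\<close>
fun vertices :: "nat \<Rightarrow> nat tree \<Rightarrow> (nat \<times> nat tree) list" where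
  "vertices l Leaf = [(l, Leaf)]"
| "vertices l (Node X k Y) = (l, Node X k Y) # vertices l X @ vertices (l + size1 X) Y"

text \<open>
  The number \<open>p(U)\<close> for the vertex \<open>(l, U)\<close>, whose leaves are \<open>l+1, \<dots>, l + size1 U\<close>.
\<close>
definition pv :: "real \<Rightarrow> (nat \<Rightarrow> real) \<Rightarrow> nat \<Rightarrow> nat tree \<Rightarrow> real" where
  "pv q \<alpha> l U = (\<Prod>k=l+1..l + size1 U. \<alpha> k) * q ^ size1 U"

fun \<Gamma>v :: "real \<Rightarrow> (nat \<Rightarrow> real) \<Rightarrow> nat \<times> nat tree \<Rightarrow> real" where
  "\<Gamma>v q \<alpha> (l, Leaf) = 1"
| "\<Gamma>v q \<alpha> (l, Node X k Y) =
    (let p = pv q \<alpha> l (Node X k Y); lp = pv q \<alpha> l X; rp = pv q \<alpha> (l + size1 X) Y;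
         lcs = cs X; rcs = cs Y; c = cs (Node X k Y)
     in qpoch q q k * qpoch q (p * q powi (int c + int lcs + int rcs - 1)) k
          * qpoch q (rp * q ^ (2 * rcs)) k
        / qpoch q (lp * q ^ (2 * lcs)) k
        * (lp * q ^ (2 * lcs)) ^ (k + rcs) * q powi (- 2 * int lcs * int rcs - int k))"


subsection \<open>Multidimensional $q$-Hahn polynomials\<close>

text \<open>
  The variable \<open>X\<^sub>h\<close> is determined by \<open>x\<close>. The right subtree receives the shifted parameters and
  variables. Under the guard all natural number subtractions are exact.
\<close>
fun mqhahn :: "real \<Rightarrow> (nat \<Rightarrow> real) \<Rightarrow> nat tree \<Rightarrow> (nat \<Rightarrow> nat) \<Rightarrow> real" where
  "mqhahn q \<alpha> Leaf x = 1"
| "mqhahn q \<alpha> (Node l k r) x =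
    (let t = size1 l; h = size1 l + size1 r; i = cs l; j = cs r; n = cs (Node l k r);
         Xt = psum x t; Xh = psum x h; At = pprod \<alpha> t; Ah = pprod \<alpha> h
     in if Xh \<ge> n \<and> Xt \<ge> i \<and> Xh - Xt \<ge> j then
          q powi (- int (j * Xt))
          * qhahn q (n - i - j) (Xt - i) (At * q powi (int t + 2 * int i - 1))
              (Ah * inverse At * q powi (int h - int t + 2 * int j - 1)) (Xh - i - j)
          * mqhahn q \<alpha> l x
          * mqhahn q (\<lambda>m. \<alpha> (t + m)) r (\<lambda>m. x (t + m))
        else 0)"

text \<open>\<open>Q\<^sub>c(\<cdot>; \<alpha>\<^sub>1, \<dots>, \<alpha>\<^sub>h, M | q)\<close> as an element of \<open>V h M\<close>.\<close>
definition Qc :: "real \<Rightarrow> nat \<Rightarrow> (nat \<Rightarrow> real) \<Rightarrow> nat \<Rightarrow> nat tree \<Rightarrow> gfun" where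
  "Qc q h \<alpha> M c = (\<lambda>x. if x \<in> grid h M then of_real (mqhahn q \<alpha> c x) else 0)"

end

theory Submission
  imports Defs
begin

text \<open>
  Write \<open>Q\<^sub>c(M)\<close> for \<open>Q\<^sub>c(\<cdot>; \<alpha>, M | q)\<close> and \<open>n\<close> for the sum of the labels of \<open>c\<close>. Everything follows from two
  pointwise identities: \<open>R\<^sub>M Q\<^sub>c(M)\<close> is a multiple of \<open>Q\<^sub>c(M+1)\<close>, and \<open>L\<^sub>M Q\<^sub>c(M)\<close> is a multiple of
  \<open>Q\<^sub>c(M-1)\<close> (hence 0 for \<open>M = n\<close>). By induction on the tree they reduce at the root to two contiguous
  relations of the one-variable polynomials. Since \<open>D\<^sub>M\<close> is \<open>R\<^bsub>M-1\<^esub>L\<^sub>M\<close> plus a constant, each \<open>Q\<^sub>c(N)\<close> is an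
  eigenvector of \<open>D\<^sub>N\<close>. Up to a power of \<open>q\<close>, \<open>R\<^sub>M\<close> and \<open>-L\<^bsub>M+1\<^esub>\<close> are adjoint, so the inner
  products of \<open>Q\<^sub>c(M+1)\<close> and \<open>Q\<^sub>d(M+1)\<close> are known multiples of those at \<open>M\<close>; this gives orthogonality for
  different \<open>n\<close> and reduces the norms to \<open>M = n\<close>. For equal \<open>n\<close> the form splits along
  \<open>X\<^sub>t + (X\<^sub>h - X\<^sub>t) = M\<close> into the forms of the two subtrees, and the norm at \<open>M = n\<close> is a terminating
  q-Vandermonde sum. The norms do not vanish, so the \<open>Q\<^sub>c(M)\<close> are independent, and there are as many of
  them as points of \<open>[h;M]\<close>. The kernel of \<open>L\<^sub>n\<close> and the eigenspaces are then read off in this basis.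
\<close>


subsection \<open>Contiguous relations of the $q$-Hahn polynomials\<close>

text \<open>Two obstacles shape the proof. The form need not be positive definite, so nothing rests
  on positivity: both parameter ranges enter only through \<open>nonres\<close>, a list of values
  that products of consecutive \<alpha>'s avoid, and an orthogonal family with nonzero norms is
  independent whatever the sign of the form. Secondly, the recursion for Q_c mixes sizes: on [h;M]
  the left subtree meets every size X_t \<le> M, so a statement about one fixed size does not pass
  to subtrees. The raising and lowering identities are therefore stated for all points x, with the
  size read off as a partial sum, and the form is treated at all sizes. For different label sums the
  two operators give it; for equal sums, labelings of the same shape that agree on both subtrees
  also agree at the root, so one of the subtrees already makes every term vanish. For the norm, the
  one-variable polynomials matter only when their degree equals their last parameter, where they are
  explicit products.\<close>

lemma qpoch_0 [simp]: "qpoch q a 0 = 1"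
  by (simp add: qpoch_def)

lemma qpoch_Suc: "qpoch q a (Suc k) = qpoch q a k * (1 - a * q ^ k)"
  by (simp add: qpoch_def)

lemma qpoch_Suc_left: "qpoch q a (Suc k) = (1 - a) * qpoch q (a * q) k"
  unfolding qpoch_def by (subst prod.lessThan_Suc_shift) (simp add: mult.assoc)

lemma qpoch_eq_0_iff: "qpoch q a k = 0 \<longleftrightarrow> (\<exists>j<k. a * q ^ j = 1)"
  by (auto simp: qpoch_def)

lemma qpoch_add: "qpoch q a (k + m) = qpoch q a k * qpoch q (a * q ^ k) m"
  by (induction m) (simp_all add: qpoch_Suc power_add mult.assoc)

section \<open>The q-Pochhammer symbols at q^(-x) and their shifts in x\<close>

locale q_base =
  fixes q :: real
  assumes q: "0 < q" "q < 1"
begin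

lemma power_eq_iff_q: "q ^ a = q ^ b \<longleftrightarrow> a = b"
  using q by (metis linorder_neqE_nat order_less_irrefl power_strict_decreasing)

lemma qpoch_q_nz: "qpoch q q k \<noteq> 0"
proof -
  have "q * q ^ j \<noteq> 1" for j
    using power_eq_iff_q[of "Suc j" 0] by simp
  then show ?thesis by (simp add: qpoch_eq_0_iff)
qed

lemma qpoch_neg: "qpoch q (q powi (- int x)) k = (\<Prod>j<k. 1 - q ^ j / q ^ x)"
  by (simp add: qpoch_def power_int_minus field_simps)

lemma qpoch_neg_nz: "k \<le> n \<Longrightarrow> qpoch q (q powi (- int n)) k \<noteq> 0"
  unfolding qpoch_neg using q by (auto simp: power_eq_iff_q)

lemma qpoch_neg_eq_0: "n < k \<Longrightarrow> qpoch q (q powi (- int n)) k = 0"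
  unfolding qpoch_neg using q by auto

lemma qpoch_neg_Suc: "qpoch q (q powi (- int x)) (Suc k)
    = qpoch q (q powi (- int x)) k * (1 - q ^ k / q ^ x)"
  by (simp add: qpoch_neg)

lemma qpoch_neg_Suc_left: "qpoch q (q powi (- int (Suc x))) (Suc k)
    = (1 - 1 / q ^ Suc x) * qpoch q (q powi (- int x)) k"
proof -
  have e: "q powi (- int n) = 1 / q ^ n" for n
    by (simp add: power_int_minus inverse_eq_divide)
  show ?thesis unfolding e qpoch_Suc_left using q by simp
qed

text \<open>Splitting off the first or the last factor of (q^(-x);q)_(k+1) and multiplying by -q^x
  gives the two sides. At x = 0 the truncated x - 1 is harmless: both sides are 0.\<close>

lemma qpoch_neg_down: "(1 - q ^ x) * qpoch q (q powi (- int (x - 1))) k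
    = (q ^ k - q ^ x) * qpoch q (q powi (- int x)) k"
proof (cases x)
  case 0
  then show ?thesis using qpoch_neg_eq_0[of 0 k] by (cases k) auto
next
  case (Suc y)
  have "(1 - 1 / q ^ x) * qpoch q (q powi (- int y)) k
      = qpoch q (q powi (- int x)) k * (1 - q ^ k / q ^ x)"
    using qpoch_neg_Suc_left[of y k] qpoch_neg_Suc[of x k] Suc by simp
  moreover have "1 - q ^ x = -(q ^ x) * (1 - 1 / q ^ x)" "q ^ k - q ^ x = -(q ^ x) * (1 - q ^ k / q ^ x)"
    using q by (simp_all add: algebra_simps)
  moreover have "x - 1 = y" using Suc by simp
  ultimately show ?thesis by (simp only: mult.assoc mult.commute mult.left_commute)
qed

text \<open>For k > 0 both symbols are multiples of (q^(-x);q)_(k-1), by splitting off the first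
  factor of one and the last factor of the other. For k = 0 the factor 1 - q^k removes the term with
  the truncated index.\<close>

lemma qpoch_neg_up: "q ^ k * qpoch q (q powi (- int (Suc x))) k
    = qpoch q (q powi (- int x)) k - (1 - q ^ k) * qpoch q (q powi (- int x)) (k - 1)" (is ?A)
  and qpoch_neg_up': "q ^ Suc x * (qpoch q (q powi (- int (Suc x))) k - qpoch q (q powi (- int x)) k)
    = - (1 - q ^ k) * qpoch q (q powi (- int x)) (k - 1)" (is ?B)
proof -
  have "?A \<and> ?B"
  proof (cases k)
    case (Suc l)
    have k: "k - 1 = l" using Suc by simp
    have 1: "qpoch q (q powi (- int (Suc x))) k = (1 - 1 / q ^ Suc x) * qpoch q (q powi (- int x)) l"
      unfolding Suc by (rule qpoch_neg_Suc_left)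
    have 2: "qpoch q (q powi (- int x)) k = qpoch q (q powi (- int x)) l * (1 - q ^ l / q ^ x)"
      unfolding Suc by (rule qpoch_neg_Suc)
    show ?thesis unfolding k 1 2 unfolding Suc using q by (simp add: field_simps)
  qed simp
  then show ?A ?B by simp_all
qed

text \<open>The part of the 3phi2 summand that is free of x and N. Raising and lowering change only
  x and N, so this coefficient is common to all polynomials in a contiguous relation.\<close>

definition hahn_coeff :: "nat \<Rightarrow> real \<Rightarrow> real \<Rightarrow> nat \<Rightarrow> real" where
  "hahn_coeff m a b k = qpoch q (q powi (- int m)) k * qpoch q (a * b * q ^ (m + 1)) k
    / (qpoch q (a * q) k * qpoch q q k)"

definition hahn_sum :: "nat \<Rightarrow> nat \<Rightarrow> real \<Rightarrow> real \<Rightarrow> nat \<Rightarrow> real" where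
  "hahn_sum m x a b N = (\<Sum>k=0..m. hahn_coeff m a b k * q ^ k
     * (qpoch q (q powi (- int x)) k / qpoch q (q powi (- int N)) k))"

lemma qhahn_eq: "qhahn q m x a b N = q powr (real m ^ 2 / 2 - real m * real N)
    * (qpoch q q N / qpoch q q (N - m)) * hahn_sum m x a b N"
proof -
  have "(\<Sum>k=0..m. qpoch q (q powi (- int m)) k * qpoch q (a * b * q ^ (m + 1)) k
                * qpoch q (q powi (- int x)) k
              / (qpoch q (a * q) k * qpoch q (q powi (- int N)) k * qpoch q q k) * q ^ k)
      = hahn_sum m x a b N"
    unfolding hahn_sum_def hahn_coeff_def by (intro sum.cong refl) (simp add: mult_ac)
  then show ?thesis unfolding qhahn_def by simp
qed

lemma hahn_coeff_Suc:
  assumes "a * q ^ Suc k \<noteq> 1"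
  shows "hahn_coeff m a b (Suc k) * (1 - q ^ Suc k) * (1 - a * q ^ Suc k)
    = hahn_coeff m a b k * (1 - q ^ k / q ^ m) * (1 - a * b * q ^ (m + k + 1))"
proof -
  have "q * q ^ k \<noteq> 1" using power_eq_iff_q[of "Suc k" 0] by simp
  with assms show ?thesis
    unfolding hahn_coeff_def qpoch_neg_Suc unfolding qpoch_Suc
    by (simp add: divide_simps power_add) (simp add: algebra_simps)
qed

text \<open>The quotient of the normalising factors at N + 1 and N, with denominators
  cleared.\<close>

lemma qhahn_step: assumes "m \<le> N"
  shows "q ^ m * (1 - q ^ (N + 1 - m)) * (q powr (real m ^ 2 / 2 - real m * real (N + 1))
    * (qpoch q q (N + 1) / qpoch q q (N + 1 - m)))
   = (1 - q ^ (N + 1)) * (q powr (real m ^ 2 / 2 - real m * real N)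
    * (qpoch q q N / qpoch q q (N - m)))"
proof -
  have "q powr (real m ^ 2 / 2 - real m * real N)
      = q powr (real m + (real m ^ 2 / 2 - real m * real (N + 1)))"
    by (simp add: algebra_simps)
  also have "\<dots> = q ^ m * q powr (real m ^ 2 / 2 - real m * real (N + 1))"
    using q by (simp only: powr_add powr_realpow)
  finally have 1: "q powr (real m ^ 2 / 2 - real m * real N)
    = q ^ m * q powr (real m ^ 2 / 2 - real m * real (N + 1))" .
  have 2: "N + 1 - m = Suc (N - m)" using assms by simp
  have "q * q ^ (N - m) \<noteq> 1" using power_eq_iff_q[of "Suc (N - m)" 0] by simp
  then show ?thesis unfolding 1 2 using qpoch_q_nz[of "N - m"]
    by (simp add: qpoch_Suc field_simps)
qed

text \<open>Holds term by term in k: by \<open>qpoch_neg_down\<close> in x the two terms on the left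
  combine to the factor q^k - q^(N+1), and the same lemma in N + 1 absorbs this factor into the
  denominator symbol. At x = 0 and x = N + 1 the term outside the range has coefficient 0.\<close>

lemma qhahn_raise:
  assumes "m \<le> N" "x \<le> N + 1"
  shows "(1 - q ^ x) * qhahn q m (x - 1) a b N + q ^ x * (1 - q ^ (N + 1 - x)) * qhahn q m x a b N
    = q ^ m * (1 - q ^ (N + 1 - m)) * qhahn q m x a b (N + 1)"
proof -
  have *: "(1 - q ^ x) * (qpoch q (q powi (- int (x - 1))) k / qpoch q (q powi (- int N)) k)
      + q ^ x * (1 - q ^ (N + 1 - x)) * (qpoch q (q powi (- int x)) k / qpoch q (q powi (- int N)) k)
      = (1 - q ^ (N + 1)) * (qpoch q (q powi (- int x)) k / qpoch q (q powi (- int (N + 1))) k)"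
    if "k \<le> m" for k
  proof -
    have nz: "qpoch q (q powi (- int N)) k \<noteq> 0" "qpoch q (q powi (- int (N + 1))) k \<noteq> 0"
      using that assms by (intro qpoch_neg_nz; simp)+
    have e: "q ^ x * (1 - q ^ (N + 1 - x)) = q ^ x - q ^ (N + 1)"
      using assms by (simp add: algebra_simps flip: power_add)
    have "(1 - q ^ x) * qpoch q (q powi (- int (x - 1))) k
        + q ^ x * (1 - q ^ (N + 1 - x)) * qpoch q (q powi (- int x)) k
        = (q ^ k - q ^ (N + 1)) * qpoch q (q powi (- int x)) k"
      unfolding e qpoch_neg_down by (simp add: algebra_simps)
    then have "(1 - q ^ x) * (qpoch q (q powi (- int (x - 1))) k / qpoch q (q powi (- int N)) k)
      + q ^ x * (1 - q ^ (N + 1 - x)) * (qpoch q (q powi (- int x)) k / qpoch q (q powi (- int N)) k)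
      = (q ^ k - q ^ (N + 1)) * qpoch q (q powi (- int x)) k / qpoch q (q powi (- int N)) k"
      by (simp only: times_divide_eq_right flip: add_divide_distrib)
    also have "\<dots> = (1 - q ^ (N + 1)) * (qpoch q (q powi (- int x)) k / qpoch q (q powi (- int (N + 1))) k)"
      using nz qpoch_neg_down[of "N + 1" k]
      by (simp add: frac_eq_eq del: of_nat_add)
    finally show ?thesis .
  qed
  have "(1 - q ^ x) * hahn_sum m (x - 1) a b N + q ^ x * (1 - q ^ (N + 1 - x)) * hahn_sum m x a b N
    = (1 - q ^ (N + 1)) * hahn_sum m x a b (N + 1)"
    unfolding hahn_sum_def sum_distrib_left sum.distrib[symmetric]
  proof (intro sum.cong refl)
    fix k assume "k \<in> {0..m}"
    then have "k \<le> m" by simp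
    from arg_cong[OF *[OF this], of "\<lambda>z. hahn_coeff m a b k * q ^ k * z"]
    show "(1 - q ^ x) * (hahn_coeff m a b k * q ^ k *
            (qpoch q (q powi - int (x - 1)) k / qpoch q (q powi - int N) k)) +
         q ^ x * (1 - q ^ (N + 1 - x)) * (hahn_coeff m a b k * q ^ k *
          (qpoch q (q powi - int x) k / qpoch q (q powi - int N) k)) =
         (1 - q ^ (N + 1)) * (hahn_coeff m a b k * q ^ k *
          (qpoch q (q powi - int x) k / qpoch q (q powi - int (N + 1)) k))"
      by (simp only: distrib_left mult.assoc mult.left_commute)
  qed
  moreover have "X * (C0 * s1) + Y * (C0 * s2) = M * (C1 * s)"
    if "X * s1 + Y * s2 = B * s" "M * C1 = B * C0" for X Y M B C0 C1 s s1 s2 :: real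
    using that by algebra
  ultimately show ?thesis unfolding qhahn_eq using qhahn_step[OF assms(1)] by blast
qed

text \<open>Unlike raising, this does not hold term by term: the k-th summands differ by a constant
  multiple of \<open>E (Suc k) - E k\<close>. The sum telescopes to 0, since \<open>E 0\<close> has
  the factor 1 - q^0 and \<open>E (Suc m)\<close> the factor (q^(-m);q)_(m+1) = 0.\<close>

lemma hahn_sum_lower:
  assumes "m \<le> N + 1" "x \<le> N" and nz: "\<And>k. k < m \<Longrightarrow> a * q ^ Suc k \<noteq> 1"
  shows "(1 - q ^ (N + 1)) * ((1 - a * q ^ Suc x) * hahn_sum m (Suc x) a b (N + 1)
      + a * q ^ Suc x * (1 - b * q ^ (N - x + 1)) * hahn_sum m x a b (N + 1))
    = (1 - q ^ (N + 1 - m)) * (1 - a * b * q ^ (N + m + 2)) * hahn_sum m x a b N"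
proof -
  define P where "P k = qpoch q (q powi (- int x)) k" for k
  define D where "D k = qpoch q (q powi (- int (N + 1))) k" for k
  define U where "U k = hahn_coeff m a b k / D k" for k
  \<comment> \<open>The unwanted term that \<open>br\<close> produces from the shift of x. The
    factors 1 - q^k and 1 - a q^k cancel the last ones in the denominator of
    \<open>hahn_coeff\<close>, so \<open>E (Suc k)\<close> is again a multiple of
    \<open>hahn_coeff m a b k\<close> and \<open>P k\<close>.\<close>
  define E where "E k = U k * (1 - q ^ k) * (1 - a * q ^ k) * P (k - 1)" for k
  define tgt where "tgt k = (1 - q ^ (N + 1 - m)) * (1 - a * b * q ^ (N + m + 2))
    * (hahn_coeff m a b k * q ^ k * (P k / qpoch q (q powi (- int N)) k))" for k
  have e: "a * q ^ Suc x * (1 - b * q ^ (N - x + 1)) = a * q ^ Suc x - a * b * q ^ (N + 2)"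
  proof -
    have "q ^ Suc x * q ^ (N - x + 1) = q ^ (N + 2)"
      using assms by (simp flip: power_add)
    moreover have "a * q ^ Suc x * (1 - b * q ^ (N - x + 1))
        = a * q ^ Suc x - a * b * (q ^ Suc x * q ^ (N - x + 1))"
      by (simp only: right_diff_distrib mult_1_right mult_ac)
    ultimately show ?thesis by simp
  qed
  have br: "q ^ k * ((1 - a * q ^ Suc x) * qpoch q (q powi (- int (Suc x))) k
      + a * q ^ Suc x * (1 - b * q ^ (N - x + 1)) * P k)
    = (1 - a * b * q ^ (N + 2 + k)) * P k - (1 - q ^ k) * (1 - a * q ^ k) * P (k - 1)" for k
  proof -
    have "X * ((1 - a * Y) * p1 + (a * Y - a * b * Z) * p) = (1 - a * b * (Z * X)) * p - (1 - X) * (1 - a * X) * p0"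
      if "X * p1 = p - (1 - X) * p0" "Y * (p1 - p) = - (1 - X) * p0" for X Y Z p0 p1 p :: real
      using that by algebra
    from this[OF qpoch_neg_up[of k x] qpoch_neg_up'[of x k]] show ?thesis
      unfolding e P_def power_add[of q "N + 2" k] .
  qed
  have key: "(1 - q ^ (N + 1)) * (U k * (1 - a * b * q ^ (N + 2 + k)) * P k)
     = tgt k + (1 - q ^ (N + 1)) * E (Suc k)"
    if k: "k \<le> m" for k
  proof (cases "k \<le> N")
    case True
    have Dnz: "D k \<noteq> 0" "D (Suc k) \<noteq> 0" unfolding D_def
      using True by (intro qpoch_neg_nz; simp)+
    have DS: "D (Suc k) = D k * (1 - q ^ k / q ^ (N + 1))"
      unfolding D_def by (rule qpoch_neg_Suc)
    have f: "1 - q ^ k / q ^ (N + 1) \<noteq> 0" using Dnz DS by auto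
    have dn: "qpoch q (q powi (- int N)) k \<noteq> 0" using True by (rule qpoch_neg_nz)
    have DN: "(1 - q ^ (N + 1)) * qpoch q (q powi (- int N)) k = (q ^ k - q ^ (N + 1)) * D k"
      using qpoch_neg_down[of "N + 1" k] unfolding D_def by simp
    have cS: "hahn_coeff m a b (Suc k) * (1 - q ^ Suc k) * (1 - a * q ^ Suc k)
      = hahn_coeff m a b k * (1 - q ^ k / q ^ m) * (1 - a * b * q ^ (m + k + 1))"
    proof (cases "k = m")
      \<comment> \<open>\<open>nz\<close> stops at k < m; for k = m both sides are 0.\<close>
      case True
      then show ?thesis using q qpoch_neg_eq_0[of m "Suc m"] by (simp add: hahn_coeff_def)
    next
      case False
      then show ?thesis using k nz by (intro hahn_coeff_Suc) auto
    qed
    have ES: "E (Suc k) = hahn_coeff m a b k * (1 - q ^ k / q ^ m) * (1 - a * b * q ^ (m + k + 1))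
      * P k / (D k * (1 - q ^ k / q ^ (N + 1)))"
      unfolding E_def U_def cS[symmetric] DS by simp
    have qm: "q ^ (N + 1 - m) * q ^ m = q ^ (N + 1)" using assms by (simp flip: power_add)
    have tg: "tgt k = (1 - q ^ (N + 1)) * ((1 - q ^ (N + 1 - m)) * (1 - a * b * q ^ (N + m + 2))
      * hahn_coeff m a b k * q ^ k * P k) / ((q ^ k - q ^ (N + 1)) * D k)"
      unfolding tgt_def DN[symmetric] using power_eq_iff_q[of "N + 1" 0] by simp
    have f2: "q ^ k - q ^ (N + 1) \<noteq> 0" using True by (simp add: power_eq_iff_q del: power_Suc)
    have q0: "q ^ m \<noteq> 0" "q ^ (N + 1) \<noteq> 0" using q by auto
    \<comment> \<open>This is \<open>key\<close> divided by the common factors (1 - q^(N+1)),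
      \<open>U k\<close> and \<open>P k\<close>: an identity of rational functions in q^k whose only
      pole is at q^k = q^(N+1), excluded here by k \<le> N.\<close>
    have alg: "(1 - a * b * q ^ (N + 2 + k)) = (1 - q ^ (N + 1 - m)) * (1 - a * b * q ^ (N + m + 2)) * q ^ k
       / (q ^ k - q ^ (N + 1)) + (1 - q ^ k / q ^ m) * (1 - a * b * q ^ (m + k + 1)) / (1 - q ^ k / q ^ (N + 1))"
    proof -
      have "(1 - q ^ k / q ^ m) * (1 - a * b * q ^ (m + k + 1)) / (1 - q ^ k / q ^ (N + 1))
         = (q ^ (N + 1) - q ^ (N + 1 - m) * q ^ k) * (1 - a * b * q ^ (m + k + 1)) / (q ^ (N + 1) - q ^ k)"
        using q0 f f2 unfolding qm[symmetric] by (simp add: divide_simps) (simp add: algebra_simps)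
      moreover have "(1 - q ^ (N + 1 - m)) * (1 - a * b * q ^ (N + m + 2)) * q ^ k
       / (q ^ k - q ^ (N + 1)) = - (1 - q ^ (N + 1 - m)) * (1 - a * b * q ^ (N + m + 2)) * q ^ k
       / (q ^ (N + 1) - q ^ k)"
      proof -
        have "z * y * w / (u - v) = - z * y * w / (v - u)" for z y w u v :: real
          by (metis minus_diff_eq minus_divide_right minus_divide_left mult_minus_left)
        then show ?thesis .
      qed
      moreover have "(1 - a * b * q ^ (N + 2 + k)) * (q ^ (N + 1) - q ^ k)
         = - (1 - q ^ (N + 1 - m)) * (1 - a * b * q ^ (N + m + 2)) * q ^ k
           + (q ^ (N + 1) - q ^ (N + 1 - m) * q ^ k) * (1 - a * b * q ^ (m + k + 1))"
      proof -
        have "(1 - a * b * (W * q * K)) * (W - K) = - (1 - r) * (1 - a * b * (W * q * M)) * K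
            + (W - r * K) * (1 - a * b * (M * K * q))" if "r * M = W" for r M W K :: real
          unfolding that[symmetric] by (simp add: algebra_simps)
        from this[OF qm, of "q ^ k"] show ?thesis
          by (simp add: power_add power2_eq_square mult_ac)
      qed
      moreover have "L = X + Z" if "Z = W / g" "X = Y / g" "L * g = Y + W" "g \<noteq> 0" for L X Y Z W g :: real
        by (simp add: that(1,2) that(3)[symmetric] that(4) flip: add_divide_distrib)
      moreover have "q ^ (N + 1) - q ^ k \<noteq> 0" using f2 by simp
      ultimately show ?thesis by blast
    qed
    have "w * (h / d * (u * v * K / g + y * z / f) * p) = w * (u * v * h * K * p) / (g * d) + w * (h * y * z * p / (d * f))"
      for w h d u v K g y z f p :: real
      by (simp add: distrib_left distrib_right mult_ac)
    then show ?thesis unfolding tg ES U_def alg .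
  next
    \<comment> \<open>Only k = m = N + 1 is left. \<open>P k\<close> vanishes because x \<le> N, so
      both \<open>tgt k\<close> and the left side are 0, and \<open>U (Suc k)\<close> is 0 by its
      numerator.\<close>
    case False
    with k assms have m: "m = N + 1" "k = N + 1" by auto
    have "P k = 0" unfolding P_def using False assms by (intro qpoch_neg_eq_0) auto
    moreover have "U (Suc k) = 0"
      unfolding U_def hahn_coeff_def m using qpoch_neg_eq_0[of "N + 1" "Suc (N + 1)"] by simp
    ultimately show ?thesis unfolding tgt_def E_def m by simp
  qed
  have tel: "(\<Sum>k=0..m. E (Suc k) - E k) = 0"
  proof -
    have "(\<Sum>k=0..m. E (Suc k) - E k) = E (Suc m) - E 0"
      using sum_Suc_diff[of 0 "m" E] by simp
    moreover have "E (Suc m) = 0"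
      unfolding E_def U_def hahn_coeff_def using qpoch_neg_eq_0[of m "Suc m"] by simp
    ultimately show ?thesis by (simp add: E_def)
  qed
  have "(1 - a * q ^ Suc x) * hahn_sum m (Suc x) a b (N + 1)
      + a * q ^ Suc x * (1 - b * q ^ (N - x + 1)) * hahn_sum m x a b (N + 1)
    = (\<Sum>k=0..m. U k * (q ^ k * ((1 - a * q ^ Suc x) * qpoch q (q powi (- int (Suc x))) k
      + a * q ^ Suc x * (1 - b * q ^ (N - x + 1)) * P k)))"
    unfolding hahn_sum_def sum_distrib_left sum.distrib[symmetric] U_def D_def P_def
    by (intro sum.cong refl) (simp only: distrib_left times_divide_eq_right times_divide_eq_left add_divide_distrib mult_ac)
  also have "\<dots> = (\<Sum>k=0..m. U k * (1 - a * b * q ^ (N + 2 + k)) * P k - E k)"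
    unfolding br E_def by (intro sum.cong refl) (simp add: algebra_simps)
  finally have "(1 - q ^ (N + 1)) * ((1 - a * q ^ Suc x) * hahn_sum m (Suc x) a b (N + 1)
      + a * q ^ Suc x * (1 - b * q ^ (N - x + 1)) * hahn_sum m x a b (N + 1))
    = (\<Sum>k=0..m. (1 - q ^ (N + 1)) * (U k * (1 - a * b * q ^ (N + 2 + k)) * P k) - (1 - q ^ (N + 1)) * E k)"
    by (simp only: sum_distrib_left right_diff_distrib)
  also have "\<dots> = (\<Sum>k=0..m. tgt k + (1 - q ^ (N + 1)) * (E (Suc k) - E k))"
  proof (intro sum.cong refl)
    fix k assume "k \<in> {0..m}"
    then have "k \<le> m" by simp
    from key[OF this] show "(1 - q ^ (N + 1)) * (U k * (1 - a * b * q ^ (N + 2 + k)) * P k) - (1 - q ^ (N + 1)) * E k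
      = tgt k + (1 - q ^ (N + 1)) * (E (Suc k) - E k)"
      by (simp only: right_diff_distrib[of _ "E (Suc k)"] add_diff_eq)
  qed
  also have "\<dots> = (\<Sum>k=0..m. tgt k)"
    by (simp add: sum.distrib tel flip: sum_distrib_left)
  also have "\<dots> = (1 - q ^ (N + 1 - m)) * (1 - a * b * q ^ (N + m + 2)) * hahn_sum m x a b N"
    unfolding tgt_def hahn_sum_def P_def sum_distrib_left ..
  finally show ?thesis .
qed

text \<open>At m = N + 1 the factor 1 - q^(N+1-m) of \<open>hahn_sum_lower\<close> is 0. This
  boundary case is what makes L_n annihilate Q_c at size n, and it gives the first-order recurrence
  behind \<open>qhahn_full_square\<close>.\<close>

lemma qhahn_lower:
  assumes "m \<le> N + 1" "x \<le> N" and nz: "\<And>k. k < m \<Longrightarrow> a * q ^ Suc k \<noteq> 1"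
  shows "q ^ m * ((1 - a * q ^ Suc x) * qhahn q m (Suc x) a b (N + 1)
      + a * q ^ Suc x * (1 - b * q ^ (N - x + 1)) * qhahn q m x a b (N + 1))
    = (if m \<le> N then (1 - a * b * q ^ (N + m + 2)) * qhahn q m x a b N else 0)"
proof -
  have nz1: "1 - q ^ (N + 1) \<noteq> 0" using power_eq_iff_q[of "N + 1" 0] by simp
  have low: "(1 - q ^ (N + 1)) * ((1 - a * q ^ Suc x) * hahn_sum m (Suc x) a b (N + 1)
      + a * q ^ Suc x * (1 - b * q ^ (N - x + 1)) * hahn_sum m x a b (N + 1))
    = (1 - q ^ (N + 1 - m)) * (1 - a * b * q ^ (N + m + 2)) * hahn_sum m x a b N"
    using assms by (rule hahn_sum_lower)
  have cancel: "qm * (u * (C1 * s1) + v * (C1 * s2)) = E * (C0 * S)"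
    if "A * (u * s1 + v * s2) = B * E * S" "qm * B * C1 = A * C0" "A \<noteq> 0" "B \<noteq> 0"
    for A B C0 C1 E S qm u v s1 s2 :: real
  proof -
    have "A * B * (qm * (u * (C1 * s1) + v * (C1 * s2))) = A * B * (E * (C0 * S))"
      using that(1,2) by algebra
    with that(3,4) show ?thesis by simp
  qed
  have zero: "qm * (u * (C * s1) + v * (C * s2)) = 0" if "u * s1 + v * s2 = 0"
    for qm u v C s1 s2 :: real using that by algebra
  show ?thesis
  proof (cases "m \<le> N")
    case True
    then have "1 - q ^ (N + 1 - m) \<noteq> 0" using power_eq_iff_q[of "N + 1 - m" 0] by simp
    with low qhahn_step[OF True] nz1 True show ?thesis
      unfolding qhahn_eq
      by (simp only: if_True) (rule cancel)
  next
    case False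
    with assms have m: "m = N + 1" by auto
    show ?thesis using low nz1 zero False unfolding m qhahn_eq by (simp del: power_Suc)
  qed
qed

end


subsection \<open>Raising and lowering along a tree\<close>

lemma sum_split_at: "(\<Sum>i=1..t + s. f i) = (\<Sum>i=1..t. f i) + (\<Sum>i=1..s. f (t + i))"
  for f :: "nat \<Rightarrow> 'a::comm_monoid_add"
  by (induction s) (simp_all add: add.assoc)

lemma prod_split_at: "(\<Prod>i=1..t + s. f i) = (\<Prod>i=1..t. f i) * (\<Prod>i=1..s. f (t + i))"
  for f :: "nat \<Rightarrow> 'a::comm_monoid_mult"
  by (induction s) (simp_all add: mult.assoc)

abbreviation (input) shift :: "nat \<Rightarrow> (nat \<Rightarrow> 'a) \<Rightarrow> nat \<Rightarrow> 'a" where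
  "shift t x \<equiv> \<lambda>m. x (t + m)"

lemma psum_split: "psum x (t + s) = psum x t + psum (shift t x) s"
  unfolding psum_def by (rule sum_split_at)

lemma pprod_split: "pprod \<alpha> (t + s) = pprod \<alpha> t * pprod (shift t \<alpha>) s"
  unfolding pprod_def by (rule prod_split_at)

lemma psum_cong: "(\<And>i. 1 \<le> i \<Longrightarrow> i \<le> k \<Longrightarrow> x i = y i) \<Longrightarrow> psum x k = psum y k"
  unfolding psum_def by (intro sum.cong) auto

lemma psum_eps_plus: "1 \<le> i \<Longrightarrow> psum (eps_plus i x) k = psum x k + (if i \<le> k then 1 else 0)"
  by (induction k) (auto simp: psum_def eps_plus_def)

lemma psum_eps_minus:
  assumes "1 \<le> i" "0 < x i"
  shows "psum (eps_minus i x) k = psum x k - (if i \<le> k then 1 else 0)"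
proof -
  have "eps_plus i (eps_minus i x) = x" using assms by (auto simp: eps_plus_def eps_minus_def)
  with psum_eps_plus[OF assms(1), of "eps_minus i x" k] show ?thesis by simp
qed

lemma shift_eps:
  "shift t (eps_plus (t + i) x) = eps_plus i (shift t x)"
  "shift t (eps_minus (t + i) x) = eps_minus i (shift t x)"
  by (auto simp: eps_plus_def eps_minus_def)

lemma mqhahn_cong:
  "(\<And>i. 1 \<le> i \<Longrightarrow> i \<le> size1 c \<Longrightarrow> x i = y i) \<Longrightarrow> mqhahn q \<alpha> c x = mqhahn q \<alpha> c y"
proof (induction c arbitrary: \<alpha> x y)
  case (Node l k r)
  have 1: "psum x (size1 l) = psum y (size1 l)"
    "psum x (size1 l + size1 r) = psum y (size1 l + size1 r)"
    by (rule psum_cong; use Node.prems in simp)+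
  have 2: "mqhahn q \<alpha> l x = mqhahn q \<alpha> l y" by (rule Node.IH) (use Node.prems in simp)
  have 3: "mqhahn q \<beta> r (shift (size1 l) x) = mqhahn q \<beta> r (shift (size1 l) y)" for \<beta>
    by (rule Node.IH) (use Node.prems in simp)
  show ?case by (simp add: 1 2 3 Let_def)
qed simp

lemma size1_ge_1: "1 \<le> size1 c"
  by (induction c) simp_all

lemma cs_eq_0_if_size1_1: "size1 c = 1 \<Longrightarrow> cs c = 0"
proof (cases c)
  case (Node l k r)
  then show "size1 c = 1 \<Longrightarrow> cs c = 0" using size1_ge_1[of l] size1_ge_1[of r] by simp
qed simp

lemma mqhahn_eq_0: "psum x (size1 c) < cs c \<Longrightarrow> mqhahn q \<alpha> c x = 0"
  by (cases c) (simp_all add: Let_def)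

text \<open>
  The non-resonance condition under which no denominator and no difference of eigenvalues
  vanishes; it is inherited by subtrees.
\<close>
definition nonres :: "real \<Rightarrow> (nat \<Rightarrow> real) \<Rightarrow> nat \<Rightarrow> nat \<Rightarrow> bool" where
  "nonres q \<alpha> h N \<longleftrightarrow> (\<forall>k. 1 \<le> k \<longrightarrow> k \<le> h \<longrightarrow> \<alpha> k \<noteq> 0) \<and>
    (\<forall>l m e. 1 \<le> m \<longrightarrow> l + m \<le> h \<longrightarrow> e \<le> m * (N - 1) \<longrightarrow> pprod (shift l \<alpha>) m * q ^ (m + e) \<noteq> 1)"

lemma nonres_left: "nonres q \<alpha> (t + s) N \<Longrightarrow> nonres q \<alpha> t N"
  unfolding nonres_def by auto

lemma nonres_right: "nonres q \<alpha> (t + s) N \<Longrightarrow> nonres q (shift t \<alpha>) s N"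
  unfolding nonres_def
proof (intro conjI allI impI; elim conjE)
  fix l m e assume *: "\<forall>l m e. 1 \<le> m \<longrightarrow> l + m \<le> t + s \<longrightarrow> e \<le> m * (N - 1) \<longrightarrow> pprod (shift l \<alpha>) m * q ^ (m + e) \<noteq> 1"
    and "1 \<le> m" "l + m \<le> s" "e \<le> m * (N - 1)"
  then show "pprod (shift l (shift t \<alpha>)) m * q ^ (m + e) \<noteq> 1"
    using *[rule_format, of m "t + l" e] by (simp add: add.assoc)
qed simp

lemma nonres_pprod_nz: "nonres q \<alpha> h N \<Longrightarrow> k \<le> h \<Longrightarrow> pprod \<alpha> k \<noteq> 0"
  unfolding nonres_def pprod_def by simp

lemma nonres_ne_1:
  assumes "nonres q \<alpha> h N" "1 \<le> h" "e \<le> h * (N - 1)"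
  shows "pprod \<alpha> h * q ^ (h + e) \<noteq> 1"
proof -
  have "pprod (shift 0 \<alpha>) h * q ^ (h + e) \<noteq> 1"
    using assms unfolding nonres_def by (metis add_0 order_refl)
  then show ?thesis by simp
qed

text \<open>Says that the Pochhammer symbols based at p(U) q^(2 cs(U)) do not vanish.
  \<open>nonres\<close> grants an exponent of N - 1 per leaf, while 2 cs(U) + r may reach 2(N - 1);
  this fits because a tree with a single leaf has label sum 0.\<close>

lemma nonres_cs:
  assumes "nonres q \<alpha> (size1 c) N" "cs c + m \<le> N" "r < m"
  shows "pprod \<alpha> (size1 c) * q ^ size1 c * q ^ (2 * cs c + r) \<noteq> 1"
proof -
  have e: "2 * cs c + r \<le> size1 c * (N - 1)"
  proof (cases "size1 c = 1")
    case True
    then show ?thesis using assms cs_eq_0_if_size1_1[OF True] by simp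
  next
    case False
    then have "2 \<le> size1 c" using size1_ge_1[of c] by linarith
    then have "2 * (N - 1) \<le> size1 c * (N - 1)" by simp
    then show ?thesis using assms by linarith
  qed
  show ?thesis using nonres_ne_1[OF assms(1) size1_ge_1 e] by (simp add: power_add mult.assoc)
qed

context q_base
begin

text \<open>The contribution of the root to \<open>mqhahn\<close>; \<open>A\<close>, \<open>B\<close> are the values of \<open>p\<close> at the sons.\<close>
definition root_factor :: "nat \<Rightarrow> nat \<Rightarrow> nat \<Rightarrow> real \<Rightarrow> real \<Rightarrow> nat \<Rightarrow> nat \<Rightarrow> real" where
  "root_factor m i j A B a b = (if a + b \<ge> m + i + j \<and> a \<ge> i \<and> b \<ge> j then
     q powi (- int (j * a)) * qhahn q m (a - i) (A * q powi (2 * int i - 1))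
       (B * q powi (2 * int j - 1)) (a + b - i - j) else 0)"

lemma mqhahn_Node:
  assumes "pprod \<alpha> (size1 l) \<noteq> 0"
  shows "mqhahn q \<alpha> (Node l m r) x
    = root_factor m (cs l) (cs r) (pprod \<alpha> (size1 l) * q ^ size1 l)
        (pprod (shift (size1 l) \<alpha>) (size1 r) * q ^ size1 r) (psum x (size1 l)) (psum (shift (size1 l) x) (size1 r))
      * mqhahn q \<alpha> l x * mqhahn q (shift (size1 l) \<alpha>) r (shift (size1 l) x)"
proof -
  have 1: "pprod \<alpha> (size1 l) * q powi (int (size1 l) + 2 * int (cs l) - 1)
    = pprod \<alpha> (size1 l) * q ^ size1 l * q powi (2 * int (cs l) - 1)"
    using q by (simp add: power_int_add power_int_diff)
  have 2: "pprod \<alpha> (size1 l + size1 r) * inverse (pprod \<alpha> (size1 l))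
      * q powi (int (size1 l + size1 r) - int (size1 l) + 2 * int (cs r) - 1)
    = pprod (shift (size1 l) \<alpha>) (size1 r) * q ^ size1 r * q powi (2 * int (cs r) - 1)"
    using q assms unfolding pprod_split by (simp add: power_int_add power_int_diff)
  show ?thesis
    unfolding mqhahn.simps Let_def 1 2 root_factor_def psum_split by (simp add: add_ac)
qed

text \<open>\<open>qhahn_raise\<close> with x = a - i and N + 1 = a + b - i - j. The coefficients
  are those that the induction hypotheses of \<open>mqhahn_raise\<close> supply for the sons; the
  factor q^(-ja) in the polynomial accounts for q^j when a drops by one. Outside the guard,
  truncated subtraction makes every term 0.\<close>

lemma root_factor_raise:
  "q ^ i * (1 - q ^ (a - i)) * root_factor m i j A B (a - 1) b
    + q ^ a * (q ^ j * (1 - q ^ (b - j))) * root_factor m i j A B a (b - 1)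
   = q ^ (m + i + j) * (1 - q ^ (a + b - (m + i + j))) * root_factor m i j A B a b"
proof (cases "a \<ge> i \<and> b \<ge> j \<and> a + b > m + i + j")
  case True
  define N where "N = a + b - i - j - 1"
  define A' where "A' = A * q powi (2 * int i - 1)"
  define B' where "B' = B * q powi (2 * int j - 1)"
  have N: "m \<le> N" "a - i \<le> N + 1" "N + 1 - (a - i) = b - j" "N + 1 - m = a + b - (m + i + j)"
    "N + 1 = a + b - i - j"
    using True by (auto simp: N_def)
  have r0: "root_factor m i j A B a b = q powi (- int (j * a)) * qhahn q m (a - i) A' B' (N + 1)"
    using True N by (simp add: root_factor_def A'_def B'_def)
  have r1: "(1 - q ^ (a - i)) * root_factor m i j A B (a - 1) b
    = (1 - q ^ (a - i)) * (q powi (- int (j * a)) * q ^ j * qhahn q m (a - i - 1) A' B' N)"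
  proof (cases "a > i")
    case gt: True
    have "j * a = j * (a - 1) + j" using gt by (cases a) simp_all
    then have "q powi (- int (j * (a - 1))) = q powi (- int (j * a)) * q ^ j"
      using q by (simp only: power_int_minus power_int_of_nat power_add) simp
    moreover have "a - 1 + b - i - j = N" "a - 1 - i = a - i - 1" "a - 1 + b \<ge> m + i + j \<and> a - 1 \<ge> i \<and> b \<ge> j"
      using gt True by (auto simp: N_def)
    ultimately show ?thesis by (simp only: root_factor_def A'_def B'_def simp_thms if_True)
  qed (use True in auto)
  have r2: "(1 - q ^ (b - j)) * root_factor m i j A B a (b - 1)
    = (1 - q ^ (b - j)) * (q powi (- int (j * a)) * qhahn q m (a - i) A' B' N)"
  proof (cases "b > j")
    case gt: True
    have "a + (b - 1) - i - j = N" "a + (b - 1) \<ge> m + i + j \<and> a \<ge> i \<and> b - 1 \<ge> j"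
      using gt True by (auto simp: N_def)
    then show ?thesis by (simp only: root_factor_def A'_def B'_def simp_thms if_True)
  qed (use True in auto)
  have qa: "q ^ a = q ^ i * q ^ (a - i)" using True by (simp flip: power_add)
  have qr: "(1 - q ^ (a - i)) * qhahn q m (a - i - 1) A' B' N + q ^ (a - i) * (1 - q ^ (b - j)) * qhahn q m (a - i) A' B' N
    = q ^ m * (1 - q ^ (a + b - (m + i + j))) * qhahn q m (a - i) A' B' (N + 1)"
    using qhahn_raise[OF N(1,2), of A' B'] unfolding N(3,4) .
  have "q ^ i * (1 - q ^ (a - i)) * root_factor m i j A B (a - 1) b
    + q ^ a * (q ^ j * (1 - q ^ (b - j))) * root_factor m i j A B a (b - 1)
    = q ^ i * ((1 - q ^ (a - i)) * root_factor m i j A B (a - 1) b)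
    + q ^ a * q ^ j * ((1 - q ^ (b - j)) * root_factor m i j A B a (b - 1))"
    by (simp only: mult.assoc)
  also have "\<dots> = q ^ i * q ^ j * q powi (- int (j * a)) * ((1 - q ^ (a - i)) * qhahn q m (a - i - 1) A' B' N
      + q ^ (a - i) * (1 - q ^ (b - j)) * qhahn q m (a - i) A' B' N)"
    unfolding r1 r2 qa by (simp only: distrib_left mult_ac)
  also have "\<dots> = q ^ (m + i + j) * (1 - q ^ (a + b - (m + i + j))) * root_factor m i j A B a b"
    unfolding r0 qr power_add by (simp only: mult_ac)
  finally show ?thesis .
next
  case False
  have 0: "q ^ (m + i + j) * (1 - q ^ (a + b - (m + i + j))) * root_factor m i j A B a b = 0"
    using False by (cases "a + b > m + i + j") (auto simp: root_factor_def)
  have 1: "q ^ i * (1 - q ^ (a - i)) * root_factor m i j A B (a - 1) b = 0"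
    using False by (cases "a > i") (auto simp: root_factor_def)
  have 2: "q ^ a * (q ^ j * (1 - q ^ (b - j))) * root_factor m i j A B a (b - 1) = 0"
    using False by (cases "b > j") (auto simp: root_factor_def)
  show ?thesis unfolding 0 1 2 by simp
qed

text \<open>\<open>qhahn_lower\<close> with x = a - i and N = a + b - i - j; the shifts in the
  parameters turn a q^(x+1) into A q^(a+i). The boundary a + b + 1 = m + i + j is its case m = N +
  1: the neighbours on the left may be nonzero, yet their combination is 0.\<close>

lemma root_factor_lower:
  assumes "i \<le> a" "j \<le> b" and nz: "\<And>k. k < m \<Longrightarrow> A * q ^ (2 * i + k) \<noteq> 1"
  shows "q ^ j * q ^ m * (1 - A * q ^ (a + i)) * root_factor m i j A B (a + 1) b
    + q ^ i * q ^ m * A * q ^ a * (1 - B * q ^ (b + j)) * root_factor m i j A B a (b + 1)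
   = (1 - A * B * q ^ (a + b + (m + i + j))) * root_factor m i j A B a b"
proof (cases "m + i + j \<le> a + b + 1")
  case True
  define N where "N = a + b - i - j"
  define x where "x = a - i"
  define A' where "A' = A * q powi (2 * int i - 1)"
  define B' where "B' = B * q powi (2 * int j - 1)"
  have N: "m \<le> N + 1" "x \<le> N" "N - x + 1 = b - j + 1" "m \<le> N \<longleftrightarrow> m + i + j \<le> a + b"
    using True assms by (auto simp: N_def x_def)
  have pw: "q powi (2 * int i - 1) * q ^ Suc k = q ^ (2 * i + k)" for i k
  proof -
    have "q powi (2 * int i - 1) * q ^ Suc k = q powi (2 * int i - 1) * q powi (int (Suc k))"
      by (simp only: power_int_of_nat)
    also have "\<dots> = q powi (int (2 * i + k))"
      using q by (simp flip: power_int_add add: algebra_simps)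
    finally show ?thesis by (simp only: power_int_of_nat)
  qed
  have A': "A' * q ^ Suc k = A * q ^ (2 * i + k)" for k
    unfolding A'_def using pw[of i k] by (simp only: mult.assoc)
  have B': "B' * q ^ Suc k = B * q ^ (2 * j + k)" for k
    unfolding B'_def using pw[of j k] by (simp only: mult.assoc)
  have e: "2 * i + x = a + i" "2 * j + (b - j) = b + j" using assms by (auto simp: x_def)
  have e1: "A' * q ^ Suc x = A * q ^ (a + i)" and e2: "B' * q ^ (N - x + 1) = B * q ^ (b + j)"
    unfolding N using A'[of x] B'[of "b - j"] unfolding e by simp_all
  have "A' * B' * q ^ (N + m + 2) = (A' * q ^ Suc N) * (B' * q ^ Suc m)"
    by (simp add: power_add power2_eq_square)
  also have "\<dots> = A * B * (q ^ (2 * i + N) * q ^ (2 * j + m))"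
    unfolding A' B' by (simp only: mult_ac)
  also have "q ^ (2 * i + N) * q ^ (2 * j + m) = q ^ (a + b + (m + i + j))"
    unfolding power_add[symmetric] using assms by (intro arg_cong[of _ _ "(^) q"]) (simp add: N_def)
  finally have e3: "A' * B' * q ^ (N + m + 2) = A * B * q ^ (a + b + (m + i + j))" .
  have nz': "A' * q ^ Suc k \<noteq> 1" if "k < m" for k unfolding A' by (rule nz[OF that])
  have ql: "q ^ m * ((1 - A * q ^ (a + i)) * qhahn q m (Suc x) A' B' (N + 1)
      + A * q ^ (a + i) * (1 - B * q ^ (b + j)) * qhahn q m x A' B' (N + 1))
    = (if m \<le> N then (1 - A * B * q ^ (a + b + (m + i + j))) * qhahn q m x A' B' N else 0)"
    using qhahn_lower[OF N(1,2) nz', of B'] unfolding e1 e2 e3 .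
  have s: "a + 1 - i = Suc x" "a + 1 + b - i - j = N + 1" "a + (b + 1) - i - j = N + 1"
    using assms by (auto simp: x_def N_def)
  have r1: "root_factor m i j A B (a + 1) b = q powi (- int (j * (a + 1))) * qhahn q m (Suc x) A' B' (N + 1)"
    unfolding root_factor_def s A'_def B'_def using True assms by simp
  have r2: "root_factor m i j A B a (b + 1) = q powi (- int (j * a)) * qhahn q m x A' B' (N + 1)"
    unfolding root_factor_def s A'_def B'_def x_def using True assms by simp
  have r0: "root_factor m i j A B a b = (if m \<le> N then q powi (- int (j * a)) * qhahn q m x A' B' N else 0)"
    unfolding root_factor_def N_def[symmetric] A'_def B'_def x_def N using True assms by (simp add: add_ac)
  have p: "q ^ j * q powi (- int (j * (a + 1))) = q powi (- int (j * a))"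
    using q by (simp only: power_int_minus power_int_of_nat distrib_left power_add) simp
  have "q ^ j * q ^ m * (1 - A * q ^ (a + i)) * root_factor m i j A B (a + 1) b
    + q ^ i * q ^ m * A * q ^ a * (1 - B * q ^ (b + j)) * root_factor m i j A B a (b + 1)
    = q powi (- int (j * a)) * (q ^ m * ((1 - A * q ^ (a + i)) * qhahn q m (Suc x) A' B' (N + 1)
      + A * q ^ (a + i) * (1 - B * q ^ (b + j)) * qhahn q m x A' B' (N + 1)))"
    unfolding r1 r2 p[symmetric] power_add[of q a i] by (simp only: distrib_left mult_ac)
  also have "\<dots> = (1 - A * B * q ^ (a + b + (m + i + j))) * root_factor m i j A B a b"
    unfolding ql r0 by simp
  finally show ?thesis .
qed (simp add: root_factor_def)

text \<open>A unit removed on one side of the root leaves the polynomial of the other subtree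
  unchanged, so the sum over i splits into the sums of the two induction hypotheses. For leaves on
  the right X_(i-1) contains all of X_t, whence the factor q^a required by
  \<open>root_factor_raise\<close>.\<close>

lemma mqhahn_raise:
  assumes "\<And>k. 1 \<le> k \<Longrightarrow> k \<le> size1 c \<Longrightarrow> \<alpha> k \<noteq> 0"
  shows "(\<Sum>i=1..size1 c. q ^ psum x (i - 1) * (1 - q ^ x i) * mqhahn q \<alpha> c (eps_minus i x))
    = q ^ cs c * (1 - q ^ (psum x (size1 c) - cs c)) * mqhahn q \<alpha> c x"
  using assms
proof (induction c arbitrary: \<alpha> x)
  case Leaf
  then show ?case by (simp add: psum_def)
next
  case (Node l m r)
  define t where "t = size1 l"
  define s where "s = size1 r"
  define y where "y = shift t x"
  define \<beta> where "\<beta> = shift t \<alpha>"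
  define a where "a = psum x t"
  define b where "b = psum y s"
  define F where "F = root_factor m (cs l) (cs r) (pprod \<alpha> t * q ^ t) (pprod \<beta> s * q ^ s)"
  have "pprod \<alpha> t \<noteq> 0" using Node.prems unfolding pprod_def t_def by simp
  then have mq: "mqhahn q \<alpha> (Node l m r) z
      = F (psum z t) (psum (shift t z) s) * mqhahn q \<alpha> l z * mqhahn q \<beta> r (shift t z)" for z
    unfolding F_def t_def s_def \<beta>_def by (rule mqhahn_Node)
  have IHl: "(\<Sum>i=1..t. q ^ psum x (i - 1) * (1 - q ^ x i) * mqhahn q \<alpha> l (eps_minus i x))
    = q ^ cs l * (1 - q ^ (a - cs l)) * mqhahn q \<alpha> l x"
    unfolding t_def a_def by (rule Node.IH) (use Node.prems in simp)
  have IHr: "(\<Sum>i=1..s. q ^ psum y (i - 1) * (1 - q ^ y i) * mqhahn q \<beta> r (eps_minus i y))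
    = q ^ cs r * (1 - q ^ (b - cs r)) * mqhahn q \<beta> r y"
    unfolding s_def b_def by (rule Node.IH) (use Node.prems in \<open>simp add: \<beta>_def t_def\<close>)
  have left: "q ^ psum x (i - 1) * (1 - q ^ x i) * mqhahn q \<alpha> (Node l m r) (eps_minus i x)
     = (q ^ psum x (i - 1) * (1 - q ^ x i) * mqhahn q \<alpha> l (eps_minus i x)) * (F (a - 1) b * mqhahn q \<beta> r y)"
    if i: "i \<in> {1..t}" for i
  proof (cases "x i = 0")
    case False
    have "psum (eps_minus i x) t = a - 1" using i False psum_eps_minus[of i x t] by (simp add: a_def)
    moreover have "psum (shift t (eps_minus i x)) s = b" unfolding b_def y_def
      by (rule psum_cong) (use i in \<open>simp add: eps_minus_def\<close>)
    moreover have "mqhahn q \<beta> r (shift t (eps_minus i x)) = mqhahn q \<beta> r y" unfolding y_def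
      by (rule mqhahn_cong) (use i in \<open>simp add: eps_minus_def\<close>)
    ultimately show ?thesis unfolding mq by (simp only: mult_ac)
  qed simp
  have right: "q ^ psum x (t + i - 1) * (1 - q ^ x (t + i)) * mqhahn q \<alpha> (Node l m r) (eps_minus (t + i) x)
     = (q ^ psum y (i - 1) * (1 - q ^ y i) * mqhahn q \<beta> r (eps_minus i y)) * (q ^ a * F a (b - 1) * mqhahn q \<alpha> l x)"
    if i: "i \<in> {1..s}" for i
  proof (cases "y i = 0")
    case False
    have ti: "t + i - 1 = t + (i - 1)" using i by simp
    have "psum x (t + i - 1) = a + psum y (i - 1)" unfolding ti psum_split a_def y_def ..
    moreover have "psum (eps_minus (t + i) x) t = a" unfolding a_def
      by (rule psum_cong) (use i in \<open>simp add: eps_minus_def\<close>)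
    moreover have "mqhahn q \<alpha> l (eps_minus (t + i) x) = mqhahn q \<alpha> l x"
      by (rule mqhahn_cong) (use i in \<open>simp add: eps_minus_def t_def\<close>)
    moreover have "shift t (eps_minus (t + i) x) = eps_minus i y" unfolding y_def by (rule shift_eps)
    moreover have "psum (eps_minus i y) s = b - 1" using i False psum_eps_minus[of i y s] by (simp add: b_def)
    moreover have "x (t + i) = y i" by (simp add: y_def)
    ultimately show ?thesis unfolding mq power_add by (simp only: mult_ac power_add)
  qed (simp add: y_def)
  have sz: "size1 (Node l m r) = t + s" by (simp add: t_def s_def)
  have "(\<Sum>i=1..t + s. q ^ psum x (i - 1) * (1 - q ^ x i) * mqhahn q \<alpha> (Node l m r) (eps_minus i x))
    = q ^ cs l * (1 - q ^ (a - cs l)) * mqhahn q \<alpha> l x * (F (a - 1) b * mqhahn q \<beta> r y)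
      + q ^ cs r * (1 - q ^ (b - cs r)) * mqhahn q \<beta> r y * (q ^ a * F a (b - 1) * mqhahn q \<alpha> l x)"
    unfolding sum_split_at using left right
    by (simp only: sum_distrib_right[symmetric] IHl IHr cong: sum.cong)
  also have "\<dots> = (q ^ cs l * (1 - q ^ (a - cs l)) * F (a - 1) b
      + q ^ a * (q ^ cs r * (1 - q ^ (b - cs r))) * F a (b - 1)) * (mqhahn q \<alpha> l x * mqhahn q \<beta> r y)"
    by (simp only: distrib_left distrib_right mult_ac)
  also have "\<dots> = q ^ (m + cs l + cs r) * (1 - q ^ (a + b - (m + cs l + cs r))) * mqhahn q \<alpha> (Node l m r) x"
    unfolding mq F_def root_factor_raise a_def b_def y_def by (simp only: mult_ac)
  finally show ?case unfolding sz psum_split a_def b_def y_def by simp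
qed

text \<open>The sum splits as for raising. The prefix A_(j-1) q^(j-1+X_(j-1)) of a leaf on the right
  contains the whole contribution A_t q^(t+X_t) of the left subtree. Multiplying by q^(cs c) keeps
  all exponents nonnegative.\<close>

lemma mqhahn_lower:
  assumes "nonres q \<alpha> (size1 c) N" "cs c \<le> N"
  shows "q ^ cs c * (\<Sum>j=1..size1 c. pprod \<alpha> (j - 1) * q ^ (j - 1 + psum x (j - 1)) * (\<alpha> j * q ^ (x j + 1) - 1)
      * mqhahn q \<alpha> c (eps_plus j x))
    = - (1 - pprod \<alpha> (size1 c) * q ^ (size1 c + psum x (size1 c) + cs c)) * mqhahn q \<alpha> c x"
  using assms
proof (induction c arbitrary: \<alpha> x)
  case Leaf
  then show ?case by (simp add: psum_def pprod_def)
next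
  case (Node l m r)
  define t where "t = size1 l"
  define s where "s = size1 r"
  define y where "y = shift t x"
  define \<beta> where "\<beta> = shift t \<alpha>"
  define a where "a = psum x t"
  define b where "b = psum y s"
  define A where "A = pprod \<alpha> t * q ^ t"
  define B where "B = pprod \<beta> s * q ^ s"
  define F where "F = root_factor m (cs l) (cs r) A B"
  have nr: "nonres q \<alpha> (t + s) N" using Node.prems by (simp add: t_def s_def)
  have nrl: "nonres q \<alpha> (size1 l) N" using nonres_left[OF nr] by (simp add: t_def)
  have nrr: "nonres q \<beta> (size1 r) N" using nonres_right[OF nr] by (simp add: \<beta>_def s_def)
  have le: "cs l + m \<le> N" "cs l \<le> N" "cs r \<le> N" using Node.prems by auto
  have "pprod \<alpha> t \<noteq> 0" using nonres_pprod_nz[OF nr] by simp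
  then have mq: "mqhahn q \<alpha> (Node l m r) z
      = F (psum z t) (psum (shift t z) s) * mqhahn q \<alpha> l z * mqhahn q \<beta> r (shift t z)" for z
    unfolding F_def t_def s_def \<beta>_def A_def B_def by (rule mqhahn_Node)
  define Sl where "Sl = (\<Sum>j=1..t. pprod \<alpha> (j - 1) * q ^ (j - 1 + psum x (j - 1)) * (\<alpha> j * q ^ (x j + 1) - 1)
      * mqhahn q \<alpha> l (eps_plus j x))"
  define Sr where "Sr = (\<Sum>j=1..s. pprod \<beta> (j - 1) * q ^ (j - 1 + psum y (j - 1)) * (\<beta> j * q ^ (y j + 1) - 1)
      * mqhahn q \<beta> r (eps_plus j y))"
  have IHl: "q ^ cs l * Sl = - (1 - A * q ^ (a + cs l)) * mqhahn q \<alpha> l x"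
    using Node.IH(1)[OF nrl le(2), of x] unfolding Sl_def t_def a_def A_def power_add
    by (simp only: mult.assoc)
  have IHr: "q ^ cs r * Sr = - (1 - B * q ^ (b + cs r)) * mqhahn q \<beta> r y"
    using Node.IH(2)[OF nrr le(3), of y] unfolding Sr_def s_def b_def B_def power_add
    by (simp only: mult.assoc)
  have left: "pprod \<alpha> (j - 1) * q ^ (j - 1 + psum x (j - 1)) * (\<alpha> j * q ^ (x j + 1) - 1)
        * mqhahn q \<alpha> (Node l m r) (eps_plus j x)
     = (pprod \<alpha> (j - 1) * q ^ (j - 1 + psum x (j - 1)) * (\<alpha> j * q ^ (x j + 1) - 1) * mqhahn q \<alpha> l (eps_plus j x))
       * (F (a + 1) b * mqhahn q \<beta> r y)"
    if j: "j \<in> {1..t}" for j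
  proof -
    have "psum (eps_plus j x) t = a + 1" using j psum_eps_plus[of j x t] by (simp add: a_def)
    moreover have "psum (shift t (eps_plus j x)) s = b" unfolding b_def y_def
      by (rule psum_cong) (use j in \<open>simp add: eps_plus_def\<close>)
    moreover have "mqhahn q \<beta> r (shift t (eps_plus j x)) = mqhahn q \<beta> r y" unfolding y_def
      by (rule mqhahn_cong) (use j in \<open>simp add: eps_plus_def\<close>)
    ultimately show ?thesis unfolding mq by (simp only: mult_ac)
  qed
  have right: "pprod \<alpha> (t + j - 1) * q ^ (t + j - 1 + psum x (t + j - 1)) * (\<alpha> (t + j) * q ^ (x (t + j) + 1) - 1)
        * mqhahn q \<alpha> (Node l m r) (eps_plus (t + j) x)
     = (pprod \<beta> (j - 1) * q ^ (j - 1 + psum y (j - 1)) * (\<beta> j * q ^ (y j + 1) - 1) * mqhahn q \<beta> r (eps_plus j y))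
       * (A * q ^ a * F a (b + 1) * mqhahn q \<alpha> l x)"
    if j: "j \<in> {1..s}" for j
  proof -
    have tj: "t + j - 1 = t + (j - 1)" using j by simp
    have "psum x (t + j - 1) = a + psum y (j - 1)" unfolding tj psum_split a_def y_def ..
    moreover have "pprod \<alpha> (t + j - 1) = pprod \<alpha> t * pprod \<beta> (j - 1)" unfolding tj pprod_split \<beta>_def ..
    moreover have "psum (eps_plus (t + j) x) t = a" unfolding a_def
      by (rule psum_cong) (use j in \<open>simp add: eps_plus_def\<close>)
    moreover have "mqhahn q \<alpha> l (eps_plus (t + j) x) = mqhahn q \<alpha> l x"
      by (rule mqhahn_cong) (use j in \<open>simp add: eps_plus_def t_def\<close>)
    moreover have "shift t (eps_plus (t + j) x) = eps_plus j y" unfolding y_def by (rule shift_eps)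
    moreover have "psum (eps_plus j y) s = b + 1" using j psum_eps_plus[of j y s] by (simp add: b_def)
    moreover have "x (t + j) = y j" by (simp add: y_def)
    moreover have "\<alpha> (t + j) = \<beta> j" by (simp add: \<beta>_def)
    ultimately show ?thesis unfolding mq A_def by (simp only: tj power_add mult_ac)
  qed
  have sz: "size1 (Node l m r) = t + s" by (simp add: t_def s_def)
  have csn: "cs (Node l m r) = m + cs l + cs r" by simp
  define i where "i = cs l"
  define j where "j = cs r"
  have sum: "(\<Sum>j=1..t + s. pprod \<alpha> (j - 1) * q ^ (j - 1 + psum x (j - 1)) * (\<alpha> j * q ^ (x j + 1) - 1)
        * mqhahn q \<alpha> (Node l m r) (eps_plus j x))
    = Sl * (F (a + 1) b * mqhahn q \<beta> r y) + Sr * (A * q ^ a * F a (b + 1) * mqhahn q \<alpha> l x)"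
    unfolding sum_split_at Sl_def Sr_def sum_distrib_right using left right
    by (simp only: cong: sum.cong)
  have "q ^ (m + i + j) * (Sl * (F (a + 1) b * mqhahn q \<beta> r y) + Sr * (A * q ^ a * F a (b + 1) * mqhahn q \<alpha> l x))
    = q ^ j * q ^ m * F (a + 1) b * mqhahn q \<beta> r y * (q ^ i * Sl)
      + q ^ i * q ^ m * A * q ^ a * F a (b + 1) * mqhahn q \<alpha> l x * (q ^ j * Sr)"
    unfolding power_add by (simp only: distrib_left mult_ac)
  also have "\<dots> = - (q ^ j * q ^ m * (1 - A * q ^ (a + i)) * F (a + 1) b
      + q ^ i * q ^ m * A * q ^ a * (1 - B * q ^ (b + j)) * F a (b + 1)) * (mqhahn q \<alpha> l x * mqhahn q \<beta> r y)"
    unfolding IHl[folded i_def] IHr[folded j_def]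
    by (simp only: distrib_left distrib_right mult_minus_left mult_minus_right minus_add_distrib mult_ac)
  also have "\<dots> = - ((1 - A * B * q ^ (a + b + (m + i + j))) * F a b) * (mqhahn q \<alpha> l x * mqhahn q \<beta> r y)"
  proof (cases "i \<le> a \<and> j \<le> b")
    case True
    have nz: "A * q ^ (2 * i + k) \<noteq> 1" if "k < m" for k
      using nonres_cs[OF nrl le(1) that] by (simp add: A_def t_def i_def)
    have "q ^ j * q ^ m * (1 - A * q ^ (a + i)) * F (a + 1) b
      + q ^ i * q ^ m * A * q ^ a * (1 - B * q ^ (b + j)) * F a (b + 1)
      = (1 - A * B * q ^ (a + b + (m + i + j))) * F a b"
      unfolding F_def i_def[symmetric] j_def[symmetric] using True nz by (intro root_factor_lower) auto
    then show ?thesis by simp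
  next
    \<comment> \<open>Outside the hypotheses of \<open>root_factor_lower\<close> the polynomial of
      one son is already 0.\<close>
    case False
    then have "mqhahn q \<alpha> l x * mqhahn q \<beta> r y = 0"
      using mqhahn_eq_0[of x l] mqhahn_eq_0[of y r] unfolding i_def j_def a_def b_def t_def s_def by auto
    then show ?thesis by (simp only: mult_zero_right)
  qed
  also have "\<dots> = - (1 - pprod \<alpha> (t + s) * q ^ (t + s + psum x (t + s) + (m + i + j))) * mqhahn q \<alpha> (Node l m r) x"
  proof -
    have ab: "A * B * q ^ (a + b + (m + i + j)) = pprod \<alpha> (t + s) * q ^ (t + s + psum x (t + s) + (m + i + j))"
      unfolding A_def B_def pprod_split psum_split a_def b_def y_def \<beta>_def by (simp add: power_add)
    show ?thesis unfolding ab unfolding mq a_def b_def y_def by (simp only: mult_minus_left mult.assoc)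
  qed
  finally show ?case unfolding sz csn sum i_def j_def .
qed

end


subsection \<open>The form and orthogonality\<close>

lemma finite_grid: "finite (grid h M)"
proof (rule finite_subset)
  show "grid h M \<subseteq> {x. \<forall>i. (i \<in> {1..h} \<longrightarrow> x i \<in> {..M}) \<and> (i \<notin> {1..h} \<longrightarrow> x i = 0)}"
    unfolding grid_def using member_le_sum[of _ "{1..h}"] by fastforce
  show "finite {x. \<forall>i. (i \<in> {1..h} \<longrightarrow> x i \<in> {..M}) \<and> (i \<notin> {1..h} \<longrightarrow> x i = (0::nat))}"
    by (rule finite_set_of_finite_funs) auto
qed

lemma grid_psum: "x \<in> grid h M \<Longrightarrow> psum x h = M"
  by (simp add: grid_def psum_def)

lemma psum_mono: "k \<le> h \<Longrightarrow> psum x k \<le> psum x h"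
  unfolding psum_def by (rule sum_mono2) auto

lemma grid_psum_le: "x \<in> grid h M \<Longrightarrow> k \<le> h \<Longrightarrow> psum x k \<le> M"
  using psum_mono[of k h x] grid_psum[of x h M] by simp

lemma eps_plus_grid: "y \<in> grid h M \<Longrightarrow> i \<in> {1..h} \<Longrightarrow> eps_plus i y \<in> grid h (M + 1)"
  using psum_eps_plus[of i y h] by (auto simp: grid_def psum_def eps_plus_def)

lemma eps_minus_grid: "x \<in> grid h (M + 1) \<Longrightarrow> i \<in> {1..h} \<Longrightarrow> 0 < x i \<Longrightarrow> eps_minus i x \<in> grid h M"
  using psum_eps_minus[of i x h] by (auto simp: grid_def psum_def eps_minus_def)

lemma sum_grid_Suc:
  fixes G :: "(nat \<Rightarrow> nat) \<Rightarrow> 'a::comm_monoid_add"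
  assumes "i \<in> {1..h}" "\<And>x. x i = 0 \<Longrightarrow> G x = 0"
  shows "(\<Sum>x\<in>grid h (M + 1). G x) = (\<Sum>y\<in>grid h M. G (eps_plus i y))"
proof -
  have "(\<Sum>x\<in>grid h (M + 1). G x) = (\<Sum>x\<in>{x\<in>grid h (M + 1). 0 < x i}. G x)"
    by (rule sum.mono_neutral_right) (use finite_grid assms in auto)
  also have "\<dots> = (\<Sum>y\<in>grid h M. G (eps_plus i y))"
  proof (rule sum.reindex_bij_witness[of _ "eps_plus i" "eps_minus i"])
    fix x assume x: "x \<in> {x \<in> grid h (M + 1). 0 < x i}"
    then show "eps_minus i x \<in> grid h M" using eps_minus_grid assms(1) by simp
    show "eps_plus i (eps_minus i x) = x" using x by (auto simp: eps_plus_def eps_minus_def)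
    then show "G (eps_plus i (eps_minus i x)) = G x" by simp
  next
    fix y assume y: "y \<in> grid h M"
    show "eps_minus i (eps_plus i y) = y" by (auto simp: eps_plus_def eps_minus_def)
    show "eps_plus i y \<in> {x \<in> grid h (M + 1). 0 < x i}"
      using eps_plus_grid[OF y assms(1)] by (simp add: eps_plus_def)
  qed
  finally show ?thesis .
qed

definition join :: "nat \<Rightarrow> (nat \<Rightarrow> nat) \<Rightarrow> (nat \<Rightarrow> nat) \<Rightarrow> nat \<Rightarrow> nat" where
  "join t y z = (\<lambda>m. if m \<le> t then y m else z (m - t))"

lemma psum_join_left: "k \<le> t \<Longrightarrow> psum (join t y z) k = psum y k"
  by (rule psum_cong) (simp add: join_def)

lemma psum_join_right: "psum (join t y z) (t + k) = psum y t + psum z k"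
  unfolding psum_split psum_join_left[OF order_refl] by (simp add: psum_def join_def)

lemma sum_grid_split:
  fixes F :: "(nat \<Rightarrow> nat) \<Rightarrow> 'a::comm_monoid_add"
  shows "(\<Sum>x\<in>grid (t + s) M. F x)
    = (\<Sum>a\<le>M. \<Sum>y\<in>grid t a. \<Sum>z\<in>grid s (M - a). F (join t y z))"
proof -
  have "(\<Sum>x\<in>grid (t + s) M. F x)
    = (\<Sum>(a, y, z)\<in>(SIGMA a:{..M}. grid t a \<times> grid s (M - a)). F (join t y z))"
  \<comment> \<open>\<open>shift t x\<close> is not itself a grid point, since its value at 0 is
    \<open>x t\<close>; the second component is therefore reset to 0 there.\<close>
  proof (rule sum.reindex_bij_witness[of _ "\<lambda>(a, y, z). join t y z"
        "\<lambda>x. (psum x t, \<lambda>m. if m \<le> t then x m else 0, \<lambda>m. if m = 0 then 0 else x (t + m))"])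
    fix x assume x: "x \<in> grid (t + s) M"
    let ?y = "\<lambda>m. if m \<le> t then x m else 0" and ?z = "\<lambda>m. if m = 0 then 0 else x (t + m)"
    have j: "join t ?y ?z = x" by (auto simp: join_def fun_eq_iff)
    then show "(case (psum x t, ?y, ?z) of (a, y, z) \<Rightarrow> join t y z) = x"
      and "(case (psum x t, ?y, ?z) of (a, y, z) \<Rightarrow> F (join t y z)) = F x" by simp_all
    have "?y \<in> grid t (psum x t)" using x by (auto simp: grid_def psum_def intro!: sum.cong)
    moreover have "psum ?z s = M - psum x t"
    proof -
      have "psum ?z s = psum (shift t x) s" by (rule psum_cong) simp
      then show ?thesis using grid_psum[OF x] unfolding psum_split by simp
    qed
    then have "?z \<in> grid s (M - psum x t)" using x by (auto simp: grid_def psum_def)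
    moreover have "psum x t \<le> M" using grid_psum_le[OF x] by simp
    ultimately show "(psum x t, ?y, ?z) \<in> (SIGMA a:{..M}. grid t a \<times> grid s (M - a))" by simp
  next
    fix p assume p: "p \<in> (SIGMA a:{..M}. grid t a \<times> grid s (M - a))"
    obtain a y z where pe: "p = (a, y, z)" by (cases p) auto
    with p have *: "a \<le> M" "y \<in> grid t a" "z \<in> grid s (M - a)" by auto
    have s: "psum (join t y z) t = a" using psum_join_left[of t t y z] grid_psum[OF *(2)] by simp
    have "psum (join t y z) (t + s) = M"
      unfolding psum_join_right using *(1) grid_psum[OF *(2)] grid_psum[OF *(3)] by simp
    moreover have "join t y z i = 0" if "i \<notin> {1..t + s}" for i
    proof (cases "i \<le> t")
      case True
      then show ?thesis using that *(2) by (simp add: grid_def join_def)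
    next
      case False
      then have "i - t \<notin> {1..s}" using that by auto
      then show ?thesis using False *(3) by (simp add: grid_def join_def)
    qed
    ultimately show "(case p of (a, y, z) \<Rightarrow> join t y z) \<in> grid (t + s) M"
      unfolding pe by (simp add: grid_def psum_def)
    show "(psum (case p of (a, y, z) \<Rightarrow> join t y z) t,
       \<lambda>m. if m \<le> t then (case p of (a, y, z) \<Rightarrow> join t y z) m else 0,
       \<lambda>m. if m = 0 then 0 else (case p of (a, y, z) \<Rightarrow> join t y z) (t + m)) = p"
      using * s unfolding pe by (auto simp: grid_def join_def fun_eq_iff)
  qed
  also have "\<dots> = (\<Sum>a\<le>M. \<Sum>y\<in>grid t a. \<Sum>z\<in>grid s (M - a). F (join t y z))"
    by (simp add: sum.Sigma sum.cartesian_product finite_grid)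
  finally show ?thesis .
qed

context q_base
begin

section \<open>The form on real functions: adjointness, splitting and orthogonality\<close>

definition weight :: "nat \<Rightarrow> (nat \<Rightarrow> real) \<Rightarrow> nat \<Rightarrow> (nat \<Rightarrow> nat) \<Rightarrow> real" where
  "weight h \<alpha> M x = (\<Prod>i=1..h. qpoch q (q * \<alpha> i) (x i) / qpoch q q (x i) * (\<alpha> i * q) ^ (M - psum x i))"

text \<open>The polynomials are real, so on them the sesquilinear form reduces to this symmetric
  bilinear one. Its arguments need not vanish off the grid, which lets \<open>mqhahn\<close> be used
  directly.\<close>

definition rform :: "nat \<Rightarrow> (nat \<Rightarrow> real) \<Rightarrow> nat \<Rightarrow> ((nat \<Rightarrow> nat) \<Rightarrow> real) \<Rightarrow> ((nat \<Rightarrow> nat) \<Rightarrow> real) \<Rightarrow> real" where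
  "rform h \<alpha> M f g = q ^ (M * (M + 1) div 2) * (\<Sum>x\<in>grid h M. weight h \<alpha> M x * f x * g x)"

lemma rform_commute: "rform h \<alpha> M f g = rform h \<alpha> M g f"
  unfolding rform_def by (simp only: mult_ac)

lemma rform_cong:
  "(\<And>x. x \<in> grid h M \<Longrightarrow> f x = f' x) \<Longrightarrow> (\<And>x. x \<in> grid h M \<Longrightarrow> g x = g' x) \<Longrightarrow>
    rform h \<alpha> M f g = rform h \<alpha> M f' g'"
  unfolding rform_def by simp

lemma rform_scale_left: "rform h \<alpha> M (\<lambda>x. r * f x) g = r * rform h \<alpha> M f g"
  unfolding rform_def by (simp add: sum_distrib_left mult_ac)

text \<open>A unit added at i raises M and every X_k with k \<ge> i, so M - X_k grows exactly for k
  < i: this is the origin of A_(i-1) q^(i-1) in the lowering operator. The entry at i contributes (1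
  - \<alpha>_i q^(y_i+1)) / (1 - q^(y_i+1)).\<close>

lemma weight_eps_plus:
  assumes "y \<in> grid h M" "i \<in> {1..h}"
  shows "weight h \<alpha> (M + 1) (eps_plus i y) * (1 - q ^ (y i + 1))
    = weight h \<alpha> M y * (pprod \<alpha> (i - 1) * q ^ (i - 1) * (1 - \<alpha> i * q ^ (y i + 1)))"
proof -
  have nz: "1 - q ^ (y i + 1) \<noteq> 0" using power_eq_iff_q[of "y i + 1" 0] by simp
  have "weight h \<alpha> (M + 1) (eps_plus i y)
    = (\<Prod>k=1..h. (qpoch q (q * \<alpha> k) (y k) / qpoch q q (y k) * (\<alpha> k * q) ^ (M - psum y k))
       * ((if k = i then (1 - \<alpha> i * q ^ (y i + 1)) / (1 - q ^ (y i + 1)) else 1)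
          * (if k \<in> {1..i-1} then \<alpha> k * q else 1)))"
    unfolding weight_def
  proof (intro prod.cong refl)
    fix k assume k: "k \<in> {1..h}"
    have le: "psum y k \<le> M" using grid_psum_le[OF assms(1)] k by simp
    have ps: "psum (eps_plus i y) k = psum y k + (if i \<le> k then 1 else 0)"
      using psum_eps_plus assms(2) by simp
    have "(\<alpha> k * q) ^ (M + 1 - psum (eps_plus i y) k)
        = (\<alpha> k * q) ^ (M - psum y k) * (if k \<in> {1..i-1} then \<alpha> k * q else 1)"
      unfolding ps using le k by (auto simp: Suc_diff_le)
    moreover have "qpoch q (q * \<alpha> k) (eps_plus i y k) / qpoch q q (eps_plus i y k)
        = qpoch q (q * \<alpha> k) (y k) / qpoch q q (y k)
          * (if k = i then (1 - \<alpha> i * q ^ (y i + 1)) / (1 - q ^ (y i + 1)) else 1)"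
      by (simp add: eps_plus_def qpoch_Suc mult_ac)
    ultimately show "qpoch q (q * \<alpha> k) (eps_plus i y k) / qpoch q q (eps_plus i y k) *
        (\<alpha> k * q) ^ (M + 1 - psum (eps_plus i y) k)
      = qpoch q (q * \<alpha> k) (y k) / qpoch q q (y k) * (\<alpha> k * q) ^ (M - psum y k)
        * ((if k = i then (1 - \<alpha> i * q ^ (y i + 1)) / (1 - q ^ (y i + 1)) else 1)
          * (if k \<in> {1..i-1} then \<alpha> k * q else 1))"
      by (simp only: mult_ac)
  qed
  also have "\<dots> = weight h \<alpha> M y * ((1 - \<alpha> i * q ^ (y i + 1)) / (1 - q ^ (y i + 1))
      * (\<Prod>k\<in>{1..h}. if k \<in> {1..i-1} then \<alpha> k * q else 1))"
    unfolding prod.distrib[symmetric] weight_def using assms(2)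
    by (simp only: prod.distrib prod.delta[OF finite_atLeastAtMost] if_True)
  also have "(\<Prod>k\<in>{1..h}. if k \<in> {1..i-1} then \<alpha> k * q else 1) = (\<Prod>k=1..i-1. \<alpha> k * q)"
    by (rule prod.mono_neutral_cong_right) (use assms(2) in auto)
  also have "\<dots> = pprod \<alpha> (i - 1) * q ^ (i - 1)"
    by (simp add: prod.distrib pprod_def)
  finally show ?thesis using nz by simp
qed

text \<open>R_M without its factor q^(-M-1), so that the size M no longer occurs.\<close>

definition raise_sum :: "nat \<Rightarrow> ((nat \<Rightarrow> nat) \<Rightarrow> real) \<Rightarrow> (nat \<Rightarrow> nat) \<Rightarrow> real" where
  "raise_sum h f x = (\<Sum>i=1..h. q ^ psum x (i - 1) * (1 - q ^ x i) * f (eps_minus i x))"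

definition lower_sum :: "nat \<Rightarrow> (nat \<Rightarrow> real) \<Rightarrow> ((nat \<Rightarrow> nat) \<Rightarrow> real) \<Rightarrow> (nat \<Rightarrow> nat) \<Rightarrow> real" where
  "lower_sum h \<alpha> f x = (\<Sum>j=1..h. pprod \<alpha> (j - 1) * q ^ (j - 1 + psum x (j - 1)) * (\<alpha> j * q ^ (x j + 1) - 1)
      * f (eps_plus j x))"

text \<open>Summation by parts: the i-th term is rewritten with x = \<open>eps_plus i y\<close>,
  points with x_i = 0 being killed by 1 - q^0. The weight ratio then turns raising coefficients into
  lowering ones up to sign, and q^(M+1) is the quotient of the prefactors q^(M(M+1)/2).\<close>

lemma rform_raise_lower:
  "rform h \<alpha> (M + 1) (raise_sum h f) g = - (q ^ (M + 1) * rform h \<alpha> M f (lower_sum h \<alpha> g))"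
proof -
  have "(\<Sum>x\<in>grid h (M + 1). weight h \<alpha> (M + 1) x * raise_sum h f x * g x)
    = (\<Sum>i=1..h. \<Sum>x\<in>grid h (M + 1). (1 - q ^ x i) *
        (weight h \<alpha> (M + 1) x * q ^ psum x (i - 1) * f (eps_minus i x) * g x))"
    unfolding raise_sum_def sum_distrib_left sum_distrib_right
    by (subst sum.swap) (simp only: mult_ac)
  also have "\<dots> = (\<Sum>i=1..h. \<Sum>y\<in>grid h M. (1 - q ^ (y i + 1)) *
        (weight h \<alpha> (M + 1) (eps_plus i y) * q ^ psum y (i - 1) * f y * g (eps_plus i y)))"
  proof (rule sum.cong[OF refl])
    fix i assume i: "i \<in> {1..h}"
    have e: "eps_minus i (eps_plus i y) = y" "eps_plus i y i = y i + 1"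
      "psum (eps_plus i y) (i - 1) = psum y (i - 1)" for y
      using i psum_eps_plus[of i y "i - 1"] by (auto simp: eps_plus_def eps_minus_def)
    show "(\<Sum>x\<in>grid h (M + 1). (1 - q ^ x i) *
        (weight h \<alpha> (M + 1) x * q ^ psum x (i - 1) * f (eps_minus i x) * g x))
      = (\<Sum>y\<in>grid h M. (1 - q ^ (y i + 1)) *
        (weight h \<alpha> (M + 1) (eps_plus i y) * q ^ psum y (i - 1) * f y * g (eps_plus i y)))"
      by (subst sum_grid_Suc[OF i]) (simp_all only: e power_0 diff_self mult_zero_left)
  qed
  also have "\<dots> = (\<Sum>i=1..h. \<Sum>y\<in>grid h M. - (weight h \<alpha> M y * f y *
      (pprod \<alpha> (i - 1) * q ^ (i - 1 + psum y (i - 1)) * (\<alpha> i * q ^ (y i + 1) - 1) * g (eps_plus i y))))"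
  proof (intro sum.cong refl)
    fix i y assume i: "i \<in> {1..h}" and y: "y \<in> grid h M"
    have "(1 - q ^ (y i + 1)) * (weight h \<alpha> (M + 1) (eps_plus i y) * q ^ psum y (i - 1) * f y * g (eps_plus i y))
      = (weight h \<alpha> (M + 1) (eps_plus i y) * (1 - q ^ (y i + 1))) * (q ^ psum y (i - 1) * f y * g (eps_plus i y))"
      by (simp only: mult_ac)
    also have "\<dots> = - (weight h \<alpha> M y * f y *
      (pprod \<alpha> (i - 1) * q ^ (i - 1 + psum y (i - 1)) * (\<alpha> i * q ^ (y i + 1) - 1) * g (eps_plus i y)))"
      unfolding weight_eps_plus[OF y i] by (simp add: power_add algebra_simps)
    finally show "(1 - q ^ (y i + 1)) * (weight h \<alpha> (M + 1) (eps_plus i y) * q ^ psum y (i - 1) * f y * g (eps_plus i y))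
      = - (weight h \<alpha> M y * f y *
      (pprod \<alpha> (i - 1) * q ^ (i - 1 + psum y (i - 1)) * (\<alpha> i * q ^ (y i + 1) - 1) * g (eps_plus i y)))" .
  qed
  also have "\<dots> = - (\<Sum>y\<in>grid h M. weight h \<alpha> M y * f y * lower_sum h \<alpha> g y)"
    unfolding lower_sum_def sum_distrib_left sum_negf by (subst sum.swap) simp
  finally have *: "(\<Sum>x\<in>grid h (M + 1). weight h \<alpha> (M + 1) x * raise_sum h f x * g x)
    = - (\<Sum>y\<in>grid h M. weight h \<alpha> M y * f y * lower_sum h \<alpha> g y)" .
  have "(M + 1) * (M + 1 + 1) div 2 = M + 1 + M * (M + 1) div 2" by simp
  then show ?thesis unfolding rform_def * by (simp add: power_add)
qed

text \<open>For i \<le> t the exponent of \<alpha>_i q grows by b, the size of the right part; these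
  b-th powers multiply to (A_t q^t)^b. Beyond t the size a of the left part cancels.\<close>

lemma weight_join:
  assumes y: "y \<in> grid t a" and z: "z \<in> grid s b"
  shows "weight (t + s) \<alpha> (a + b) (join t y z)
    = weight t \<alpha> a y * (pprod \<alpha> t * q ^ t) ^ b * weight s (shift t \<alpha>) b z"
proof -
  have "(\<Prod>i=1..t. qpoch q (q * \<alpha> i) (join t y z i) / qpoch q q (join t y z i)
        * (\<alpha> i * q) ^ (a + b - psum (join t y z) i))
    = (\<Prod>i=1..t. qpoch q (q * \<alpha> i) (y i) / qpoch q q (y i) * (\<alpha> i * q) ^ (a - psum y i) * (\<alpha> i * q) ^ b)"
  proof (intro prod.cong refl)
    fix i assume i: "i \<in> {1..t}"
    have "psum y i \<le> a" using grid_psum_le[OF y] i by simp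
    then have "a + b - psum (join t y z) i = a - psum y i + b" using i by (simp add: psum_join_left)
    moreover have "join t y z i = y i" using i by (simp add: join_def)
    ultimately show "qpoch q (q * \<alpha> i) (join t y z i) / qpoch q q (join t y z i)
        * (\<alpha> i * q) ^ (a + b - psum (join t y z) i)
      = qpoch q (q * \<alpha> i) (y i) / qpoch q q (y i) * (\<alpha> i * q) ^ (a - psum y i) * (\<alpha> i * q) ^ b"
      by (simp add: power_add)
  qed
  also have "\<dots> = weight t \<alpha> a y * (pprod \<alpha> t * q ^ t) ^ b"
  proof -
    have "(\<Prod>i=1..t. (\<alpha> i * q) ^ b) = (pprod \<alpha> t * q ^ t) ^ b"
      unfolding prod_power_distrib[symmetric] prod.distrib pprod_def by simp
    then show ?thesis unfolding weight_def by (simp only: prod.distrib)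
  qed
  finally have 1: "(\<Prod>i=1..t. qpoch q (q * \<alpha> i) (join t y z i) / qpoch q q (join t y z i)
        * (\<alpha> i * q) ^ (a + b - psum (join t y z) i)) = weight t \<alpha> a y * (pprod \<alpha> t * q ^ t) ^ b" .
  have 2: "(\<Prod>i=1..s. qpoch q (q * \<alpha> (t + i)) (join t y z (t + i)) / qpoch q q (join t y z (t + i))
        * (\<alpha> (t + i) * q) ^ (a + b - psum (join t y z) (t + i))) = weight s (shift t \<alpha>) b z"
    unfolding weight_def psum_join_right grid_psum[OF y]
    by (intro prod.cong refl) (simp add: join_def)
  show ?thesis unfolding weight_def[of "t + s"] prod_split_at 1 2 ..
qed

text \<open>Here a stands for X_t, and u, v make room for the root factors. The power q^(a(M-a)) is
  the excess of q^(M(M+1)/2) over the prefactors of the two parts.\<close>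

lemma rform_split:
  assumes f: "\<And>a y z. a \<le> M \<Longrightarrow> y \<in> grid t a \<Longrightarrow> z \<in> grid s (M - a) \<Longrightarrow> f (join t y z) = u a * f1 y * f2 z"
    and g: "\<And>a y z. a \<le> M \<Longrightarrow> y \<in> grid t a \<Longrightarrow> z \<in> grid s (M - a) \<Longrightarrow> g (join t y z) = v a * g1 y * g2 z"
  shows "rform (t + s) \<alpha> M f g = (\<Sum>a\<le>M. q ^ (a * (M - a)) * (pprod \<alpha> t * q ^ t) ^ (M - a) * u a * v a
    * rform t \<alpha> a f1 g1 * rform s (shift t \<alpha>) (M - a) f2 g2)"
  unfolding rform_def[of "t + s"] sum_grid_split sum_distrib_left
proof (intro sum.cong refl)
  fix a assume "a \<in> {..M}"
  then have a: "a \<le> M" by simp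
  define b where "b = M - a"
  have M: "M = a + b" using a by (simp add: b_def)
  have "M * (M + 1) = a * (a + 1) + b * (b + 1) + 2 * (a * b)" unfolding M by (simp add: algebra_simps)
  moreover have "even (a * (a + 1))" "even (b * (b + 1))" by simp_all
  ultimately have e: "M * (M + 1) div 2 = a * (a + 1) div 2 + b * (b + 1) div 2 + a * b"
    by (elim evenE) simp
  have t: "q ^ (M * (M + 1) div 2) * (weight (t + s) \<alpha> M (join t y z) * f (join t y z) * g (join t y z))
    = (q ^ (a * b) * (pprod \<alpha> t * q ^ t) ^ b * u a * v a)
      * ((q ^ (a * (a + 1) div 2) * (weight t \<alpha> a y * f1 y * g1 y))
      * (q ^ (b * (b + 1) div 2) * (weight s (shift t \<alpha>) b z * f2 z * g2 z)))"
    if y: "y \<in> grid t a" and z: "z \<in> grid s b" for y z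
    unfolding e f[OF a y z[unfolded b_def]] g[OF a y z[unfolded b_def]]
    unfolding M weight_join[OF y z] power_add by (simp only: mult_ac)
  have "(\<Sum>y\<in>grid t a. \<Sum>z\<in>grid s b. q ^ (M * (M + 1) div 2) * (weight (t + s) \<alpha> M (join t y z) * f (join t y z) * g (join t y z)))
    = (\<Sum>y\<in>grid t a. \<Sum>z\<in>grid s b. (q ^ (a * b) * (pprod \<alpha> t * q ^ t) ^ b * u a * v a)
      * ((q ^ (a * (a + 1) div 2) * (weight t \<alpha> a y * f1 y * g1 y))
      * (q ^ (b * (b + 1) div 2) * (weight s (shift t \<alpha>) b z * f2 z * g2 z))))"
    by (intro sum.cong refl) (rule t)
  also have "\<dots> = q ^ (a * b) * (pprod \<alpha> t * q ^ t) ^ b * u a * v a * rform t \<alpha> a f1 g1 * rform s (shift t \<alpha>) b f2 g2"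
  proof -
    have K: "(\<Sum>y\<in>I. \<Sum>z\<in>J. K * (F y * G z)) = K * (\<Sum>y\<in>I. F y) * (\<Sum>z\<in>J. G z)"
      for K :: real and F G and I J :: "(nat \<Rightarrow> nat) set"
      unfolding mult.assoc sum_product unfolding sum_distrib_left ..
    show ?thesis unfolding K rform_def sum_distrib_left ..
  qed
  finally show "(\<Sum>y\<in>grid t a. \<Sum>z\<in>grid s (M - a). q ^ (M * (M + 1) div 2) * (weight (t + s) \<alpha> M (join t y z) * f (join t y z) * g (join t y z)))
    = q ^ (a * (M - a)) * (pprod \<alpha> t * q ^ t) ^ (M - a) * u a * v a * rform t \<alpha> a f1 g1 * rform s (shift t \<alpha>) (M - a) f2 g2"
    unfolding b_def .
qed

text \<open>The form of raised Q_c against Q_d, computed in two ways: directly on c, and through the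
  adjoint on d. The asymmetry in c and d is exploited in
  \<open>rform_mqhahn_eq_0_less\<close>.\<close>

lemma rform_mqhahn_step:
  assumes "size1 c = h" "size1 d = h" "nonres q \<alpha> h N" "cs d \<le> N"
  shows "q ^ cs d * (q ^ cs c * (1 - q ^ (M + 1 - cs c))) * rform h \<alpha> (M + 1) (mqhahn q \<alpha> c) (mqhahn q \<alpha> d)
    = q ^ (M + 1) * (1 - pprod \<alpha> h * q ^ (h + M + cs d)) * rform h \<alpha> M (mqhahn q \<alpha> c) (mqhahn q \<alpha> d)"
proof -
  have nz: "\<And>k. 1 \<le> k \<Longrightarrow> k \<le> size1 c \<Longrightarrow> \<alpha> k \<noteq> 0" using assms unfolding nonres_def by simp
  have "q ^ cs c * (1 - q ^ (M + 1 - cs c)) * rform h \<alpha> (M + 1) (mqhahn q \<alpha> c) (mqhahn q \<alpha> d)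
    = rform h \<alpha> (M + 1) (raise_sum h (mqhahn q \<alpha> c)) (mqhahn q \<alpha> d)"
    unfolding rform_scale_left[symmetric]
  proof (intro rform_cong refl)
    fix x assume "x \<in> grid h (M + 1)"
    then show "q ^ cs c * (1 - q ^ (M + 1 - cs c)) * mqhahn q \<alpha> c x = raise_sum h (mqhahn q \<alpha> c) x"
      using mqhahn_raise[of c \<alpha> x, OF nz] assms(1) grid_psum[of x h "M + 1"] unfolding raise_sum_def by simp
  qed
  also have "\<dots> = - (q ^ (M + 1) * rform h \<alpha> M (mqhahn q \<alpha> c) (lower_sum h \<alpha> (mqhahn q \<alpha> d)))"
    by (rule rform_raise_lower)
  finally have "q ^ cs d * (q ^ cs c * (1 - q ^ (M + 1 - cs c)) * rform h \<alpha> (M + 1) (mqhahn q \<alpha> c) (mqhahn q \<alpha> d))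
    = - (q ^ (M + 1)) * (q ^ cs d * rform h \<alpha> M (lower_sum h \<alpha> (mqhahn q \<alpha> d)) (mqhahn q \<alpha> c))"
    by (simp add: rform_commute)
  also have "q ^ cs d * rform h \<alpha> M (lower_sum h \<alpha> (mqhahn q \<alpha> d)) (mqhahn q \<alpha> c)
    = - (1 - pprod \<alpha> h * q ^ (h + M + cs d)) * rform h \<alpha> M (mqhahn q \<alpha> d) (mqhahn q \<alpha> c)"
    unfolding rform_scale_left[symmetric]
  proof (intro rform_cong refl)
    fix x assume "x \<in> grid h M"
    then show "q ^ cs d * lower_sum h \<alpha> (mqhahn q \<alpha> d) x = - (1 - pprod \<alpha> h * q ^ (h + M + cs d)) * mqhahn q \<alpha> d x"
      using mqhahn_lower[of \<alpha> d N x] assms grid_psum[of x h M] unfolding lower_sum_def by simp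
  qed
  finally show ?thesis
    unfolding rform_commute[of _ _ _ "mqhahn q \<alpha> d"]
    by (simp only: mult_minus_left mult_minus_right minus_minus mult_ac)
qed

text \<open>Below size cs d the function Q_d is 0. From there on M + 1 \<ge> cs d > cs c, so the
  coefficient 1 - q^(M+1-cs c) is nonzero and the zero propagates upwards.\<close>

lemma rform_mqhahn_eq_0_less:
  assumes "size1 c = h" "size1 d = h" "nonres q \<alpha> h N" "cs d \<le> N" "cs c < cs d"
  shows "rform h \<alpha> M (mqhahn q \<alpha> c) (mqhahn q \<alpha> d) = 0"
proof (induction M)
  case 0
  have "rform h \<alpha> 0 (mqhahn q \<alpha> c) (mqhahn q \<alpha> d) = rform h \<alpha> 0 (\<lambda>x. 0 * 0) (mqhahn q \<alpha> d)"
    unfolding rform_def using assms(2,5) mqhahn_eq_0[of _ d q \<alpha>] grid_psum[of _ h 0]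
    by (auto intro!: sum.neutral)
  then show ?case unfolding rform_scale_left by simp
next
  case (Suc M)
  show ?case
  proof (cases "Suc M < cs d")
    case True
    then have "mqhahn q \<alpha> d x = 0" if "x \<in> grid h (Suc M)" for x
      using mqhahn_eq_0[of x d q \<alpha>] grid_psum[OF that] assms(2) by simp
    then show ?thesis unfolding rform_def by simp
  next
    case False
    then have "q ^ (M + 1 - cs c) \<noteq> 1" using assms(5) power_eq_iff_q[of "M + 1 - cs c" 0] by simp
    then show ?thesis using rform_mqhahn_step[OF assms(1-4), of M] Suc q by simp
  qed
qed

lemma mqhahn_join:
  assumes "pprod \<alpha> (size1 l) \<noteq> 0" "y \<in> grid (size1 l) a" "z \<in> grid (size1 r) b"
  shows "mqhahn q \<alpha> (Node l m r) (join (size1 l) y z)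
    = root_factor m (cs l) (cs r) (pprod \<alpha> (size1 l) * q ^ size1 l)
        (pprod (shift (size1 l) \<alpha>) (size1 r) * q ^ size1 r) a b
      * mqhahn q \<alpha> l y * mqhahn q (shift (size1 l) \<alpha>) r z"
proof -
  have "psum (join (size1 l) y z) (size1 l) = a"
    using psum_join_left[of "size1 l" "size1 l" y z] grid_psum[OF assms(2)] by simp
  moreover have "psum (shift (size1 l) (join (size1 l) y z)) (size1 r) = psum z (size1 r)"
    by (rule psum_cong) (simp add: join_def)
  moreover have "mqhahn q \<alpha> l (join (size1 l) y z) = mqhahn q \<alpha> l y"
    by (rule mqhahn_cong) (simp add: join_def)
  moreover have "mqhahn q (shift (size1 l) \<alpha>) r (shift (size1 l) (join (size1 l) y z)) = mqhahn q (shift (size1 l) \<alpha>) r z"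
    by (rule mqhahn_cong) (simp add: join_def)
  ultimately show ?thesis unfolding mqhahn_Node[OF assms(1)] using grid_psum[OF assms(3)] by simp
qed

lemma size1_map_tree: "size1 (map_tree f c) = size1 c"
  by (induction c) simp_all

lemma rform_mqhahn_eq_0:
  assumes "map_tree (\<lambda>_. ()) c = map_tree (\<lambda>_. ()) d" "nonres q \<alpha> (size1 c) N" "cs c \<le> N" "cs d \<le> N" "c \<noteq> d"
  shows "rform (size1 c) \<alpha> M (mqhahn q \<alpha> c) (mqhahn q \<alpha> d) = 0"
  using assms
proof (induction c arbitrary: d \<alpha> M)
  case Leaf
  then show ?case by (cases d) auto
next
  case (Node l m r)
  obtain l' m' r' where d: "d = Node l' m' r'"
    and sh: "map_tree (\<lambda>_. ()) l = map_tree (\<lambda>_. ()) l'" "map_tree (\<lambda>_. ()) r = map_tree (\<lambda>_. ()) r'"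
    using Node.prems(1) by (cases d) auto
  have sz: "size1 l' = size1 l" "size1 r' = size1 r" using sh size1_map_tree by metis+
  have szd: "size1 d = size1 (Node l m r)" unfolding d by (simp add: sz)
  show ?case
  proof (cases "cs (Node l m r) = cs d")
    case False
    then consider "cs (Node l m r) < cs d" | "cs d < cs (Node l m r)" by linarith
    then show ?thesis
    proof cases
      case 1
      then show ?thesis using rform_mqhahn_eq_0_less[OF refl szd Node.prems(2,4)] by blast
    next
      case 2
      then show ?thesis unfolding rform_commute[of _ _ _ "mqhahn q \<alpha> (Node l m r)"]
        using rform_mqhahn_eq_0_less[OF szd refl Node.prems(2,3)] by blast
    qed
  next
    case True
    define t where "t = size1 l"
    define s where "s = size1 r"
    have nr: "nonres q \<alpha> (t + s) N" using Node.prems by (simp add: t_def s_def)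
    have nrl: "nonres q \<alpha> (size1 l) N" using nonres_left[OF nr] by (simp add: t_def)
    have nrr: "nonres q (shift t \<alpha>) (size1 r) N" using nonres_right[OF nr] by (simp add: s_def)
    have p: "pprod \<alpha> (size1 l) \<noteq> 0" using nonres_pprod_nz[OF nrl] by simp
    have 0: "rform t \<alpha> a (mqhahn q \<alpha> l) (mqhahn q \<alpha> l') * rform s (shift t \<alpha>) b (mqhahn q (shift t \<alpha>) r) (mqhahn q (shift t \<alpha>) r') = 0"
      for a b
    proof (cases "l = l'")
      case l: False
      then show ?thesis unfolding t_def
        using Node.IH(1)[OF sh(1) nrl _ _ l] Node.prems d by simp
    next
      case l: True
      \<comment> \<open>With equal label sums, equal sons would force equal root labels.\<close>
      have r: "r \<noteq> r'" using True Node.prems(5) l unfolding d by auto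
      then show ?thesis unfolding s_def
        using Node.IH(2)[OF sh(2) nrr _ _ r] Node.prems d by simp
    qed
    have szn: "size1 (Node l m r) = t + s" by (simp add: t_def s_def)
    define u where "u k l r a = root_factor k (cs l) (cs r) (pprod \<alpha> t * q ^ t)
        (pprod (shift t \<alpha>) s * q ^ s) a (M - a)" for k l r a
    have f: "mqhahn q \<alpha> (Node l m r) (join t y z) = u m l r a * mqhahn q \<alpha> l y * mqhahn q (shift t \<alpha>) r z"
      if "y \<in> grid t a" "z \<in> grid s (M - a)" for a y z
      unfolding u_def using mqhahn_join[OF p, of y a z r "M - a" m] that by (simp add: t_def s_def)
    have g: "mqhahn q \<alpha> (Node l' m' r') (join t y z) = u m' l' r' a * mqhahn q \<alpha> l' y * mqhahn q (shift t \<alpha>) r' z"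
      if "y \<in> grid t a" "z \<in> grid s (M - a)" for a y z
      unfolding u_def using mqhahn_join[of \<alpha> l' y a z r' "M - a" m'] p that by (simp add: t_def s_def sz)
    have "rform (t + s) \<alpha> M (mqhahn q \<alpha> (Node l m r)) (mqhahn q \<alpha> (Node l' m' r'))
      = (\<Sum>a\<le>M. q ^ (a * (M - a)) * (pprod \<alpha> t * q ^ t) ^ (M - a) * u m l r a * u m' l' r' a
        * rform t \<alpha> a (mqhahn q \<alpha> l) (mqhahn q \<alpha> l')
        * rform s (shift t \<alpha>) (M - a) (mqhahn q (shift t \<alpha>) r) (mqhahn q (shift t \<alpha>) r'))"
      by (rule rform_split) (rule f g; assumption)+
    then show ?thesis unfolding szn d by (simp only: 0 mult.assoc mult_zero_right sum.neutral_const)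
  qed
qed

end


subsection \<open>The norms\<close>

text \<open>Gaussian binomials by a q-Pascal rule, which drives the induction in
  \<open>q_vandermonde\<close>. When m - x is truncated, the factor \<open>qbinom q m x\<close> is
  0.\<close>

fun qbinom :: "real \<Rightarrow> nat \<Rightarrow> nat \<Rightarrow> real" where
  "qbinom q m 0 = 1"
| "qbinom q 0 (Suc x) = 0"
| "qbinom q (Suc m) (Suc x) = qbinom q m (Suc x) + q ^ (m - x) * qbinom q m x"

lemma qbinom_eq_0: "m < x \<Longrightarrow> qbinom q m x = 0"
  by (induction q m x rule: qbinom.induct) auto

lemma sum_qbinom_Suc:
  "(\<Sum>x\<le>Suc m. qbinom q (Suc m) x * f x)
    = (\<Sum>x\<le>m. qbinom q m x * f x) + (\<Sum>x\<le>m. q ^ (m - x) * qbinom q m x * f (Suc x))"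
proof -
  have "(\<Sum>x\<le>m. qbinom q m x * f x) = (\<Sum>x\<le>Suc m. qbinom q m x * f x)"
    by (simp add: qbinom_eq_0)
  also have "\<dots> = f 0 + (\<Sum>x\<le>m. qbinom q m (Suc x) * f (Suc x))"
    by (subst sum.atMost_Suc_shift) simp
  finally show ?thesis
    by (subst sum.atMost_Suc_shift) (simp add: distrib_right sum.distrib)
qed

text \<open>q-Vandermonde cleared of the denominators (A;q)_x. The q-Pascal rule splits the sum at m
  + 1 into sums at m with parameters (A, B) and (Aq, B/q). Both have the same product AB, so both
  equal (AB;q)_m and only the coefficients have to be added.\<close>

lemma q_vandermonde:
  assumes "q \<noteq> 0"
  shows "(\<Sum>x\<le>m. qbinom q m x * (A ^ x * q ^ (x * (x - 1)) * (\<Prod>r<x. 1 - B / q ^ r) * qpoch q (A * q ^ x) (m - x)))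
    = qpoch q (A * B) m"
proof (induction m arbitrary: A B)
  case (Suc m)
  define f where "f A B m x = A ^ x * q ^ (x * (x - 1)) * (\<Prod>r<x. 1 - B / q ^ r) * qpoch q (A * q ^ x) (m - x)"
    for A B m x
  have 1: "qbinom q m x * f A B (Suc m) x = (1 - A * q ^ m) * (qbinom q m x * f A B m x)" if "x \<le> m" for x
  proof -
    have "A * q ^ x * q ^ (m - x) = A * q ^ m" using that by (simp add: mult.assoc flip: power_add)
    then have "qpoch q (A * q ^ x) (Suc m - x) = qpoch q (A * q ^ x) (m - x) * (1 - A * q ^ m)"
      using that by (simp add: Suc_diff_le qpoch_Suc)
    then show ?thesis unfolding f_def by (simp only: mult_ac)
  qed
  have 2: "q ^ (m - x) * qbinom q m x * f A B (Suc m) (Suc x)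
      = A * q ^ m * (1 - B) * (qbinom q m x * f (A * q) (B / q) m x)" if "x \<le> m" for x
  proof -
    have "m - x + Suc x * (Suc x - 1) = m + x + x * (x - 1)"
      using that by (cases x) auto
    then have e: "q ^ (m - x) * q ^ (Suc x * (Suc x - 1)) = q ^ m * q ^ x * q ^ (x * (x - 1))"
      by (metis power_add)
    have "(\<Prod>r<Suc x. 1 - B / q ^ r) = (1 - B) * (\<Prod>r<x. 1 - B / q / q ^ r)"
      by (subst prod.lessThan_Suc_shift) (simp add: mult.commute)
    then have "q ^ (m - x) * qbinom q m x * f A B (Suc m) (Suc x)
      = (q ^ (m - x) * q ^ (Suc x * (Suc x - 1))) * (A * A ^ x * (1 - B) * qbinom q m x
        * ((\<Prod>r<x. 1 - B / q / q ^ r) * qpoch q (A * q * q ^ x) (m - x)))"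
      unfolding f_def by (simp only: power_Suc diff_Suc_Suc mult_ac)
    also have "\<dots> = A * q ^ m * (1 - B) * (qbinom q m x * f (A * q) (B / q) m x)"
      unfolding e f_def power_mult_distrib by (simp only: mult_ac)
    finally show ?thesis .
  qed
  have "(\<Sum>x\<le>Suc m. qbinom q (Suc m) x * f A B (Suc m) x)
    = (1 - A * q ^ m) * (\<Sum>x\<le>m. qbinom q m x * f A B m x)
      + A * q ^ m * (1 - B) * (\<Sum>x\<le>m. qbinom q m x * f (A * q) (B / q) m x)"
    unfolding sum_qbinom_Suc sum_distrib_left
    by (intro arg_cong2[of _ _ _ _ "(+)"] sum.cong refl 1 2) simp_all
  also have "\<dots> = (1 - A * q ^ m) * qpoch q (A * B) m + A * q ^ m * (1 - B) * qpoch q (A * q * (B / q)) m"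
    unfolding f_def Suc.IH ..
  also have "\<dots> = qpoch q (A * B) (Suc m)"
    using assms by (simp add: qpoch_Suc algebra_simps)
  finally show ?case unfolding f_def .
qed simp

text \<open>The product over r lists the last x factors of (B;q)_m backwards; division by q^r avoids
  truncated exponents.\<close>

lemma qpoch_reverse:
  assumes "x \<le> m" "q \<noteq> 0"
  shows "qpoch q B (m - x) * (\<Prod>r<x. 1 - B * q ^ (m - 1) / q ^ r) = qpoch q B m"
  using assms(1)
proof (induction x)
  case (Suc x)
  have e: "m - x = Suc (m - Suc x)" "m - 1 = m - Suc x + x" using Suc.prems by auto
  have "B * q ^ (m - 1) / q ^ x = B * q ^ (m - Suc x)"
    unfolding e(2) using assms(2) by (simp add: power_add)
  then have "qpoch q B (m - Suc x) * (\<Prod>r<Suc x. 1 - B * q ^ (m - 1) / q ^ r)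
    = qpoch q B (m - x) * (\<Prod>r<x. 1 - B * q ^ (m - 1) / q ^ r)"
    unfolding e(1) qpoch_Suc prod.lessThan_Suc by (simp only: mult_ac)
  moreover have "qpoch q B (m - x) * (\<Prod>r<x. 1 - B * q ^ (m - 1) / q ^ r) = qpoch q B m"
    using Suc by simp
  ultimately show ?case by (rule trans)
qed simp

section \<open>The product of \<Gamma>(U) over all vertices, as a recursion on the tree\<close>

lemma pv_eq: "pv q \<alpha> l U = pprod (shift l \<alpha>) (size1 U) * q ^ size1 U"
proof -
  have "(\<Prod>k=l+1..l+n. \<alpha> k) = pprod (shift l \<alpha>) n" for n
    by (induction n) (simp_all add: pprod_def)
  then show ?thesis unfolding pv_def by simp
qed

lemma \<Gamma>v_shift: "\<Gamma>v q \<alpha> (t + l, U) = \<Gamma>v q (shift t \<alpha>) (l, U)"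
  by (cases U) (simp_all add: pv_eq Let_def add.assoc)

lemma vertices_shift: "vertices (t + l) c = map (\<lambda>(k, U). (t + k, U)) (vertices l c)"
  by (induction c arbitrary: l) (simp_all add: add.assoc)

definition \<Gamma>prod :: "real \<Rightarrow> (nat \<Rightarrow> real) \<Rightarrow> nat tree \<Rightarrow> real" where
  "\<Gamma>prod q \<alpha> c = (\<Prod>U\<leftarrow>vertices 0 c. \<Gamma>v q \<alpha> U)"

lemma \<Gamma>prod_Leaf: "\<Gamma>prod q \<alpha> Leaf = 1"
  by (simp add: \<Gamma>prod_def)

lemma \<Gamma>prod_Node: "\<Gamma>prod q \<alpha> (Node l m r)
  = \<Gamma>v q \<alpha> (0, Node l m r) * \<Gamma>prod q \<alpha> l * \<Gamma>prod q (shift (size1 l) \<alpha>) r"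
proof -
  have "map (\<Gamma>v q \<alpha>) (vertices (size1 l) r) = map (\<Gamma>v q (shift (size1 l) \<alpha>)) (vertices 0 r)"
    using vertices_shift[of "size1 l" 0 r] by (auto simp: \<Gamma>v_shift)
  then show ?thesis unfolding \<Gamma>prod_def by (simp add: mult.assoc del: \<Gamma>v.simps)
qed

context q_base
begin

lemma qbinom_eq: "x \<le> m \<Longrightarrow> qbinom q m x = qpoch q q m / (qpoch q q x * qpoch q q (m - x))"
proof (induction m arbitrary: x)
  case (Suc m)
  show ?case
  proof (cases x)
    case 0
    then show ?thesis using qpoch_q_nz[of "Suc m"] by simp
  next
    case (Suc y)
    with Suc.prems have y: "y \<le> m" by simp
    have nz: "q * q ^ k \<noteq> 1" for k using power_eq_iff_q[of "Suc k" 0] by simp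
    show ?thesis
    proof (cases "y = m")
      case True
      then show ?thesis using Suc.IH[of m] Suc qpoch_q_nz[of m] qpoch_q_nz[of "Suc m"] by (simp add: qbinom_eq_0)
    next
      case False
      with y have y1: "Suc y \<le> m" by simp
      define d where "d = m - Suc y"
      have d: "m = d + Suc y" "m - y = Suc d" "m - Suc y = d" using y1 by (auto simp: d_def)
      have "qbinom q (Suc m) (Suc y) = qpoch q q m / (qpoch q q (Suc y) * qpoch q q d)
          + q ^ Suc d * (qpoch q q m / (qpoch q q y * qpoch q q (Suc d)))"
        using Suc.IH[OF y1] Suc.IH[OF y] by (simp add: d)
      also have "\<dots> = qpoch q q (Suc m) / (qpoch q q (Suc y) * qpoch q q (Suc d))"
        unfolding qpoch_Suc using nz[of y] nz[of d] qpoch_q_nz[of y] qpoch_q_nz[of d]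
        by (simp add: divide_simps) (simp add: d(1) power_add algebra_simps)
      finally show ?thesis using Suc d by simp
    qed
  qed
qed simp

lemma qhahn_0: "qhahn q m 0 a b N = q powr (real m ^ 2 / 2 - real m * real N) * (qpoch q q N / qpoch q q (N - m))"
proof -
  have "hahn_sum m 0 a b N = (\<Sum>k\<in>{0}. hahn_coeff m a b k * q ^ k
     * (qpoch q (q powi (- int 0)) k / qpoch q (q powi (- int N)) k))"
    unfolding hahn_sum_def using qpoch_neg_eq_0[of 0] by (intro sum.mono_neutral_right) auto
  then show ?thesis unfolding qhahn_eq by (simp add: hahn_coeff_def)
qed

text \<open>For \<open>m = N\<close> the right-hand side of the lowering relation is 0, which determines the polynomial.\<close>
lemma qhahn_full_square:
  assumes "x \<le> m" and nz: "\<And>k. k < m \<Longrightarrow> a * q ^ Suc k \<noteq> 1"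
  shows "(qhahn q m x a b m)\<^sup>2 = q powr (- (real m ^ 2)) * (qpoch q q m)\<^sup>2 * (a * q) ^ (2 * x) * q ^ (x * (x - 1))
    * (\<Prod>r<x. 1 - b * q * q ^ (m - 1) / q ^ r)\<^sup>2 / (qpoch q (a * q) x)\<^sup>2"
  using assms(1)
proof (induction x)
  case 0
  have "q powr (real m ^ 2 / 2 - real m * real m) * q powr (real m ^ 2 / 2 - real m * real m)
    = q powr (- (real m ^ 2))"
    unfolding powr_add[symmetric] by (simp add: power2_eq_square)
  then show ?case unfolding qhahn_0 by (simp add: power_mult_distrib power2_eq_square mult_ac)
next
  case (Suc x)
  define N where "N = m - 1"
  have N: "m = N + 1" "x \<le> N" using Suc.prems by (auto simp: N_def)
  have x1: "a * q * q ^ x \<noteq> 1" using nz[of x] Suc.prems by (simp add: mult.assoc)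
  have "b * q ^ (N - x + 1) * q ^ x = b * q * q ^ (m - 1)"
    using N by (simp add: mult.assoc flip: power_add)
  then have e: "b * q ^ (N - x + 1) = b * q * q ^ (m - 1) / q ^ x"
    using q by (simp add: field_simps)
  define w where "w = 1 - b * q * q ^ (m - 1) / q ^ x"
  have "q ^ m * ((1 - a * q ^ Suc x) * qhahn q m (Suc x) a b (N + 1)
      + a * q ^ Suc x * (1 - b * q ^ (N - x + 1)) * qhahn q m x a b (N + 1)) = 0"
    using qhahn_lower[of m N x a b] N nz by simp
  then have "(1 - a * q * q ^ x) * qhahn q m (Suc x) a b m = - (a * q * q ^ x * w * qhahn q m x a b m)"
    unfolding e w_def N(1)[symmetric] using q by (simp add: mult.assoc)
  \<comment> \<open>The sign (-1)^x that this recurrence accumulates disappears in the square, which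
    is all the norm requires.\<close>
  then have s: "qhahn q m (Suc x) a b m = - (a * q * q ^ x * w * qhahn q m x a b m) / (1 - a * q * q ^ x)"
    using x1 by (metis nonzero_mult_div_cancel_left right_minus_eq)
  have IH: "(qhahn q m x a b m)\<^sup>2 = q powr (- (real m ^ 2)) * (qpoch q q m)\<^sup>2 * (a * q) ^ (2 * x) * q ^ (x * (x - 1))
    * (\<Prod>r<x. 1 - b * q * q ^ (m - 1) / q ^ r)\<^sup>2 / (qpoch q (a * q) x)\<^sup>2"
    using Suc by simp
  have "Suc x * (Suc x - 1) = x + x + x * (x - 1)" by (cases x) auto
  then have e2: "q ^ (Suc x * (Suc x - 1)) = (q ^ x)\<^sup>2 * q ^ (x * (x - 1))"
    by (simp only: power_add power2_eq_square)
  have e3: "(a * q) ^ (2 * Suc x) = (a * q)\<^sup>2 * (a * q) ^ (2 * x)"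
    by (simp add: power2_eq_square)
  show ?case unfolding e2 e3 unfolding s qpoch_Suc prod.lessThan_Suc power_divide power2_minus power_mult_distrib IH
      w_def[symmetric]
    by (simp only: times_divide_eq_right times_divide_eq_left divide_divide_eq_left power_mult_distrib mult_ac)
qed

text \<open>Equals M(M+1)/2 - 2Mn + n^2 + n, hence an integer, possibly negative. As a real number
  it can be added to the half-integral exponents in the normalisation of
  \<open>qhahn\<close>.\<close>

definition norm_exp :: "nat \<Rightarrow> nat \<Rightarrow> real" where
  "norm_exp M n = ((real M - 2 * real n)^2 + real M + 2 * real n - 2 * real n ^ 2) / 2"

lemma norm_exp_Suc: "norm_exp (Suc M) n = norm_exp M n + (real M + 1 - 2 * real n)"
  unfolding norm_exp_def by (simp add: power2_eq_square algebra_simps add_divide_distrib diff_divide_distrib)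

definition norm_formula :: "(nat \<Rightarrow> real) \<Rightarrow> nat tree \<Rightarrow> nat \<Rightarrow> real" where
  "norm_formula \<alpha> c M = qpoch q (pprod \<alpha> (size1 c) * q ^ (size1 c + 2 * cs c)) (M - cs c) / qpoch q q (M - cs c)
     * q powr norm_exp M (cs c) * \<Gamma>prod q \<alpha> c"

text \<open>\<open>rform_mqhahn_step\<close> with c = d: consecutive norms have the quotient
  q^(M+1-2n) (1 - A_h q^(h+M+n)) / (1 - q^(M+1-n)), and the formula satisfies the same
  recurrence.\<close>

lemma norm_formula_step:
  assumes "nonres q \<alpha> (size1 c) N" "cs c \<le> N" "cs c \<le> M"
    and base: "rform (size1 c) \<alpha> (cs c) (mqhahn q \<alpha> c) (mqhahn q \<alpha> c) = norm_formula \<alpha> c (cs c)"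
  shows "rform (size1 c) \<alpha> M (mqhahn q \<alpha> c) (mqhahn q \<alpha> c) = norm_formula \<alpha> c M"
  using assms(3)
proof (induction M rule: dec_induct)
  case (step M)
  define n where "n = cs c"
  define h where "h = size1 c"
  define A where "A = pprod \<alpha> h"
  have d: "M + 1 - n = Suc (M - n)" "Suc M - n = Suc (M - n)" using step by (auto simp: n_def)
  have nz: "1 - q * q ^ (M - n) \<noteq> 0" using power_eq_iff_q[of "Suc (M - n)" 0] by simp
  have "q ^ n * (q ^ n * (1 - q * q ^ (M - n))) * rform h \<alpha> (Suc M) (mqhahn q \<alpha> c) (mqhahn q \<alpha> c)
    = q ^ (M + 1) * (1 - A * q ^ (h + M + n)) * norm_formula \<alpha> c M"
    using rform_mqhahn_step[OF refl refl assms(1,2), of M] step.IH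
    unfolding n_def[symmetric] h_def[symmetric] A_def[symmetric] d by simp
  also have "\<dots> = q ^ n * (q ^ n * (1 - q * q ^ (M - n))) * norm_formula \<alpha> c (Suc M)"
  proof -
    have "h + M + n = h + 2 * n + (M - n)" using step by (simp add: n_def)
    then have "q ^ (h + M + n) = q ^ (h + 2 * n) * q ^ (M - n)"
      by (simp only: power_add)
    then have 1: "qpoch q (A * q ^ (h + 2 * n)) (Suc (M - n))
      = qpoch q (A * q ^ (h + 2 * n)) (M - n) * (1 - A * q ^ (h + M + n))"
      by (simp add: qpoch_Suc mult.assoc)
    have "q powr norm_exp (Suc M) n = q powr norm_exp M n * q powr (real (M + 1) - real (n + n))"
      unfolding norm_exp_Suc powr_add[symmetric] by (simp add: algebra_simps)
    also have "q powr (real (M + 1) - real (n + n)) = q ^ (M + 1) / (q ^ n * q ^ n)"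
      using q by (simp only: powr_diff powr_realpow power_add)
    finally have 2: "q powr norm_exp (Suc M) n = q powr norm_exp M n * (q ^ (M + 1) / (q ^ n * q ^ n))" .
    have "k * s * (p / c * e * G) = v * (v * z) * (p * s / (c * z) * (e * (k / (v * v))) * G)"
      if "c \<noteq> 0" "z \<noteq> 0" "v \<noteq> 0" for k s p c e G v z :: real
      using that by (simp add: field_simps)
    from this[of "qpoch q q (M - n)" "1 - q * q ^ (M - n)" "q ^ n"] show ?thesis
      unfolding norm_formula_def n_def[symmetric] h_def[symmetric] A_def[symmetric] d 1 2 qpoch_Suc[of q q]
      using qpoch_q_nz nz q by simp
  qed
  finally show ?case using nz q by (simp add: h_def)
qed (rule base)

text \<open>Bookkeeping for one summand in \<open>rform_mqhahn_base\<close>: e1, ..., e6 are its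
  powers of q, Ab and A2 its powers of the left parameter, Ax, By, Bm, qm, qx, qy Pochhammer
  symbols, and Pi the reversed product of \<open>qpoch_reverse\<close>.\<close>

lemma norm_term_aux:
  fixes qm :: real
  assumes "e1 * e2 * e3 * e4 * e5 * e6 = C" "Ab * A2 = Am * A1" "By * Pi = Bm" "Ax \<noteq> 0" "qx \<noteq> 0" "qy \<noteq> 0"
  shows "e1 * (Ab * e2) * (e3 * (e4 * qm\<^sup>2 * A2 * P * Pi\<^sup>2 / Ax\<^sup>2)) * (Ax / qx * e5 * Gl) * (By / qy * e6 * Gr)
    = qm * Bm * Am * C * Gl * Gr * (qm / (qx * qy) * (A1 * P * Pi / Ax))"
proof -
  have "e1 * (Ab * e2) * (e3 * (e4 * qm\<^sup>2 * A2 * P * Pi\<^sup>2 / Ax\<^sup>2)) * (Ax / qx * e5 * Gl) * (By / qy * e6 * Gr)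
    = (e1 * e2 * e3 * e4 * e5 * e6) * (Ab * A2) * (By * Pi) * qm\<^sup>2 * P * Pi * Gl * Gr / (Ax * qx * qy)"
    using assms(4-6) by (simp add: power2_eq_square mult_ac)
  then show ?thesis unfolding assms(1-3) by (simp add: power2_eq_square mult_ac)
qed

text \<open>At size n the root factor vanishes unless X_t = i + x with 0 \<le> x \<le> m, and then
  its one-variable polynomial has degree m equal to its last parameter, so
  \<open>qhahn_full_square\<close> applies. With the norms of the subtrees at sizes i + x and j + m
  - x, the sum over x becomes a q-Vandermonde sum times a constant.\<close>

lemma rform_mqhahn_base:
  assumes nr: "nonres q \<alpha> (size1 l + size1 r) N" and le: "m + cs l + cs r \<le> N"
    and L: "\<And>a. cs l \<le> a \<Longrightarrow> rform (size1 l) \<alpha> a (mqhahn q \<alpha> l) (mqhahn q \<alpha> l) = norm_formula \<alpha> l a"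
    and R: "\<And>b. cs r \<le> b \<Longrightarrow> rform (size1 r) (shift (size1 l) \<alpha>) b (mqhahn q (shift (size1 l) \<alpha>) r)
        (mqhahn q (shift (size1 l) \<alpha>) r) = norm_formula (shift (size1 l) \<alpha>) r b"
  shows "rform (size1 l + size1 r) \<alpha> (m + cs l + cs r) (mqhahn q \<alpha> (Node l m r)) (mqhahn q \<alpha> (Node l m r))
    = norm_formula \<alpha> (Node l m r) (m + cs l + cs r)"
proof -
  define t where "t = size1 l"
  define s where "s = size1 r"
  define i where "i = cs l"
  define j where "j = cs r"
  define n where "n = m + i + j"
  define \<beta> where "\<beta> = shift t \<alpha>"
  define A where "A = pprod \<alpha> t * q ^ t"
  define B where "B = pprod \<beta> s * q ^ s"
  define A' where "A' = A * q ^ (2 * i)"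
  define B' where "B' = B * q ^ (2 * j)"
  define Gl where "Gl = \<Gamma>prod q \<alpha> l"
  define Gr where "Gr = \<Gamma>prod q \<beta> r"
  define u where "u a = root_factor m i j A B a (n - a)" for a
  have nrl: "nonres q \<alpha> (size1 l) N" using nonres_left[OF nr] .
  have nzp: "pprod \<alpha> (size1 l) \<noteq> 0" using nonres_pprod_nz[OF nrl] by simp
  have f: "mqhahn q \<alpha> (Node l m r) (join t y z) = u a * mqhahn q \<alpha> l y * mqhahn q \<beta> r z"
    if "y \<in> grid t a" "z \<in> grid s (n - a)" for a y z
    unfolding u_def \<beta>_def using mqhahn_join[OF nzp, of y a z r "n - a" m] that
    by (simp add: t_def s_def A_def B_def \<beta>_def i_def j_def)
  have nzA: "A' * q ^ k \<noteq> 1" if "k < m" for k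
  proof -
    have "cs l + m \<le> N" using le by simp
    from nonres_cs[OF nrl this that] show ?thesis
      by (simp add: A'_def A_def t_def i_def power_add mult.assoc)
  qed
  have nzAx: "qpoch q A' x \<noteq> 0" if "x \<le> m" for x
    using nzA that by (auto simp: qpoch_eq_0_iff)
  \<comment> \<open>The total exponent of q in a summand that is left after the powers of
    \<open>A'\<close> and q^(x(x-1)) are set aside; by \<open>ee\<close> below it does not depend on
    x.\<close>
  define C where "C = norm_exp n n - 2 * real i * real j - real m"
  define K where "K = qpoch q q m * qpoch q B' m * A' ^ (m + j) * q powr C * Gl * Gr"
  have pw: "q powi (2 * int i - 1) * q = q ^ (2 * i)" for i
    using q by (simp add: power_int_diff power_int_mult power_mult)
  have "rform (t + s) \<alpha> n (mqhahn q \<alpha> (Node l m r)) (mqhahn q \<alpha> (Node l m r))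
    = (\<Sum>a\<le>n. q ^ (a * (n - a)) * A ^ (n - a) * u a * u a
        * rform t \<alpha> a (mqhahn q \<alpha> l) (mqhahn q \<alpha> l) * rform s \<beta> (n - a) (mqhahn q \<beta> r) (mqhahn q \<beta> r))"
    unfolding A_def \<beta>_def by (rule rform_split) (rule f[unfolded \<beta>_def]; assumption)+
  also have "\<dots> = (\<Sum>x\<le>m. q ^ ((i + x) * (n - (i + x))) * A ^ (n - (i + x)) * u (i + x) * u (i + x)
        * rform t \<alpha> (i + x) (mqhahn q \<alpha> l) (mqhahn q \<alpha> l) * rform s \<beta> (n - (i + x)) (mqhahn q \<beta> r) (mqhahn q \<beta> r))"
  proof -
    have "u a = 0" if "a \<notin> (\<lambda>x. i + x) ` {..m}" "a \<le> n" for a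
    proof (cases "a < i")
      case True
      then show ?thesis by (simp add: u_def root_factor_def)
    next
      case False
      then have "a = i + (a - i)" by simp
      with that(1) have "\<not> a - i \<le> m" by blast
      then show ?thesis using that(2) by (auto simp: u_def root_factor_def n_def)
    qed
    moreover have "(\<lambda>x. i + x) ` {..m} \<subseteq> {..n}" by (auto simp: n_def)
    ultimately show ?thesis
      by (subst sum.mono_neutral_right[of _ "(\<lambda>x. i + x) ` {..m}"]) (simp_all add: sum.reindex)
  qed
  also have "\<dots> = (\<Sum>x\<le>m. K * (qbinom q m x * (A' ^ x * q ^ (x * (x - 1)) * (\<Prod>r<x. 1 - B' * q ^ (m - 1) / q ^ r) / qpoch q A' x)))"
  proof (intro sum.cong refl)
    fix x assume "x \<in> {..m}"
    then have x: "x \<le> m" by simp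
    define y where "y = m - x"
    have y: "n - (i + x) = j + y" "m = x + y" using x by (auto simp: y_def n_def)
    define a0 where "a0 = A * q powi (2 * int i - 1)"
    define b0 where "b0 = B * q powi (2 * int j - 1)"
    have ab0: "a0 * q = A'" "b0 * q = B'"
      unfolding a0_def b0_def A'_def B'_def mult.assoc pw by simp_all
    have a0S: "a0 * q ^ Suc k \<noteq> 1" if "k < m" for k
      using nzA[OF that] unfolding ab0(1)[symmetric] by (simp add: mult.assoc)
    have u: "u (i + x) = q powi (- int (j * (i + x))) * qhahn q m x a0 b0 m"
      unfolding u_def root_factor_def y(1) a0_def b0_def using y(2) by simp
    have u2: "u (i + x) * u (i + x) = q powr (- 2 * real j * (real i + real x)) * (q powr (- (real m ^ 2)) * (qpoch q q m)\<^sup>2 * A' ^ (2 * x) * q ^ (x * (x - 1))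
    * (\<Prod>r<x. 1 - B' * q ^ (m - 1) / q ^ r)\<^sup>2 / (qpoch q A' x)\<^sup>2)"
    proof -
      have "q powi (- int (j * (i + x))) = q powr (- (real j * (real i + real x)))"
        using q powr_real_of_int'[of q "- int (j * (i + x))"] by simp
      then have "q powi (- int (j * (i + x))) * q powi (- int (j * (i + x))) = q powr (- 2 * real j * (real i + real x))"
        by (simp add: mult.assoc flip: powr_add)
      moreover have "(qhahn q m x a0 b0 m)\<^sup>2 = q powr (- (real m ^ 2)) * (qpoch q q m)\<^sup>2 * A' ^ (2 * x) * q ^ (x * (x - 1))
          * (\<Prod>r<x. 1 - B' * q ^ (m - 1) / q ^ r)\<^sup>2 / (qpoch q A' x)\<^sup>2"
        unfolding ab0[symmetric] by (rule qhahn_full_square[OF x]) (rule a0S)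
      moreover have "v * h * (v * h) = e * z" if "v * v = e" "h\<^sup>2 = z" for v h e z :: real
        using that by (simp add: power2_eq_square mult_ac)
      ultimately show ?thesis unfolding u by blast
    qed
    have eA: "A ^ (n - (i + x)) = A' ^ (j + y) * q powr (- 2 * real i * (real j + real y))"
    proof -
      have "q powr (- 2 * real i * (real j + real y)) = 1 / q ^ (2 * i * (j + y))"
        using q by (simp add: powr_minus powr_realpow[symmetric] inverse_eq_divide)
      then show ?thesis unfolding y(1) A'_def using q
        by (simp add: power_mult_distrib power_mult)
    qed
    have eab: "q ^ ((i + x) * (n - (i + x))) = q powr ((real i + real x) * (real j + real y))"
      unfolding y(1) using q by (simp add: powr_realpow[symmetric])
    have rl: "rform t \<alpha> (i + x) (mqhahn q \<alpha> l) (mqhahn q \<alpha> l) = qpoch q A' x / qpoch q q x * q powr norm_exp (i + x) i * Gl"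
      unfolding t_def using L[of "i + x"] unfolding norm_formula_def
      by (simp add: i_def[symmetric] Gl_def A'_def A_def t_def power_add mult.assoc)
    have rr: "rform s \<beta> (n - (i + x)) (mqhahn q \<beta> r) (mqhahn q \<beta> r) = qpoch q B' y / qpoch q q y * q powr norm_exp (j + y) j * Gr"
      unfolding s_def \<beta>_def t_def y(1) using R[of "j + y"] unfolding norm_formula_def
      by (simp add: j_def[symmetric] Gr_def B'_def B_def s_def t_def \<beta>_def power_add mult.assoc)
    have ee: "q powr ((real i + real x) * (real j + real y)) * q powr (- 2 * real i * (real j + real y))
        * q powr (- 2 * real j * (real i + real x)) * q powr (- (real m ^ 2)) * q powr norm_exp (i + x) i
        * q powr norm_exp (j + y) j = q powr C"
      unfolding powr_add[symmetric] C_def norm_exp_def n_def y(2)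
      by (intro arg_cong[of _ _ "(powr) q"]) (simp add: field_simps power2_eq_square)
    have eA2: "A' ^ (j + y) * A' ^ (2 * x) = A' ^ (m + j) * A' ^ x"
      unfolding power_add[symmetric] using y(2) by (intro arg_cong[of _ _ "(^) A'"]) simp
    show "q ^ ((i + x) * (n - (i + x))) * A ^ (n - (i + x)) * u (i + x) * u (i + x)
        * rform t \<alpha> (i + x) (mqhahn q \<alpha> l) (mqhahn q \<alpha> l) * rform s \<beta> (n - (i + x)) (mqhahn q \<beta> r) (mqhahn q \<beta> r)
      = K * (qbinom q m x * (A' ^ x * q ^ (x * (x - 1)) * (\<Prod>r<x. 1 - B' * q ^ (m - 1) / q ^ r) / qpoch q A' x))"
      unfolding mult.assoc[of _ "u (i + x)"] u2 eA eab rl rr K_def qbinom_eq[OF x] y_def[symmetric]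
      using norm_term_aux[OF ee eA2 _ nzAx[OF x] qpoch_q_nz qpoch_q_nz]
        qpoch_reverse[OF x, of q B', folded y_def] q by simp
  qed
  also have "\<dots> = K * (\<Sum>x\<le>m. qbinom q m x * (A' ^ x * q ^ (x * (x - 1)) * (\<Prod>r<x. 1 - B' * q ^ (m - 1) / q ^ r) * qpoch q (A' * q ^ x) (m - x))) / qpoch q A' m"
    unfolding sum_distrib_left sum_divide_distrib
  proof (intro sum.cong refl)
    fix x assume "x \<in> {..m}"
    then have x: "x \<le> m" by simp
    have e: "qpoch q A' m = qpoch q A' x * qpoch q (A' * q ^ x) (m - x)"
      using qpoch_add[of q A' x "m - x"] x by simp
    with nzAx[of m] nzAx[OF x] show "K * (qbinom q m x * (A' ^ x * q ^ (x * (x - 1)) * (\<Prod>r<x. 1 - B' * q ^ (m - 1) / q ^ r) / qpoch q A' x))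
      = K * (qbinom q m x * (A' ^ x * q ^ (x * (x - 1)) * (\<Prod>r<x. 1 - B' * q ^ (m - 1) / q ^ r) * qpoch q (A' * q ^ x) (m - x))) / qpoch q A' m"
      by (simp add: field_simps)
  qed
  also have "\<dots> = K * qpoch q (A' * (B' * q ^ (m - 1))) m / qpoch q A' m"
    using q_vandermonde[of q m A' "B' * q ^ (m - 1)"] q by simp
  also have "\<dots> = q powr norm_exp n n * (\<Gamma>v q \<alpha> (0, Node l m r) * Gl * Gr)"
  proof -
    have "q powr C = q powr (norm_exp n n + real_of_int (- 2 * int i * int j - int m))"
      unfolding C_def by (simp add: algebra_simps)
    also have "\<dots> = q powr norm_exp n n * q powi (- 2 * int i * int j - int m)"
      unfolding powr_add using q powr_real_of_int'[of q "- 2 * int i * int j - int m"] by simp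
    finally have C: "q powr C = q powr norm_exp n n * q powi (- 2 * int i * int j - int m)" .
    \<comment> \<open>For m = 0 the exponent m - 1 is truncated, but both symbols are then empty
      products.\<close>
    have p: "qpoch q (A' * (B' * q ^ (m - 1))) m
      = qpoch q (pv q \<alpha> 0 (Node l m r) * q powi (int n + int i + int j - 1)) m"
    proof (cases m)
      case (Suc k)
      have "int n + int i + int j - 1 = int (2 * i + 2 * j + k)" using Suc by (simp add: n_def)
      then have "q powi (int n + int i + int j - 1) = q ^ (2 * i) * q ^ (2 * j) * q ^ k"
        by (simp only: power_int_of_nat power_add)
      moreover have "pv q \<alpha> 0 (Node l m r) = A * B"
        unfolding pv_eq A_def B_def \<beta>_def t_def s_def by (simp add: pprod_split power_add)
      ultimately show ?thesis using Suc by (simp add: A'_def B'_def mult_ac)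
    qed simp
    have lp: "pv q \<alpha> 0 l * q ^ (2 * i) = A'" "pv q \<alpha> (0 + size1 l) r * q ^ (2 * j) = B'"
      unfolding pv_eq A'_def B'_def A_def B_def t_def s_def \<beta>_def by simp_all
    have csn: "cs (Node l m r) = n" by (simp add: n_def i_def j_def)
    show ?thesis
      unfolding K_def C \<Gamma>v.simps Let_def csn i_def[symmetric] j_def[symmetric] lp p by simp
  qed
  also have "\<dots> = norm_formula \<alpha> (Node l m r) n"
    unfolding norm_formula_def \<Gamma>prod_Node Gl_def Gr_def \<beta>_def t_def by (simp add: n_def i_def j_def)
  finally show ?thesis unfolding n_def i_def j_def t_def s_def .
qed

text \<open>Base and step alternate: \<open>rform_mqhahn_base\<close> needs the norms of the sons at
  all sizes from their label sums on, and \<open>norm_formula_step\<close> extends each son from its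
  smallest size to these.\<close>

lemma rform_mqhahn:
  assumes "nonres q \<alpha> (size1 c) N" "cs c \<le> N" "cs c \<le> M"
  shows "rform (size1 c) \<alpha> M (mqhahn q \<alpha> c) (mqhahn q \<alpha> c) = norm_formula \<alpha> c M"
  using assms
proof (induction c arbitrary: \<alpha> M)
  case Leaf
  have g: "grid 1 0 = {\<lambda>_. 0}" by (auto simp: grid_def fun_eq_iff) (metis One_nat_def)
  have base: "rform (size1 Leaf) \<alpha> (cs Leaf) (mqhahn q \<alpha> Leaf) (mqhahn q \<alpha> Leaf) = norm_formula \<alpha> Leaf (cs Leaf)"
    using g q by (simp add: rform_def norm_formula_def norm_exp_def weight_def \<Gamma>prod_Leaf)
  show ?case by (rule norm_formula_step[OF Leaf base])
next
  case (Node l m r)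
  have nr: "nonres q \<alpha> (size1 l + size1 r) N" using Node.prems by simp
  have nrl: "nonres q \<alpha> (size1 l) N" using nonres_left[OF nr] .
  have nrr: "nonres q (shift (size1 l) \<alpha>) (size1 r) N" using nonres_right[OF nr] .
  have le: "cs l \<le> N" "cs r \<le> N" "m + cs l + cs r \<le> N" using Node.prems by auto
  have base: "rform (size1 (Node l m r)) \<alpha> (cs (Node l m r)) (mqhahn q \<alpha> (Node l m r)) (mqhahn q \<alpha> (Node l m r))
    = norm_formula \<alpha> (Node l m r) (cs (Node l m r))"
    using rform_mqhahn_base[OF nr le(3) Node.IH(1)[OF nrl le(1)] Node.IH(2)[OF nrr le(2)]] by simp
  show ?case by (rule norm_formula_step[OF Node.prems base])
qed

end


subsection \<open>Non-resonance of the parameters\<close>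

text \<open>In the first range every \<alpha>_i q lies in (0,1), so the products stay below 1. In
  the second every \<alpha>_i q^N exceeds 1; m such factors contain q^(m+m(N-1)), and a smaller e
  only enlarges the product. This is the source of the bound m(N-1) in
  \<open>nonres\<close>.\<close>

lemma nonresI:
  assumes q: "0 < q" "q < 1" and "N \<ge> 1"
    and \<alpha>: "(\<forall>i\<in>{1..h}. 0 < \<alpha> i \<and> \<alpha> i < q powi (-1)) \<or> (\<forall>i\<in>{1..h}. \<alpha> i > q powi (- int N))"
  shows "nonres q \<alpha> h N"
proof -
  have pos: "0 < \<alpha> i" if "i \<in> {1..h}" for i
    using \<alpha> that q by (meson order_less_trans zero_less_power_int)
  have "pprod (shift l \<alpha>) m * q ^ (m + e) \<noteq> 1" if "1 \<le> m" "l + m \<le> h" "e \<le> m * (N - 1)" for l m e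
    using \<alpha>
  proof
    assume a: "\<forall>i\<in>{1..h}. 0 < \<alpha> i \<and> \<alpha> i < q powi (-1)"
    have "0 < pprod (shift l \<alpha>) m * q ^ m \<and> pprod (shift l \<alpha>) m * q ^ m < 1"
      using that(1,2)
    proof (induction m rule: dec_induct)
      case base
      then have "0 < \<alpha> (l + 1)" "\<alpha> (l + 1) < q powi (-1)" using a by auto
      then show ?case using q by (simp add: pprod_def field_simps)
    next
      case (step m)
      then have "0 < \<alpha> (l + Suc m)" "\<alpha> (l + Suc m) < q powi (-1)" using a by auto
      then have "0 < \<alpha> (l + Suc m) * q" "\<alpha> (l + Suc m) * q < 1" using q by (simp_all add: field_simps)
      moreover have "0 < pprod (shift l \<alpha>) m * q ^ m" "pprod (shift l \<alpha>) m * q ^ m < 1"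
        using step by auto
      moreover have "0 < u * v \<and> u * v < 1" if "0 < u" "u < 1" "0 < v" "v < 1" for u v :: real
        using that mult_strict_mono'[of u 1 v 1] by simp
      moreover have "pprod (shift l \<alpha>) (Suc m) * q ^ Suc m = (pprod (shift l \<alpha>) m * q ^ m) * (\<alpha> (l + Suc m) * q)"
        by (simp add: pprod_def)
      ultimately show ?case by presburger
    qed
    moreover have "q ^ e \<le> 1" using q by (simp add: power_le_one)
    ultimately have "pprod (shift l \<alpha>) m * q ^ m * q ^ e < 1"
      using mult_left_le[of "q ^ e" "pprod (shift l \<alpha>) m * q ^ m"] by linarith
    then show ?thesis by (simp add: power_add mult.assoc)
  next
    assume a: "\<forall>i\<in>{1..h}. \<alpha> i > q powi (- int N)"
    have a1: "1 < \<alpha> i * q * q ^ (N - 1)" if "i \<in> {1..h}" for i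
    proof -
      have "q * q ^ (N - 1) = q ^ N" using \<open>N \<ge> 1\<close> by (cases N) auto
      moreover have "q powi (- int N) < \<alpha> i" using a that by blast
      then have "1 < \<alpha> i * q ^ N" using q by (simp add: power_int_minus field_simps)
      ultimately show ?thesis by (simp add: mult.assoc)
    qed
    have "1 < pprod (shift l \<alpha>) m * q ^ m * q ^ (m * (N - 1))"
      using that(1,2)
    proof (induction m rule: dec_induct)
      case base
      then show ?case using a1[of "l + 1"] by (simp add: pprod_def)
    next
      case (step m)
      have "pprod (shift l \<alpha>) (Suc m) * q ^ Suc m * q ^ (Suc m * (N - 1))
         = (pprod (shift l \<alpha>) m * q ^ m * q ^ (m * (N - 1))) * (\<alpha> (l + Suc m) * q * q ^ (N - 1))"
        by (simp add: pprod_def power_add mult_ac)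
      moreover have "1 < pprod (shift l \<alpha>) m * q ^ m * q ^ (m * (N - 1))" using step by simp
      moreover have "1 < \<alpha> (l + Suc m) * q * q ^ (N - 1)" using a1[of "l + Suc m"] step by simp
      ultimately show ?case by (metis less_1_mult)
    qed
    also have "\<dots> \<le> pprod (shift l \<alpha>) m * q ^ m * q ^ e"
    proof (rule mult_left_mono)
      show "q ^ (m * (N - 1)) \<le> q ^ e" using that(3) q by (intro power_decreasing) auto
      have "0 \<le> pprod (shift l \<alpha>) m" unfolding pprod_def
        using pos that(2) by (intro prod_nonneg) (auto intro!: less_imp_le)
      then show "0 \<le> pprod (shift l \<alpha>) m * q ^ m" using q by simp
    qed
    finally show ?thesis by (simp add: power_add mult.assoc)
  qed
  then show ?thesis unfolding nonres_def using pos by (metis atLeastAtMost_iff less_irrefl)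
qed

subsection \<open>Counting labelings\<close>

definition labelings :: "unit tree \<Rightarrow> nat \<Rightarrow> nat tree set" where
  "labelings T M = {c. map_tree (\<lambda>_. ()) c = T \<and> cs c \<le> M}"

lemma UN_CL: "(\<Union>n\<in>{0..M}. CL T n) = labelings T M"
  by (auto simp: CL_def labelings_def)

lemma card_grid_split: "card (grid (t + s) M) = (\<Sum>a\<le>M. card (grid t a) * card (grid s (M - a)))"
  using sum_grid_split[of "\<lambda>_. 1::nat" t s M] by simp

text \<open>Here a is the root label plus the sum of the left labels. Counting the root with the
  left subtree makes the labelings of sum at most M obey the recursion
  \<open>card_grid_split\<close> of the points of [h;M], with a in the role of X_t.\<close>

lemma bij_labelings_Node:
  "bij_betw (\<lambda>(a, c, d). Node c (a - cs c) d) (SIGMA a:{..M}. labelings l a \<times> labelings r (M - a))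
    (labelings (Node l u r) M)"
  by (rule bij_betw_byWitness[where f' = "\<lambda>c. case c of Node c k d \<Rightarrow> (k + cs c, c, d)"])
    (auto simp: labelings_def split: tree.splits)

lemma finite_card_labelings:
  "finite (labelings T M) \<and> card (labelings T M) = card (grid (size1 T) M)"
proof (induction T arbitrary: M)
  case Leaf
  have "labelings Leaf M = {Leaf}" by (auto simp: labelings_def)
  moreover have "grid 1 M = {\<lambda>i. if i = 1 then M else 0}" by (auto simp: grid_def fun_eq_iff)
  ultimately show ?case by simp
next
  case (Node l u r)
  have "finite (SIGMA a:{..M}. labelings l a \<times> labelings r (M - a))"
    using Node by (intro finite_SigmaI finite_cartesian_product) auto
  moreover have "card (SIGMA a:{..M}. labelings l a \<times> labelings r (M - a)) = card (grid (size1 l + size1 r) M)"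
    unfolding card_grid_split using Node by (simp add: card_cartesian_product)
  ultimately show ?case
    using bij_betw_finite[OF bij_labelings_Node, of M l r u] bij_betw_same_card[OF bij_labelings_Node, of M l r u]
    by simp
qed

subsection \<open>Linear combinations of functions\<close>

text \<open>Coefficients are attached to indices, not to functions, so linear relations make sense
  before the family is known to be injective.\<close>

definition comb :: "('i \<Rightarrow> complex) \<Rightarrow> ('i \<Rightarrow> 'a \<Rightarrow> complex) \<Rightarrow> 'i set \<Rightarrow> 'a \<Rightarrow> complex" where
  "comb u b I = (\<lambda>x. \<Sum>c\<in>I. u c * b c x)"

lemma sum_fun_apply: "(\<Sum>i\<in>I. f i) x = (\<Sum>i\<in>I. f i x)" for f :: "'i \<Rightarrow> 'a \<Rightarrow> complex"
  by (induction I rule: infinite_finite_induct) simp_all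

lemma span_eq_comb:
  assumes "finite I"
  shows "cfun.span (b ` I) = {f. \<exists>u. f = comb u b I}"
proof (intro subset_antisym subsetI)
  fix f assume "f \<in> cfun.span (b ` I)"
  then show "f \<in> {f. \<exists>u. f = comb u b I}"
  proof (induction rule: cfun.span_induct_alt)
    case base
    have "0 = comb (\<lambda>_. 0) b I" by (simp add: comb_def fun_eq_iff)
    then show ?case by blast
  next
    case (step k g f)
    then obtain i u where "i \<in> I" "g = b i" "f = comb u b I" by auto
    then have "(\<lambda>x. k * g x) + f = comb (\<lambda>c. (if c = i then k else 0) + u c) b I"
      using assms by (simp add: comb_def fun_eq_iff distrib_right sum.distrib if_distrib[of "\<lambda>z. z * _"] sum.delta' cong: if_cong)
    then show ?case by blast
  qed
next
  fix f assume "f \<in> {f. \<exists>u. f = comb u b I}"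
  then obtain u where "f = comb u b I" by auto
  then have "f = (\<Sum>c\<in>I. (\<lambda>x. u c * b c x))" by (simp add: comb_def fun_eq_iff sum_fun_apply)
  then show "f \<in> cfun.span (b ` I)"
    by (simp only:) (intro cfun.span_sum cfun.span_scale cfun.span_base imageI)
qed

lemma independent_comb:
  assumes "finite I" and *: "\<And>u i. comb u b I = (\<lambda>_. 0) \<Longrightarrow> i \<in> I \<Longrightarrow> u i = 0"
  shows "inj_on b I" "cfun.independent (b ` I)"
proof -
  show inj: "inj_on b I"
  proof (rule inj_onI, rule ccontr)
    fix i j assume ij: "i \<in> I" "j \<in> I" "b i = b j" "i \<noteq> j"
    \<comment> \<open>A repeated member gives a relation with coefficients 1 and -1, so injectivity
      too follows from the vanishing of coefficients.\<close>
    define u :: "_ \<Rightarrow> complex" where "u c = (if c = i then 1 else 0) + (if c = j then -1 else 0)" for c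
    have "comb u b I = (\<lambda>_. 0)"
    proof
      fix x
      have "comb u b I x = (\<Sum>c\<in>I. (if c = i then b c x else 0) + (if c = j then - b c x else 0))"
        unfolding comb_def u_def by (intro sum.cong refl) (simp add: distrib_right)
      also have "\<dots> = b i x - b j x"
        using ij assms(1) by (simp only: sum.distrib sum.delta if_True) simp
      finally show "comb u b I x = 0" using ij by simp
    qed
    from *[OF this ij(1)] ij(4) show False by (simp add: u_def)
  qed
  show "cfun.independent (b ` I)"
    unfolding cfun.dependent_finite[OF finite_imageI[OF assms(1)]]
  proof clarify
    fix u c assume s: "(\<Sum>v\<in>b ` I. (\<lambda>x. u v * v x)) = 0" and c: "u (b c) \<noteq> 0" "c \<in> I"
    have "(\<Sum>v\<in>b ` I. (\<lambda>x. u v * v x)) = comb (\<lambda>c. u (b c)) b I"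
      unfolding sum.reindex[OF inj] by (simp add: comb_def fun_eq_iff sum_fun_apply)
    with s have "comb (\<lambda>c. u (b c)) b I = (\<lambda>_. 0)" by (simp add: zero_fun_def)
    from *[OF this c(2)] c(1) show False by simp
  qed
qed

lemma comb_mono_neutral:
  assumes "finite J" "I \<subseteq> J" "\<And>c. c \<in> J - I \<Longrightarrow> u c = 0 \<or> b c = (\<lambda>_. 0)"
  shows "comb u b J = comb u b I"
proof
  fix x
  have "u c * b c x = 0" if "c \<in> J - I" for c using assms(3)[OF that] by auto
  then show "comb u b J x = comb u b I x" unfolding comb_def
    by (intro sum.mono_neutral_right) (use assms in auto)
qed

lemma comb_cong: "(\<And>c x. c \<in> I \<Longrightarrow> u c * b c x = u' c * b' c x) \<Longrightarrow> comb u b I = comb u' b' I"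
  unfolding comb_def by (simp add: fun_eq_iff)

lemma sum_comb: "(\<Sum>i\<in>J. k i * comb u b I (y i)) = (\<Sum>c\<in>I. u c * (\<Sum>i\<in>J. k i * b c (y i)))"
  unfolding comb_def sum_distrib_left by (subst sum.swap) (simp only: mult_ac)

lemma V_eq_span: "V h M = cfun.span ((\<lambda>y x. if x = y then 1 else 0) ` grid h M)"
  unfolding span_eq_comb[OF finite_grid]
proof (intro subset_antisym subsetI)
  fix f assume f: "f \<in> V h M"
  have "f = comb f (\<lambda>y x. if x = y then 1 else 0) (grid h M)"
  proof
    fix x
    show "f x = comb f (\<lambda>y x. if x = y then 1 else 0) (grid h M) x"
      using f unfolding comb_def V_def
      by (simp add: if_distrib[of "\<lambda>z. _ * z"] sum.delta' finite_grid cong: if_cong)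
  qed
  then show "f \<in> {f. \<exists>u. f = comb u (\<lambda>y x. if x = y then 1 else 0) (grid h M)}" by blast
qed (auto simp: V_def comb_def intro!: sum.neutral)

lemma V_form_comb: "V_form q h \<alpha> M (comb u b I) g = (\<Sum>c\<in>I. u c * V_form q h \<alpha> M (b c) g)"
proof -
  have "V_form q h \<alpha> M (comb u b I) g = of_real (q ^ (M * (M + 1) div 2)) * (\<Sum>x\<in>grid h M. (of_real
      (\<Prod>i=1..h. qpoch q (q * \<alpha> i) (x i) / qpoch q q (x i) * (\<alpha> i * q) ^ (M - psum x i)) * cnj (g x))
      * comb u b I x)"
    unfolding V_form_def by (simp only: mult_ac)
  also have "\<dots> = (\<Sum>c\<in>I. u c * V_form q h \<alpha> M (b c) g)"
    unfolding sum_comb unfolding V_form_def sum_distrib_left by (intro sum.cong refl) (simp only: mult_ac)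
  finally show ?thesis .
qed

subsection \<open>The operators\<close>

lemma R_op_comb: "R_op q h M (comb u b I) = comb u (\<lambda>c. R_op q h M (b c)) I"
proof
  fix x show "R_op q h M (comb u b I) x = comb u (\<lambda>c. R_op q h M (b c)) I x"
    unfolding R_op_def by (subst sum_comb) (simp add: comb_def)
qed

lemma L_op_comb: "L_op q h \<alpha> M (comb u b I) = comb u (\<lambda>c. L_op q h \<alpha> M (b c)) I"
proof
  fix x show "L_op q h \<alpha> M (comb u b I) x = comb u (\<lambda>c. L_op q h \<alpha> M (b c)) I x"
    unfolding L_op_def by (subst sum_comb) (simp add: comb_def)
qed

lemma R_chain_self: "R_chain q h n n f = f"
  by (simp add: R_chain_def)

lemma R_chain_Suc: "n \<le> N \<Longrightarrow> R_chain q h n (Suc N) f = R_op q h N (R_chain q h n N f)"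
  by (simp add: R_chain_def)

lemma R_chain_comb:
  "n \<le> N \<Longrightarrow> R_chain q h n N (comb u b I) = comb u (\<lambda>c. R_chain q h n N (b c)) I"
  by (induction N rule: dec_induct) (simp_all add: R_chain_self R_chain_Suc R_op_comb)

lemma R_op_scale: "R_op q h M (\<lambda>x. k * f x) = (\<lambda>x. k * R_op q h M f x)"
  unfolding R_op_def by (simp add: fun_eq_iff sum_distrib_left mult_ac)

context q_base
begin

text \<open>R after L removes a unit at i and adds one at j. For i \<noteq> j the exponent [i<j]
  records the unit missing from X_(j-1); for i = j the point returns to x and yields the sum inside
  the braces. What remains of D_M is the constant.\<close>

lemma D_op_eq:
  assumes "M \<ge> 1"
  shows "D_op q h \<alpha> M f x = (if x \<in> grid h M then R_op q h (M - 1) (L_op q h \<alpha> M f) x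
    + of_real ((pprod \<alpha> h * q powi (int h + int M - 1) - 1) * (1 - q powi (- int M))) * f x else 0)"
proof (cases "x \<in> grid h M")
  case True
  define k where "k i = (of_real (q powi (int (psum x (i - 1)) - int M) * (1 - q ^ x i)) :: complex)" for i
  define T where "T i j = of_real (pprod \<alpha> (j - 1)
        * q powi (int (j - 1) + int (psum x (j - 1)) + int (psum x (i - 1)) - int M
                  - (if i < j then 1 else 0))
        * (\<alpha> j * q ^ (x j + 1) - 1) * (1 - q ^ x i))
      * f (eps_minus i (eps_plus j x))" for i j
  define E where "E j = pprod \<alpha> (j - 1) * q powi (int (j - 1) + 2 * int (psum x (j - 1)) - int M)
                  * (\<alpha> j * q ^ x j - 1) * (1 - q ^ x j)" for j
  have M: "M - 1 + 1 = M" "int (M - 1) = int M - 1" using assms by simp_all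
  have "k i * L_op q h \<alpha> M f (eps_minus i x) = (\<Sum>j\<in>{1..h} - {i}. T i j) + of_real (E i) * f x"
    if i: "i \<in> {1..h}" for i
  proof (cases "x i = 0")
    case True
    then show ?thesis by (simp add: k_def T_def E_def)
  next
    case xi: False
    define y where "y = eps_minus i x"
    have y: "y \<in> grid h (M - 1)" unfolding y_def
      using eps_minus_grid[of x h "M - 1" i] True M(1) i xi by simp
    have ps: "psum y (j - 1) = psum x (j - 1) - (if i < j then 1 else 0)" if "j \<in> {1..h}" for j
      unfolding y_def using psum_eps_minus[of i x "j - 1"] i xi that by auto
    have 1: "k i * (of_real (pprod \<alpha> (j - 1) * q ^ (j - 1 + psum y (j - 1)) * (\<alpha> j * q ^ (y j + 1) - 1)) * f (eps_plus j y)) = T i j"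
      if j: "j \<in> {1..h} - {i}" for j
    proof -
      have e: "eps_plus j y = eps_minus i (eps_plus j x)" "y j = x j"
        using j by (auto simp: y_def eps_plus_def eps_minus_def fun_eq_iff)
      \<comment> \<open>Makes the truncated subtraction in \<open>ps\<close> exact: for i < j the
        positive entry x_i is part of X_(j-1).\<close>
      have le: "(if i < j then 1 else 0) \<le> psum x (j - 1)"
      proof (cases "i < j")
        case True
        then have "x i \<le> psum x (j - 1)" unfolding psum_def using i by (intro member_le_sum) auto
        then show ?thesis using xi by simp
      qed simp
      have "int (psum x (i - 1)) - int M + int (j - 1 + psum y (j - 1))
        = int (j - 1) + int (psum x (j - 1)) + int (psum x (i - 1)) - int M - (if i < j then 1 else 0)"
        using ps[of j] j le by (auto simp: of_nat_diff)
      then have "q powi (int (psum x (i - 1)) - int M) * q ^ (j - 1 + psum y (j - 1))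
        = q powi (int (j - 1) + int (psum x (j - 1)) + int (psum x (i - 1)) - int M - (if i < j then 1 else 0))"
        using q by (metis power_int_add power_int_of_nat less_irrefl)
      then show ?thesis unfolding k_def T_def e by (simp only: of_real_mult[symmetric] mult.assoc[symmetric]) (simp only: mult_ac)
    qed
    have 2: "k i * (of_real (pprod \<alpha> (i - 1) * q ^ (i - 1 + psum y (i - 1)) * (\<alpha> i * q ^ (y i + 1) - 1)) * f (eps_plus i y)) = of_real (E i) * f x"
    proof -
      have e: "eps_plus i y = x" "y i + 1 = x i"
        using xi by (auto simp: y_def eps_plus_def eps_minus_def fun_eq_iff)
      have p: "psum y (i - 1) = psum x (i - 1)" using ps[OF i] by simp
      have "int (psum x (i - 1)) - int M + int (i - 1 + psum y (i - 1))
        = int (i - 1) + 2 * int (psum x (i - 1)) - int M"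
        unfolding p by simp
      then have "q powi (int (psum x (i - 1)) - int M) * q ^ (i - 1 + psum y (i - 1))
        = q powi (int (i - 1) + 2 * int (psum x (i - 1)) - int M)"
        using q by (metis power_int_add power_int_of_nat less_irrefl)
      then show ?thesis unfolding k_def E_def e by (simp only: of_real_mult[symmetric] mult.assoc[symmetric]) (simp only: mult_ac)
    qed
    have "k i * L_op q h \<alpha> M f y = (\<Sum>j=1..h. k i * (of_real (pprod \<alpha> (j - 1) * q ^ (j - 1 + psum y (j - 1)) * (\<alpha> j * q ^ (y j + 1) - 1)) * f (eps_plus j y)))"
      unfolding sum_distrib_left[symmetric] unfolding L_op_def using y assms by simp
    also have "\<dots> = of_real (E i) * f x + (\<Sum>j\<in>{1..h} - {i}. T i j)"
      using i 1 2 by (subst sum.remove[of _ i]) (simp_all only: finite_atLeastAtMost cong: sum.cong)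
    finally show ?thesis by (simp add: y_def)
  qed
  then have S: "(\<Sum>i=1..h. k i * L_op q h \<alpha> M f (eps_minus i x))
    = (\<Sum>i=1..h. (\<Sum>j\<in>{1..h} - {i}. T i j)) + of_real (\<Sum>i=1..h. E i) * f x"
    by (simp add: sum.distrib sum_distrib_right)
  have "int (psum x (i - 1)) - int (M - 1) - 1 = int (psum x (i - 1)) - int M" for i
    using assms by simp
  then have R: "R_op q h (M - 1) g x = (\<Sum>i=1..h. k i * g (eps_minus i x))" for g
    unfolding R_op_def M(1) k_def using True by simp
  show ?thesis
    unfolding D_op_def R S T_def[symmetric] E_def[symmetric] using True
    by (simp only: if_True of_real_add distrib_right add.assoc)
qed (simp add: D_op_def)

lemma Qc_in_V: "Qc q h \<alpha> M c \<in> V h M"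
  by (simp add: Qc_def V_def)

lemma V_form_Qc:
  "V_form q h \<alpha> M (Qc q h \<alpha> M c) (Qc q h \<alpha> M d) = of_real (rform h \<alpha> M (mqhahn q \<alpha> c) (mqhahn q \<alpha> d))"
  unfolding V_form_def rform_def weight_def Qc_def by simp

lemma Qc_eq_0:
  assumes "size1 c = h" "M < cs c"
  shows "Qc q h \<alpha> M c = (\<lambda>_. 0)"
  using assms mqhahn_eq_0[of _ c q \<alpha>] grid_psum[of _ h M] by (auto simp: Qc_def fun_eq_iff)

lemma R_op_Qc:
  assumes "size1 c = h" "nonres q \<alpha> h N"
  shows "R_op q h M (Qc q h \<alpha> M c)
    = (\<lambda>x. of_real (q ^ cs c * (1 - q ^ (M + 1 - cs c)) / q ^ (M + 1)) * Qc q h \<alpha> (M + 1) c x)"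
proof
  fix x
  show "R_op q h M (Qc q h \<alpha> M c) x
    = of_real (q ^ cs c * (1 - q ^ (M + 1 - cs c)) / q ^ (M + 1)) * Qc q h \<alpha> (M + 1) c x"
  proof (cases "x \<in> grid h (M + 1)")
    case True
    have nz: "\<And>k. 1 \<le> k \<Longrightarrow> k \<le> size1 c \<Longrightarrow> \<alpha> k \<noteq> 0" using assms unfolding nonres_def by simp
    have "(\<Sum>i=1..h. of_real (q powi (int (psum x (i - 1)) - int M - 1) * (1 - q ^ x i)) * Qc q h \<alpha> M c (eps_minus i x))
      = (\<Sum>i=1..h. of_real (q ^ psum x (i - 1) * (1 - q ^ x i) * mqhahn q \<alpha> c (eps_minus i x) / q ^ (M + 1)))"
    proof (intro sum.cong refl)
      fix i assume i: "i \<in> {1..h}"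
      have p: "q powi (int (psum x (i - 1)) - int M - 1) = q ^ psum x (i - 1) / q ^ (M + 1)"
        using q by (simp add: power_int_diff)
      show "of_real (q powi (int (psum x (i - 1)) - int M - 1) * (1 - q ^ x i)) * Qc q h \<alpha> M c (eps_minus i x)
        = of_real (q ^ psum x (i - 1) * (1 - q ^ x i) * mqhahn q \<alpha> c (eps_minus i x) / q ^ (M + 1))"
        unfolding p using eps_minus_grid[OF True i] by (cases "x i = 0") (simp_all add: Qc_def)
    qed
    also have "\<dots> = of_real ((\<Sum>i=1..h. q ^ psum x (i - 1) * (1 - q ^ x i) * mqhahn q \<alpha> c (eps_minus i x)) / q ^ (M + 1))"
      by (simp only: of_real_sum sum_divide_distrib)
    also have "\<dots> = of_real (q ^ cs c * (1 - q ^ (M + 1 - cs c)) / q ^ (M + 1)) * Qc q h \<alpha> (M + 1) c x"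
      using mqhahn_raise[of c \<alpha> x, OF nz] assms(1) grid_psum[OF True] True by (simp add: Qc_def)
    finally show ?thesis using True by (simp add: R_op_def)
  qed (simp add: R_op_def Qc_def)
qed

lemma L_op_Qc:
  assumes "size1 c = h" "nonres q \<alpha> h N" "cs c \<le> N"
  shows "L_op q h \<alpha> (Suc M) (Qc q h \<alpha> (Suc M) c)
    = (\<lambda>x. of_real (- (1 - pprod \<alpha> h * q ^ (h + M + cs c)) / q ^ cs c) * Qc q h \<alpha> M c x)"
proof
  fix x
  show "L_op q h \<alpha> (Suc M) (Qc q h \<alpha> (Suc M) c) x
    = of_real (- (1 - pprod \<alpha> h * q ^ (h + M + cs c)) / q ^ cs c) * Qc q h \<alpha> M c x"
  proof (cases "x \<in> grid h M")
    case True
    define S where "S = (\<Sum>j=1..h. pprod \<alpha> (j - 1) * q ^ (j - 1 + psum x (j - 1)) * (\<alpha> j * q ^ (x j + 1) - 1)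
      * mqhahn q \<alpha> c (eps_plus j x))"
    have "L_op q h \<alpha> (Suc M) (Qc q h \<alpha> (Suc M) c) x = of_real S"
      unfolding L_op_def S_def of_real_sum using True eps_plus_grid[OF True]
      by (simp add: Qc_def)
    moreover have "q ^ cs c * S = - (1 - pprod \<alpha> h * q ^ (h + M + cs c)) * mqhahn q \<alpha> c x"
      unfolding S_def using mqhahn_lower[of \<alpha> c N x] assms grid_psum[OF True] by simp
    then have "S = - (1 - pprod \<alpha> h * q ^ (h + M + cs c)) / q ^ cs c * mqhahn q \<alpha> c x"
      using q by (simp add: field_simps)
    ultimately show ?thesis using True by (simp only: Qc_def if_True of_real_mult)
  qed (simp add: L_op_def Qc_def)
qed

text \<open>In the factor q^n (1 - q^(M+1-n)) / q^(M+1) of \<open>R_op_Qc\<close>, with n = cs c,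
  only k = M - n survives: it is (1 - q^(k+1)) / q^(k+1), and the product over k is the
  constant.\<close>

lemma R_chain_Qc:
  assumes "size1 c = h" "nonres q \<alpha> h N'" "cs c \<le> N"
  shows "R_chain q h (cs c) N (Qc q h \<alpha> (cs c) c)
    = (\<lambda>x. of_real (qpoch q q (N - cs c) / q ^ ((N - cs c) * (N - cs c + 1) div 2)) * Qc q h \<alpha> N c x)"
  using assms(3)
proof (induction N rule: dec_induct)
  case base
  then show ?case by (simp add: R_chain_self)
next
  case (step M)
  define k where "k = M - cs c"
  have k: "M + 1 - cs c = Suc k" "Suc M - cs c = Suc k" and k3: "M + 1 = cs c + Suc k"
    using step by (auto simp: k_def)
  have d: "Suc k * (Suc k + 1) div 2 = Suc k + k * (k + 1) div 2" by simp
  have eq: "qpoch q q (Suc k) / q ^ (Suc k * (Suc k + 1) div 2)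
    = qpoch q q k / q ^ (k * (k + 1) div 2) * (q ^ cs c * (1 - q ^ Suc k) / q ^ (M + 1))"
    unfolding d unfolding k3 power_add qpoch_Suc using q by (simp add: field_simps)
  show ?case
    unfolding R_chain_Suc[OF step(1)] step.IH R_op_scale R_op_Qc[OF assms(1,2)] k k_def[symmetric] eq of_real_mult
    by (simp only: mult.assoc Suc_eq_plus1)
qed

lemma \<Gamma>prod_nz:
  assumes "nonres q \<alpha> (size1 c) N" "cs c \<le> N"
  shows "\<Gamma>prod q \<alpha> c \<noteq> 0"
  using assms
proof (induction c arbitrary: \<alpha>)
  case (Node l m r)
  have nr: "nonres q \<alpha> (size1 l + size1 r) N" using Node.prems by simp
  have nrl: "nonres q \<alpha> (size1 l) N" using nonres_left[OF nr] .
  have nrr: "nonres q (shift (size1 l) \<alpha>) (size1 r) N" using nonres_right[OF nr] .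
  have 1: "qpoch q (pv q \<alpha> 0 l * q ^ (2 * cs l)) m \<noteq> 0"
  proof -
    have "cs l + m \<le> N" using Node.prems by simp
    from nonres_cs[OF nrl this] show ?thesis
      by (auto simp: qpoch_eq_0_iff pv_eq power_add mult.assoc)
  qed
  have 2: "qpoch q (pv q \<alpha> (0 + size1 l) r * q ^ (2 * cs r)) m \<noteq> 0"
  proof -
    have "cs r + m \<le> N" using Node.prems by simp
    from nonres_cs[OF nrr this] show ?thesis
      by (auto simp: qpoch_eq_0_iff pv_eq power_add mult.assoc)
  qed
  have 3: "qpoch q (pv q \<alpha> 0 (Node l m r) * q powi (int (cs (Node l m r)) + int (cs l) + int (cs r) - 1)) m \<noteq> 0"
    unfolding qpoch_eq_0_iff
  proof clarify
    fix k assume k: "k < m" and eq: "pv q \<alpha> 0 (Node l m r) * q powi (int (cs (Node l m r)) + int (cs l) + int (cs r) - 1) * q ^ k = 1"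
    \<comment> \<open>Since k \<le> m - 1, this is at most 2(m + cs l + cs r - 1) \<le> 2(N - 1),
      within the bound of \<open>nonres\<close> for the at least two leaves below an internal
      vertex.\<close>
    define e where "e = 2 * cs l + 2 * cs r + (m - 1) + k"
    have "2 * (N - 1) \<le> (size1 l + size1 r) * (N - 1)"
      using size1_ge_1[of l] size1_ge_1[of r] by (intro mult_right_mono) auto
    moreover have "e \<le> 2 * (N - 1)" using k Node.prems(2) by (simp add: e_def)
    ultimately have "e \<le> (size1 l + size1 r) * (N - 1)" by linarith
    moreover have "1 \<le> size1 l + size1 r" using size1_ge_1[of l] by linarith
    ultimately have "pprod \<alpha> (size1 l + size1 r) * q ^ (size1 l + size1 r + e) \<noteq> 1"
      using nonres_ne_1[OF nr] by blast
    moreover have "int (cs (Node l m r)) + int (cs l) + int (cs r) - 1 + int k = int e"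
      using k by (simp add: e_def of_nat_diff)
    then have "q powi (int (cs (Node l m r)) + int (cs l) + int (cs r) - 1) * q ^ k = q ^ e"
      using q by (metis power_int_add power_int_of_nat less_irrefl)
    ultimately show False using eq by (simp add: pv_eq power_add mult.assoc)
  qed
  have 4: "pv q \<alpha> 0 l \<noteq> 0" using nonres_pprod_nz[OF nrl order_refl] q by (simp add: pv_eq)
  have "\<Gamma>v q \<alpha> (0, Node l m r) \<noteq> 0"
    using 1 2 3 4 qpoch_q_nz[of m] q unfolding \<Gamma>v.simps Let_def by simp
  then show ?case unfolding \<Gamma>prod_Node
    using Node.IH(1)[OF nrl] Node.IH(2)[OF nrr] Node.prems(2) by simp
qed (simp add: \<Gamma>prod_Leaf)

lemma norm_formula_nz:
  assumes "nonres q \<alpha> (size1 c) N" "cs c \<le> M" "M \<le> N"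
  shows "norm_formula \<alpha> c M \<noteq> 0"
proof -
  have "cs c + (M - cs c) \<le> N" using assms by simp
  from nonres_cs[OF assms(1) this]
  have "qpoch q (pprod \<alpha> (size1 c) * q ^ (size1 c + 2 * cs c)) (M - cs c) \<noteq> 0"
    by (auto simp: qpoch_eq_0_iff power_add mult.assoc)
  then show ?thesis unfolding norm_formula_def
    using \<Gamma>prod_nz[OF assms(1)] assms qpoch_q_nz q by simp
qed

end

subsection \<open>Bases, kernels and eigenspaces\<close>

locale q_hahn = q_base +
  fixes h N :: nat and \<alpha> :: "nat \<Rightarrow> real" and T :: "unit tree"
  assumes nr: "nonres q \<alpha> h N" and h2: "2 \<le> h" and N1: "1 \<le> N" and T: "size1 T = h"
begin

lemma labelings_size: "c \<in> labelings T M \<Longrightarrow> size1 c = h"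
  using size1_map_tree T by (metis (mono_tags, lifting) labelings_def mem_Collect_eq)

lemma CL_labelings: "n \<le> M \<Longrightarrow> CL T n \<subseteq> labelings T M"
  by (auto simp: CL_def labelings_def)

text \<open>Such factors occur in the coefficients of L on Q_c and in differences of eigenvalues of
  D_N.\<close>

lemma nz_double:
  assumes "e \<le> 2 * (N - 1)"
  shows "pprod \<alpha> h * q ^ (h + e) \<noteq> 1"
proof (rule nonres_ne_1[OF nr])
  have "2 * (N - 1) \<le> h * (N - 1)" using h2 by simp
  with assms show "e \<le> h * (N - 1)" by linarith
qed (use h2 in simp)

lemma orthogonal:
  assumes "M \<le> N" "c \<in> labelings T M" "d \<in> labelings T M" "c \<noteq> d"
  shows "V_form q h \<alpha> M (Qc q h \<alpha> M c) (Qc q h \<alpha> M d) = 0"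
  using rform_mqhahn_eq_0[of c d \<alpha> N M] assms labelings_size nr
  by (auto simp: V_form_Qc labelings_def)

lemma norm_nz:
  assumes "M \<le> N" "c \<in> labelings T M"
  shows "V_form q h \<alpha> M (Qc q h \<alpha> M c) (Qc q h \<alpha> M c) \<noteq> 0"
proof -
  have c: "size1 c = h" "cs c \<le> M" using assms labelings_size by (auto simp: labelings_def)
  have "rform h \<alpha> M (mqhahn q \<alpha> c) (mqhahn q \<alpha> c) = norm_formula \<alpha> c M"
    using rform_mqhahn[of \<alpha> c N M] c assms nr by simp
  then show ?thesis using norm_formula_nz[of \<alpha> c N M] c assms nr by (simp add: V_form_Qc)
qed

text \<open>Pairing the relation with Q_d isolates \<open>u d\<close> times the norm of Q_d; that
  this norm is nonzero replaces definiteness.\<close>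

lemma comb_Qc_eq_0:
  assumes "M \<le> N" "I \<subseteq> labelings T M" "comb u (Qc q h \<alpha> M) I = (\<lambda>_. 0)" "d \<in> I"
  shows "u d = 0"
proof -
  have fin: "finite I" using assms(2) finite_card_labelings finite_subset by metis
  have "0 = V_form q h \<alpha> M (comb u (Qc q h \<alpha> M) I) (Qc q h \<alpha> M d)"
    unfolding assms(3) by (simp add: V_form_def)
  also have "\<dots> = (\<Sum>c\<in>I. u c * V_form q h \<alpha> M (Qc q h \<alpha> M c) (Qc q h \<alpha> M d))"
    by (rule V_form_comb)
  also have "\<dots> = (\<Sum>c\<in>I. if c = d then u d * V_form q h \<alpha> M (Qc q h \<alpha> M d) (Qc q h \<alpha> M d) else 0)"
    using assms orthogonal by (intro sum.cong refl) (auto simp: subset_iff)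
  also have "\<dots> = u d * V_form q h \<alpha> M (Qc q h \<alpha> M d) (Qc q h \<alpha> M d)"
    using fin assms(4) by simp
  finally show ?thesis using norm_nz assms by auto
qed

lemma orthogonal_basis_Qc:
  assumes "M \<le> N" "I \<subseteq> labelings T M"
  shows "orthogonal_basis (V_form q h \<alpha> M) {f. \<exists>u. f = comb u (Qc q h \<alpha> M) I} (Qc q h \<alpha> M) I"
proof -
  have fin: "finite I" using assms(2) finite_card_labelings finite_subset by metis
  show ?thesis unfolding orthogonal_basis_def span_eq_comb[OF fin]
    using independent_comb[OF fin, of "Qc q h \<alpha> M"] comb_Qc_eq_0[OF assms] orthogonal[OF assms(1)] assms(2)
    by blast
qed

text \<open>The Q_c are independent and as numerous as the delta functions spanning V. A function
  outside their span would give one independent vector too many.\<close>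

lemma V_eq_comb:
  assumes "M \<le> N"
  shows "V h M = {f. \<exists>u. f = comb u (Qc q h \<alpha> M) (labelings T M)}"
proof -
  let ?I = "labelings T M" and ?S = "(\<lambda>y x. if x = y then 1 else 0 :: complex) ` grid h M"
  have fin: "finite ?I" and card: "card ?I = card (grid h M)"
    using finite_card_labelings[of T M] T by auto
  note b = orthogonal_basis_Qc[OF assms order_refl, unfolded orthogonal_basis_def]
  have B: "card (Qc q h \<alpha> M ` ?I) = card (grid h M)" using b card card_image by fastforce
  have sub: "Qc q h \<alpha> M ` ?I \<subseteq> cfun.span ?S" using Qc_in_V unfolding V_eq_span by blast
  have "V h M = cfun.span (Qc q h \<alpha> M ` ?I)"
  proof
    show "cfun.span (Qc q h \<alpha> M ` ?I) \<subseteq> V h M"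
      unfolding V_eq_span using sub by (intro cfun.span_minimal cfun.subspace_span)
    show "V h M \<subseteq> cfun.span (Qc q h \<alpha> M ` ?I)"
    proof (rule subsetI, rule ccontr)
      fix v assume v: "v \<in> V h M" "v \<notin> cfun.span (Qc q h \<alpha> M ` ?I)"
      then have "cfun.independent (insert v (Qc q h \<alpha> M ` ?I))"
        using b by (intro cfun.independent_insertI) auto
      moreover have "insert v (Qc q h \<alpha> M ` ?I) \<subseteq> cfun.span ?S" using v(1) sub unfolding V_eq_span by blast
      ultimately have "card (insert v (Qc q h \<alpha> M ` ?I)) \<le> card ?S"
        using cfun.independent_span_bound[of ?S] finite_grid by blast
      moreover have "v \<notin> Qc q h \<alpha> M ` ?I" using v(2) cfun.span_base by blast
      then have "card (insert v (Qc q h \<alpha> M ` ?I)) = Suc (card (grid h M))"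
        using fin B by simp
      moreover have "card ?S \<le> card (grid h M)" by (rule card_image_le[OF finite_grid])
      ultimately show False by simp
    qed
  qed
  then show ?thesis unfolding span_eq_comb[OF fin] .
qed

text \<open>L_n sends Q_c at size n to a nonzero multiple of Q_c at size n - 1 if cs c < n, and to 0
  if cs c = n. The images in the first case are independent, so a kernel element has no such
  components. For n = 0 there are none.\<close>

lemma Ker_L_eq:
  assumes "n \<le> N"
  shows "Ker_L q h \<alpha> n = {f. \<exists>u. f = comb u (Qc q h \<alpha> n) (CL T n)}"
proof (intro subset_antisym subsetI)
  fix f assume "f \<in> Ker_L q h \<alpha> n"
  then have f: "f \<in> V h n" "L_op q h \<alpha> n f = (\<lambda>_. 0)" by (auto simp: Ker_L_def zero_fun_def)
  then obtain u where u: "f = comb u (Qc q h \<alpha> n) (labelings T n)" using V_eq_comb[OF assms] by auto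
  have "u c = 0" if c: "c \<in> labelings T n - CL T n" for c
  proof -
    have cs: "cs c < n" "c \<in> labelings T (n - 1)" using c by (auto simp: labelings_def CL_def)
    then obtain M where M: "n = Suc M" by (cases n) auto
    define k where "k c = (of_real (- (1 - pprod \<alpha> h * q ^ (h + M + cs c)) / q ^ cs c) :: complex)" for c
    have "comb (\<lambda>c. u c * k c) (Qc q h \<alpha> M) (labelings T M) = comb (\<lambda>c. u c * k c) (Qc q h \<alpha> M) (labelings T n)"
      by (rule comb_mono_neutral[symmetric])
        (use finite_card_labelings Qc_eq_0 labelings_size in \<open>auto simp: labelings_def M\<close>)
    also have "\<dots> = comb u (\<lambda>c. L_op q h \<alpha> n (Qc q h \<alpha> n c)) (labelings T n)"
    proof (rule comb_cong)
      fix c x assume c: "c \<in> labelings T n"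
      then have "size1 c = h" "cs c \<le> N" using labelings_size assms by (auto simp: labelings_def)
      from L_op_Qc[OF this(1) nr this(2), of M]
      show "u c * k c * Qc q h \<alpha> M c x = u c * L_op q h \<alpha> n (Qc q h \<alpha> n c) x"
        by (simp add: M k_def)
    qed
    also have "\<dots> = (\<lambda>_. 0)" using f(2) unfolding u L_op_comb .
    finally have "u c * k c = 0"
      using comb_Qc_eq_0[of M "labelings T M" "\<lambda>c. u c * k c" c] cs(2) assms M by simp
    moreover have "pprod \<alpha> h * q ^ (h + (M + cs c)) \<noteq> 1" using cs(1) assms M by (intro nz_double) simp
    then have "- (1 - pprod \<alpha> h * q ^ (h + M + cs c)) / q ^ cs c \<noteq> 0" using q by (simp add: add.assoc)
    then have "k c \<noteq> 0" unfolding k_def by (simp only: of_real_eq_0_iff not_False_eq_True)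
    ultimately show ?thesis by simp
  qed
  then have "f = comb u (Qc q h \<alpha> n) (CL T n)"
    unfolding u by (intro comb_mono_neutral) (use finite_card_labelings CL_labelings in auto)
  then show "f \<in> {f. \<exists>u. f = comb u (Qc q h \<alpha> n) (CL T n)}" by blast
next
  fix f assume "f \<in> {f. \<exists>u. f = comb u (Qc q h \<alpha> n) (CL T n)}"
  then obtain u where u: "f = comb u (Qc q h \<alpha> n) (CL T n)" by auto
  have "f \<in> V h n" unfolding u V_def comb_def by (auto simp: Qc_def)
  moreover have "L_op q h \<alpha> n (Qc q h \<alpha> n c) = (\<lambda>_. 0)" if c: "c \<in> CL T n" for c
  proof (cases n)
    case 0
    then show ?thesis by (simp add: L_op_def)
  next
    case (Suc M)
    have "size1 c = h" "cs c = n" using c labelings_size[of c n] by (auto simp: CL_def labelings_def)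
    then show ?thesis using L_op_Qc[of c h \<alpha> N M] Qc_eq_0[of c h M \<alpha>] nr assms Suc by simp
  qed
  then have "L_op q h \<alpha> n f = (\<lambda>_. 0)"
    unfolding u L_op_comb by (simp add: comb_def)
  ultimately show "f \<in> Ker_L q h \<alpha> n" by (simp add: Ker_L_def zero_fun_def)
qed

text \<open>All Q_c with label sum n are scaled by the same nonzero constant k.\<close>

lemma R_chain_Ker_L:
  assumes "n \<le> N"
  shows "R_chain q h n N ` Ker_L q h \<alpha> n = {f. \<exists>u. f = comb u (Qc q h \<alpha> N) (CL T n)}"
proof -
  define k where "k = (of_real (qpoch q q (N - n) / q ^ ((N - n) * (N - n + 1) div 2)) :: complex)"
  have k: "k \<noteq> 0" unfolding k_def using qpoch_q_nz q by simp
  have *: "R_chain q h n N (comb u (Qc q h \<alpha> n) (CL T n)) = comb (\<lambda>c. u c * k) (Qc q h \<alpha> N) (CL T n)" for u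
    unfolding R_chain_comb[OF assms]
  proof (rule comb_cong)
    fix c x assume c: "c \<in> CL T n"
    then have "size1 c = h" "cs c = n" using labelings_size[of c n] by (auto simp: CL_def labelings_def)
    then show "u c * R_chain q h n N (Qc q h \<alpha> n c) x = u c * k * Qc q h \<alpha> N c x"
      using R_chain_Qc[of c h \<alpha> N N] nr assms by (simp add: k_def)
  qed
  show ?thesis
  proof (intro subset_antisym subsetI)
    fix f assume "f \<in> R_chain q h n N ` Ker_L q h \<alpha> n"
    then show "f \<in> {f. \<exists>u. f = comb u (Qc q h \<alpha> N) (CL T n)}"
      unfolding Ker_L_eq[OF assms] using * by auto
  next
    fix f assume "f \<in> {f. \<exists>u. f = comb u (Qc q h \<alpha> N) (CL T n)}"
    then obtain u where "f = comb u (Qc q h \<alpha> N) (CL T n)" by auto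
    then have "f = R_chain q h n N (comb (\<lambda>c. u c / k) (Qc q h \<alpha> n) (CL T n))"
      unfolding * using k by simp
    then show "f \<in> R_chain q h n N ` Ker_L q h \<alpha> n" unfolding Ker_L_eq[OF assms] by blast
  qed
qed

definition eigenvalue :: "nat \<Rightarrow> real" where
  "eigenvalue n = q powi (- int n) * (1 - q ^ n) * (1 - pprod \<alpha> h * q powi (int h + int n - 1))"

lemma powi_h: "q powi (int h + int n - 1) = q ^ (h - 1) * q ^ n"
proof -
  have "int h + int n - 1 = int (h - 1 + n)" using h2 by simp
  then show ?thesis by (simp only: power_int_of_nat power_add)
qed

text \<open>Up to powers of q the difference of two eigenvalues is (q^m - q^n)(A_h q^(h-1+m+n) - 1).
  For m \<noteq> n the last exponent is h + e with e = m + n - 1 \<le> 2(N - 1), so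
  \<open>nz_double\<close> applies.\<close>

lemma eigenvalue_inj:
  assumes "m \<le> N" "n \<le> N" "eigenvalue m = eigenvalue n"
  shows "m = n"
proof (rule ccontr)
  assume "m \<noteq> n"
  define W where "W = pprod \<alpha> h * q ^ (h - 1)"
  define e where "e = m + n - 1"
  have e: "e \<le> 2 * (N - 1)" "h - 1 + m + n = h + e" using assms h2 \<open>m \<noteq> n\<close> by (auto simp: e_def)
  have "q ^ (h - 1) * q ^ m * q ^ n = q ^ (h + e)"
    unfolding power_add[symmetric] e(2) ..
  then have 1: "W * q ^ m * q ^ n \<noteq> 1"
    unfolding W_def using nz_double[OF e(1)] by (metis mult.assoc)
  have 2: "q ^ m - q ^ n \<noteq> 0" using \<open>m \<noteq> n\<close> by (simp add: power_eq_iff_q)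
  have ev: "eigenvalue k = 1 / q ^ k * (1 - q ^ k) * (1 - W * q ^ k)" for k
    unfolding eigenvalue_def powi_h W_def by (simp add: power_int_minus inverse_eq_divide mult.assoc)
  have "(q ^ m - q ^ n) * (W * q ^ m * q ^ n - 1) = 0"
    using assms(3) q unfolding ev by (simp add: field_simps)
  with 1 2 show False by simp
qed

lemma D_op_Qc:
  assumes "c \<in> labelings T N"
  shows "D_op q h \<alpha> N (Qc q h \<alpha> N c) = (\<lambda>x. of_real (eigenvalue (cs c)) * Qc q h \<alpha> N c x)"
proof
  fix x
  obtain M where M: "N = Suc M" using N1 by (cases N) auto
  have c: "size1 c = h" "cs c \<le> N" using assms labelings_size by (auto simp: labelings_def)
  define W where "W = pprod \<alpha> h * q ^ (h - 1)"
  define n where "n = cs c"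
  have hM: "pprod \<alpha> h * q ^ (h + M + n) = W * q ^ N * q ^ n"
    unfolding W_def M using h2 by (cases h) (simp_all add: power_add mult_ac)
  have Nn: "q ^ n * (1 - q ^ (N - n)) = q ^ n - q ^ N"
    using c by (simp add: n_def right_diff_distrib flip: power_add)
  \<comment> \<open>The composition R L contributes the first product and D_N adds its constant.
    With X = q^N and Y = q^n everything depending on X cancels, which is why the eigenvalue does not
    involve N.\<close>
  have "- (1 - W * q ^ N * q ^ n) / q ^ n * ((q ^ n - q ^ N) / q ^ N)
      + (pprod \<alpha> h * q powi (int h + int N - 1) - 1) * (1 - q powi (- int N)) = eigenvalue n"
  proof -
    have "q ^ n \<noteq> 0" "q ^ N \<noteq> 0" using q by auto
    moreover have "- (1 - W * X * Y) / Y * ((Y - X) / X) + (W * X - 1) * (1 - 1 / X) = 1 / Y * (1 - Y) * (1 - W * Y)"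
      if "X \<noteq> 0" "Y \<noteq> 0" for X Y :: real
      using that by (simp add: field_simps)
    ultimately show ?thesis unfolding eigenvalue_def powi_h W_def
      by (simp add: power_int_minus inverse_eq_divide mult.assoc[symmetric])
  qed
  then have ev: "of_real (- (1 - W * q ^ N * q ^ n) / q ^ n) * (of_real ((q ^ n - q ^ N) / q ^ N) * z)
      + of_real ((pprod \<alpha> h * q powi (int h + int N - 1) - 1) * (1 - q powi (- int N))) * z
    = of_real (eigenvalue n) * z" for z :: complex
    by (simp only: mult.assoc[symmetric] of_real_mult[symmetric] of_real_add[symmetric] distrib_right[symmetric])
  have L: "L_op q h \<alpha> N (Qc q h \<alpha> N c) = (\<lambda>x. of_real (- (1 - W * q ^ N * q ^ n) / q ^ n) * Qc q h \<alpha> M c x)"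
    using L_op_Qc[OF c(1) nr c(2), of M] unfolding n_def[symmetric] hM M[symmetric] .
  have R: "R_op q h M (Qc q h \<alpha> M c) = (\<lambda>x. of_real ((q ^ n - q ^ N) / q ^ N) * Qc q h \<alpha> N c x)"
    using R_op_Qc[OF c(1) nr, of M] unfolding n_def[symmetric] Suc_eq_plus1[symmetric] M[symmetric] Nn .
  have NM: "N - 1 = M" using M by simp
  show "D_op q h \<alpha> N (Qc q h \<alpha> N c) x = of_real (eigenvalue (cs c)) * Qc q h \<alpha> N c x"
    unfolding D_op_eq[OF N1] NM L R_op_scale R n_def[symmetric] ev by (simp add: Qc_def)
qed

text \<open>Comparing coefficients in the basis of V gives u c (\<open>eigenvalue (cs c)\<close> -
  \<open>eigenvalue n\<close>) = 0, and distinct label sums have distinct eigenvalues.\<close>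

lemma eigenspace_eq:
  assumes "n \<le> N"
  shows "eigenspace_D q h \<alpha> N (eigenvalue n) = {f. \<exists>u. f = comb u (Qc q h \<alpha> N) (CL T n)}"
proof -
  have D: "D_op q h \<alpha> N (comb u (Qc q h \<alpha> N) I) = comb (\<lambda>c. u c * of_real (eigenvalue (cs c))) (Qc q h \<alpha> N) I"
    if "I \<subseteq> labelings T N" for u I
  proof -
    have "D_op q h \<alpha> N (comb u (Qc q h \<alpha> N) I) = comb u (\<lambda>c. D_op q h \<alpha> N (Qc q h \<alpha> N c)) I"
    proof -
      \<comment> \<open>The value of the constant is hidden: for linearity only the shape R L + K
        matters.\<close>
      obtain K where K: "D_op q h \<alpha> N f x = (if x \<in> grid h N then R_op q h (N - 1) (L_op q h \<alpha> N f) x + K * f x else 0)"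
        for f x using D_op_eq[OF N1] by blast
      show ?thesis unfolding K L_op_comb R_op_comb
        by (rule ext) (simp add: comb_def sum_distrib_left sum.distrib distrib_left mult_ac)
    qed
    also have "\<dots> = comb (\<lambda>c. u c * of_real (eigenvalue (cs c))) (Qc q h \<alpha> N) I"
      using that by (intro comb_cong) (auto simp: D_op_Qc)
    finally show ?thesis .
  qed
  show ?thesis
  proof (intro subset_antisym subsetI)
    fix f assume "f \<in> eigenspace_D q h \<alpha> N (eigenvalue n)"
    then have f: "f \<in> V h N" "D_op q h \<alpha> N f = (\<lambda>x. of_real (eigenvalue n) * f x)"
      by (auto simp: eigenspace_D_def)
    then obtain u where u: "f = comb u (Qc q h \<alpha> N) (labelings T N)" using V_eq_comb by auto
    have "comb (\<lambda>c. u c * of_real (eigenvalue (cs c) - eigenvalue n)) (Qc q h \<alpha> N) (labelings T N) = (\<lambda>_. 0)"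
    proof
      fix x
      have "comb (\<lambda>c. u c * of_real (eigenvalue (cs c) - eigenvalue n)) (Qc q h \<alpha> N) (labelings T N) x
        = comb (\<lambda>c. u c * of_real (eigenvalue (cs c))) (Qc q h \<alpha> N) (labelings T N) x - of_real (eigenvalue n) * f x"
        unfolding u comb_def sum_distrib_left sum_subtractf[symmetric]
        by (intro sum.cong refl) (simp add: algebra_simps)
      also have "\<dots> = 0" using fun_cong[OF f(2), of x] D[OF order_refl, of u] unfolding u[symmetric] by simp
      finally show "comb (\<lambda>c. u c * of_real (eigenvalue (cs c) - eigenvalue n)) (Qc q h \<alpha> N) (labelings T N) x = 0" .
    qed
    then have "u c * of_real (eigenvalue (cs c) - eigenvalue n) = 0" if "c \<in> labelings T N" for c
      using comb_Qc_eq_0[OF order_refl order_refl _ that] by blast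
    then have "u c = 0" if "c \<in> labelings T N - CL T n" for c
      using that eigenvalue_inj[of "cs c" n] assms by (auto simp: labelings_def CL_def)
    then have "f = comb u (Qc q h \<alpha> N) (CL T n)"
      unfolding u by (intro comb_mono_neutral) (use finite_card_labelings CL_labelings[OF assms] in auto)
    then show "f \<in> {f. \<exists>u. f = comb u (Qc q h \<alpha> N) (CL T n)}" by blast
  next
    fix f assume "f \<in> {f. \<exists>u. f = comb u (Qc q h \<alpha> N) (CL T n)}"
    then obtain u where u: "f = comb u (Qc q h \<alpha> N) (CL T n)" by auto
    have "f \<in> V h N" unfolding u V_def comb_def by (auto simp: Qc_def)
    moreover have "D_op q h \<alpha> N f = (\<lambda>x. of_real (eigenvalue n) * f x)"
      unfolding u D[OF CL_labelings[OF assms]]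
      by (auto simp: comb_def fun_eq_iff sum_distrib_left CL_def intro!: sum.cong)
    ultimately show "f \<in> eigenspace_D q h \<alpha> N (eigenvalue n)" by (simp add: eigenspace_D_def)
  qed
qed

end

theorem theorem5p3:
  fixes q :: real and h N :: nat and \<alpha> :: "nat \<Rightarrow> real" and T :: "unit tree"
  assumes "0 < q" and "q < 1" and "h \<ge> 2" and "N \<ge> 1"
    and "(\<forall>i\<in>{1..h}. 0 < \<alpha> i \<and> \<alpha> i < q powi (-1)) \<or> (\<forall>i\<in>{1..h}. \<alpha> i > q powi (- int N))"
    and "size1 T = h"
  shows "orthogonal_basis (V_form q h \<alpha> N) (V h N) (Qc q h \<alpha> N) (\<Union>n\<in>{0..N}. CL T n)
    \<and> (\<forall>n\<in>{0..N}.
      orthogonal_basis (V_form q h \<alpha> N) (R_chain q h n N ` Ker_L q h \<alpha> n) (Qc q h \<alpha> N) (CL T n)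
      \<and> R_chain q h n N ` Ker_L q h \<alpha> n
        = eigenspace_D q h \<alpha> N
            (q powi (- int n) * (1 - q ^ n) * (1 - pprod \<alpha> h * q powi (int h + int n - 1))))
    \<and> (\<forall>n\<in>{0..N}. \<forall>c\<in>CL T n.
      V_form q h \<alpha> N (Qc q h \<alpha> N c) (Qc q h \<alpha> N c)
      = of_real (qpoch q (pprod \<alpha> h * q ^ (h + 2 * n)) (N - n) / qpoch q q (N - n)
          * q powr (((real N - 2 * real n)^2 + real N + 2 * real n - 2 * real n ^ 2) / 2)
          * (\<Prod>U\<leftarrow>vertices 0 c. \<Gamma>v q \<alpha> U)))
    \<and> (\<forall>n\<in>{0..N}. \<forall>c\<in>CL T n. \<forall>x\<in>grid h N.
      Qc q h \<alpha> N c x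
      = of_real (q ^ ((N - n) * (N - n + 1) div 2) / qpoch q q (N - n))
        * R_chain q h n N (Qc q h \<alpha> n c) x)"
proof -
  interpret q_base q using assms by unfold_locales
  interpret q_hahn q h N \<alpha> T
    using nonresI[OF assms(1,2,4,5)] assms by unfold_locales
  have c: "size1 c = h \<and> cs c = n" if "c \<in> CL T n" for c n
    using that labelings_size[of c n] by (auto simp: CL_def labelings_def)
  show ?thesis
  proof (intro conjI ballI)
    show "orthogonal_basis (V_form q h \<alpha> N) (V h N) (Qc q h \<alpha> N) (\<Union>n\<in>{0..N}. CL T n)"
      unfolding UN_CL V_eq_comb[OF order_refl] by (rule orthogonal_basis_Qc) auto
  next
    fix n assume "n \<in> {0..N}"
    then have n: "n \<le> N" by simp
    show "orthogonal_basis (V_form q h \<alpha> N) (R_chain q h n N ` Ker_L q h \<alpha> n) (Qc q h \<alpha> N) (CL T n)"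
      unfolding R_chain_Ker_L[OF n] by (rule orthogonal_basis_Qc[OF order_refl CL_labelings[OF n]])
    show "R_chain q h n N ` Ker_L q h \<alpha> n = eigenspace_D q h \<alpha> N
        (q powi (- int n) * (1 - q ^ n) * (1 - pprod \<alpha> h * q powi (int h + int n - 1)))"
      using eigenspace_eq[OF n] R_chain_Ker_L[OF n] unfolding eigenvalue_def by simp
  next
    fix n d assume "n \<in> {0..N}" and d: "d \<in> CL T n"
    then have "rform h \<alpha> N (mqhahn q \<alpha> d) (mqhahn q \<alpha> d) = norm_formula \<alpha> d N"
      using rform_mqhahn[of \<alpha> d N N] c[OF d] nr by simp
    then show "V_form q h \<alpha> N (Qc q h \<alpha> N d) (Qc q h \<alpha> N d)
      = of_real (qpoch q (pprod \<alpha> h * q ^ (h + 2 * n)) (N - n) / qpoch q q (N - n)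
          * q powr (((real N - 2 * real n)^2 + real N + 2 * real n - 2 * real n ^ 2) / 2)
          * (\<Prod>U\<leftarrow>vertices 0 d. \<Gamma>v q \<alpha> U))"
      unfolding V_form_Qc norm_formula_def norm_exp_def \<Gamma>prod_def using c[OF d] by simp
  next
    fix n d x assume "n \<in> {0..N}" and d: "d \<in> CL T n"
    then have "R_chain q h n N (Qc q h \<alpha> n d) x
        = of_real (qpoch q q (N - n) / q ^ ((N - n) * (N - n + 1) div 2)) * Qc q h \<alpha> N d x"
      using R_chain_Qc[of d h \<alpha> N N] c[OF d] nr by simp
    then show "Qc q h \<alpha> N d x = of_real (q ^ ((N - n) * (N - n + 1) div 2) / qpoch q q (N - n))
        * R_chain q h n N (Qc q h \<alpha> n d) x"
      using qpoch_q_nz[of "N - n"] q by simp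
  qed
qed

end
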